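(* Suppose $(q_1, q_2, q_3, \dots)$ is a sequence of positive numbers such that $q_n \to 0$ as $n \to \infty$. Then there exists a real-valued strictly stationary, countable-state, irreducible, aperiodic (hence $\beta$-mixing) Markov chain $X := (X_k, k \in \mathbb{Z})$ which is reversible and has the following properties: (i) There exists a positive constant $C$ such that $P(|X_0| \leq C) = 1$. (ii) There exists a positive integer $N$ such that $\mathrm{Var}\bigl(\sum_{k=1}^n X_k\bigr) \geq q_n \cdot n^2$ for all $n \geq N$. (iii) $E[X_0^2] < \infty$ and $E[X_0] = 0$; $$\lim_{n \to \infty} n^{-1}\,\mathrm{Var}\Bigl(\sum_{k=1}^n X_k\Bigr) = \infty;$$ and for every $c > 0$, $$\lim_{n \to \infty} \Bigl[\, \sup_{r \in \mathbb{R}} P\Bigl(r - c < n^{-1/2} \sum_{k=1}^n X_k < r + c\Bigr)\Bigr] = 0.$$ (iv) There exist a strictly increasing sequence $(J(1), J(2), J(3), \dots)$ of positive integers and a sequence $(b_1, b_2, b_3, \dots)$ of positive constants satisfying $b_n \to \infty$ as $n \to \infty$, such that $$b_n^{-1} \sum_{k=1}^{J(n)} X_k \to \mu_{\mathrm{P1sL}} \quad \text{in distribution as } n \to \infty.$$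
   Context: Markov chains are indexed by the set $\mathbb{Z}$ of all integers; "countable-state" means that the state space is a finite or countably infinite subset of $\mathbb{R}$. Reversible: a strictly stationary Markov chain $(X_k, k \in \mathbb{Z})$ is reversible if the time-reversed sequence $(X_{-k}, k \in \mathbb{Z})$ has the same distribution on $\mathbb{R}^{\mathbb{Z}}$ as $(X_k, k\in\mathbb{Z})$ (equivalently, $(X_1, X_0)$ has the same distribution as $(X_0, X_1)$). Absolute regularity ($\beta$-mixing): for $\sigma$-fields $\mathcal{A}, \mathcal{B}$ on the probability space, $\beta(\mathcal{A}, \mathcal{B}) := \sup \frac12 \sum_{i=1}^I \sum_{j=1}^J |P(A_i \cap B_j) - P(A_i)P(B_j)|$, the supremum being over all pairs of finite partitions $\{A_1,\dots,A_I\}$, $\{B_1,\dots,B_J\}$ of $\Omega$ with $A_i \in \mathcal{A}$, $B_j \in \mathcal{B}$. For a strictly stationary sequence $X$, $\beta_X(n) := \beta(\sigma(X_k, k \le 0), \sigma(X_k, k \ge n))$, and $X$ is $\beta$-mixing if $\beta_X(n) \to 0$ as $n \to \infty$. The distribution $\mu_{\mathrm{P1sL}}$: the distribution of the random variable $Y := \sum_{k=1}^{N} \eta_k$ (with empty sum equal to $0$), where $\eta_1, \eta_2, \dots$ are i.i.d. with the Laplace density $\frac12 e^{-|x|}$, $x \in \mathbb{R}$, and $N$ is a Poisson random variable with mean $1$, independent of $(\eta_1, \eta_2, \dots)$. *)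

theory Defs
  imports "HOL-Probability.Probability"
begin

definition strictly_stationary :: "'w measure \<Rightarrow> (int \<Rightarrow> 'w \<Rightarrow> real) \<Rightarrow> bool" where
  "strictly_stationary M X \<longleftrightarrow>
     (\<forall>m. distr M (\<Pi>\<^sub>M k\<in>UNIV. borel) (\<lambda>\<omega> k. X (k + m) \<omega>)
        = distr M (\<Pi>\<^sub>M k\<in>UNIV. borel) (\<lambda>\<omega> k. X k \<omega>))"

definition reversible :: "'w measure \<Rightarrow> (int \<Rightarrow> 'w \<Rightarrow> real) \<Rightarrow> bool" where
  "reversible M X \<longleftrightarrow>
     distr M (\<Pi>\<^sub>M k\<in>UNIV. borel) (\<lambda>\<omega> k. X (- k) \<omega>)
   = distr M (\<Pi>\<^sub>M k\<in>UNIV. borel) (\<lambda>\<omega> k. X k \<omega>)"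

text \<open>
  Histories of probability \<open>0\<close> are excluded: there \<^const>\<open>cond_prob\<close> is \<open>0\<close> by convention (division by \<open>0\<close>).
\<close>
definition countable_state_markov_chain ::
    "'w measure \<Rightarrow> real set \<Rightarrow> (int \<Rightarrow> 'w \<Rightarrow> real) \<Rightarrow> bool" where
  "countable_state_markov_chain M S X \<longleftrightarrow>
     prob_space M \<and> countable S \<and>
     (\<forall>k. X k \<in> borel_measurable M) \<and>
     (\<forall>k. \<forall>\<omega>\<in>space M. X k \<omega> \<in> S) \<and>
     (\<forall>k (n::nat) (s :: nat \<Rightarrow> real). \<forall>t\<in>S.
        \<P>(\<omega> in M. \<forall>i\<le>n. X (k - int i) \<omega> = s i) > 0 \<longrightarrow>
        \<P>(\<omega> in M. X (k + 1) \<omega> = t \<bar> \<forall>i\<le>n. X (k - int i) \<omega> = s i)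
      = \<P>(\<omega> in M. X (k + 1) \<omega> = t \<bar> X k \<omega> = s 0))"

text \<open>
  The next two notions are meant for strictly stationary chains, whose transition probabilities
  do not depend on time. Either of them forces \<open>X 0\<close> to charge every state of \<open>S\<close>.
\<close>
definition irreducible_chain ::
    "'w measure \<Rightarrow> real set \<Rightarrow> (int \<Rightarrow> 'w \<Rightarrow> real) \<Rightarrow> bool" where
  "irreducible_chain M S X \<longleftrightarrow>
     (\<forall>s\<in>S. \<forall>t\<in>S. \<exists>n::nat. n \<ge> 1 \<and> \<P>(\<omega> in M. X (int n) \<omega> = t \<bar> X 0 \<omega> = s) > 0)"

definition aperiodic_chain ::
    "'w measure \<Rightarrow> real set \<Rightarrow> (int \<Rightarrow> 'w \<Rightarrow> real) \<Rightarrow> bool" where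
  "aperiodic_chain M S X \<longleftrightarrow>
     (\<forall>s\<in>S. Gcd {n::nat. n \<ge> 1 \<and> \<P>(\<omega> in M. X (int n) \<omega> = s \<bar> X 0 \<omega> = s) > 0} = 1)"

definition process_sigma :: "'w measure \<Rightarrow> (int \<Rightarrow> 'w \<Rightarrow> real) \<Rightarrow> int set \<Rightarrow> 'w set set" where
  "process_sigma M X K =
     sigma_sets (space M) {X k -` B \<inter> space M | k B. k \<in> K \<and> B \<in> sets borel}"

text \<open>
  \<^const>\<open>partition_on\<close> excludes empty blocks; these would not contribute to the sum.
\<close>
definition beta_coeff :: "'w measure \<Rightarrow> 'w set set \<Rightarrow> 'w set set \<Rightarrow> real" where
  "beta_coeff M \<A> \<B> =
     Sup {(1 / 2) * (\<Sum>A\<in>P. \<Sum>B\<in>Q. \<bar>measure M (A \<inter> B) - measure M A * measure M B\<bar>) | P Q.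
       finite P \<and> partition_on (space M) P \<and> P \<subseteq> \<A> \<and>
       finite Q \<and> partition_on (space M) Q \<and> Q \<subseteq> \<B>}"

definition beta_mixing :: "'w measure \<Rightarrow> (int \<Rightarrow> 'w \<Rightarrow> real) \<Rightarrow> bool" where
  "beta_mixing M X \<longleftrightarrow>
     (\<lambda>n::nat. beta_coeff M (process_sigma M X {..0}) (process_sigma M X {int n..}))
       \<longlonglongrightarrow> 0"

definition laplace_distribution :: "real measure" where
  "laplace_distribution = density lborel (\<lambda>x. ennreal (1 / 2 * exp (- \<bar>x\<bar>)))"

definition mu_P1sL :: "real measure" where
  "mu_P1sL =
     distr (measure_pmf (poisson_pmf 1) \<Otimes>\<^sub>M (\<Pi>\<^sub>M k\<in>{1::nat..}. laplace_distribution)) borel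
       (\<lambda>(N, \<eta>). \<Sum>k=1..N. \<eta> k)"

end

theory Submission
  imports Defs "HOL-Real_Asymp.Real_Asymp"
begin

text \<open>
  The chain is a superposition of independent stationary three-state chains. The chain $Z^{(m)}$ lives on
  $\{0,1,-1\}$; at each step it keeps its value with probability $\rho_m = 1 - 1/L_m$ and otherwise
  draws a fresh value from its stationary law, which charges $\pm 1$ with total mass $w_m$. Its $n$-step
  kernel is $\rho_m^n I + (1-\rho_m^n) 1 \pi_m^T$, so it is reversible and mixes geometrically. The sum
  $X_k = \sum_m 4^{-m} Z^{(m)}_k$ determines all its summands, so it is again a reversible countable-state
  Markov chain, and the mixing passes to the superposition because $\sum_m w_m$ converges.

  The weights $w_m$ are fixed and decrease superexponentially, whereas the time scales $L_m$ grow as fast as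
  we please. For $n \le L_m/2$ the component $m$ alone contributes at least $16^{-m} w_m n^2/2$
  to the variance, which beats $q_n n^2$ on a long range of $n$. On the time scale $J(m) \approx L_m/w_m$
  the component $m$ makes about Poisson(1) many excursions of random sign and geometric length with
  mean $L_m$, which produces the Laplace summands, while all other components are negligible in $L^1$ against
  $4^{-m} L_m$. Finally, every single component satisfies a central limit theorem with variance of order
  $16^{-m} w_m L_m$, which tends to infinity with $m$; this forces the characteristic function of $n^{-1/2} S_n$ to $0$ off
  the origin and hence spreads out its law.
\<close>

section \<open>Limits and characteristic functions of three-state chains\<close>

text \<open>The order of choice reconciles the variance bound with the limit law. Component m can
  beat q_n only as far as the factor 16^{-m} w_m allows, so the weights come first, then thresholds
  N_m beyond which q_n is below that factor, and only then L_m, large enough for component m to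
  serve the whole block up to N_{m+1} and to outgrow all earlier scales.

  One component is needed in two opposite regimes: n to infinity with \<rho> fixed, and \<rho> to 1
  with w to 0 along J(m). Neither excursions nor a general central limit theorem are invoked; both
  regimes rest on one non-asymptotic estimate of the characteristic function,
  \<open>cf_recursion_bound\<close>. The Laplace law enters through \<open>kap\<close>: at angle t/L
  with 1 - \<rho> = 1/L its real part tends to 1/(1+t^2).

  A path of the superposition has an infinite product over the components as its probability.
  Stationarity, reversibility and the Markov property are therefore phrased as identities between
  path probabilities without denominators, which hold factor by factor and survive the
  limit.\<close>

lemma power_one_minus_tendsto_exp:
  fixes c :: "nat \<Rightarrow> real" and J :: "nat \<Rightarrow> nat"
  assumes c0: "c \<longlonglongrightarrow> 0" and Jc: "(\<lambda>n. real (J n) * c n) \<longlonglongrightarrow> l"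
  shows "(\<lambda>n. (1 - c n) ^ J n) \<longlonglongrightarrow> exp (- l)"
proof -
  have ev: "\<forall>\<^sub>F n in sequentially. \<bar>c n\<bar> < 1/2"
    using tendstoD[OF c0, of "1/2"] by simp
  have "(\<lambda>n. 2 * \<bar>c n\<bar> * \<bar>real (J n) * c n\<bar>) \<longlonglongrightarrow> 2 * \<bar>0\<bar> * \<bar>l\<bar>"
    by (intro tendsto_intros c0 Jc)
  then have lim0: "(\<lambda>n. 2 * \<bar>c n\<bar> * \<bar>real (J n) * c n\<bar>) \<longlonglongrightarrow> 0" by simp
  \<comment> \<open>The error of the linearised logarithm is quadratic in \<open>c n\<close>, so
    even \<open>J n\<close> copies of it are of order \<open>c n\<close> times the convergent
    product \<open>J n * c n\<close>.\<close>
  have "(\<lambda>n. real (J n) * (ln (1 + - c n) - - c n)) \<longlonglongrightarrow> 0"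
  proof (rule Lim_null_comparison[OF _ lim0])
    show "\<forall>\<^sub>F n in sequentially. norm (real (J n) * (ln (1 + - c n) - - c n))
        \<le> 2 * \<bar>c n\<bar> * \<bar>real (J n) * c n\<bar>"
      using ev
    proof eventually_elim
      case (elim n)
      have "\<bar>ln (1 + - c n) - - c n\<bar> \<le> 2 * (- c n)\<^sup>2"
        by (rule abs_ln_one_plus_x_minus_x_bound) (use elim in auto)
      then have "real (J n) * \<bar>ln (1 + - c n) - - c n\<bar> \<le> real (J n) * (2 * (- c n)\<^sup>2)"
        by (intro mult_left_mono) auto
      also have "\<dots> = 2 * \<bar>c n\<bar> * \<bar>real (J n) * c n\<bar>"
        by (simp add: abs_mult power2_eq_square)
      finally show ?case by (simp add: abs_mult)
    qed
  qed
  then have "(\<lambda>n. real (J n) * (ln (1 + - c n) - - c n) - real (J n) * c n) \<longlonglongrightarrow> 0 - l"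
    by (intro tendsto_diff Jc)
  then have "(\<lambda>n. exp (real (J n) * ln (1 - c n))) \<longlonglongrightarrow> exp (- l)"
    by (intro tendsto_exp) (simp add: algebra_simps)
  moreover have "\<forall>\<^sub>F n in sequentially. exp (real (J n) * ln (1 - c n)) = (1 - c n) ^ J n"
    using ev by eventually_elim (auto simp: exp_of_nat_mult)
  ultimately show ?thesis by (rule Lim_transform_eventually)
qed

text \<open>A Gaussian bump of width \<open>c\<close> around \<open>r\<close> dominates the
  indicator up to the factor e^(1/2). The bump is itself a value of the characteristic function of
  the standard normal law, so Fubini turns the bound into an average of the characteristic function
  of \<open>Y\<close>. The centre \<open>r\<close> survives only as a phase, which makes the bound
  uniform in \<open>r\<close>.\<close>

lemma concentration_le_char:
  fixes Y :: "'a \<Rightarrow> real"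
  assumes M: "prob_space M" and Y[measurable]: "Y \<in> borel_measurable M" and c: "c > 0"
  shows "measure M {\<omega> \<in> space M. r - c < Y \<omega> \<and> Y \<omega> < r + c}
    \<le> exp (1/2) * (\<integral>x. cmod (char (distr M borel Y) (x / c)) \<partial>std_normal_distribution)"
proof -
  interpret prob_space M by fact
  interpret G: real_distribution std_normal_distribution by (rule real_dist_normal_dist)
  interpret GM: pair_prob_space std_normal_distribution M ..
  define A where "A = {\<omega> \<in> space M. r - c < Y \<omega> \<and> Y \<omega> < r + c}"
  have [measurable]: "A \<in> sets M" unfolding A_def by measurable
  have "measure M A = (\<integral>\<omega>. indicator A \<omega> \<partial>M)" by simp
  also have "\<dots> \<le> (\<integral>\<omega>. exp (1/2) * exp (- ((Y \<omega> - r) / c)\<^sup>2 / 2) \<partial>M)"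
  proof (rule integral_mono)
    show "integrable M (indicator A :: _ \<Rightarrow> real)" by (simp add: emeasure_finite less_top[symmetric])
    show "integrable M (\<lambda>\<omega>. exp (1/2) * exp (- ((Y \<omega> - r) / c)\<^sup>2 / 2))"
      by (rule integrable_const_bound[of _ "exp (1/2)"]) auto
    fix \<omega> assume "\<omega> \<in> space M"
    show "indicator A \<omega> \<le> exp (1/2) * exp (- ((Y \<omega> - r) / c)\<^sup>2 / 2)"
    proof (cases "\<omega> \<in> A")
      case True
      then have "\<bar>(Y \<omega> - r) / c\<bar> \<le> 1" using c by (auto simp: A_def field_simps)
      then have "((Y \<omega> - r) / c)\<^sup>2 \<le> 1" by (simp add: abs_square_le_1)
      then have "0 \<le> 1/2 - ((Y \<omega> - r) / c)\<^sup>2 / 2" by simp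
      then have "1 \<le> exp (1/2 + (- ((Y \<omega> - r) / c)\<^sup>2 / 2))" by simp
      then show ?thesis using True unfolding exp_add by simp
    qed simp
  qed
  also have "\<dots> = exp (1/2) * (\<integral>\<omega>. exp (- ((Y \<omega> - r) / c)\<^sup>2 / 2) \<partial>M)" by simp
  also have "(\<integral>\<omega>. exp (- ((Y \<omega> - r) / c)\<^sup>2 / 2) \<partial>M)
      \<le> (\<integral>x. cmod (char (distr M borel Y) (x / c)) \<partial>std_normal_distribution)"
  proof -
    have int: "integrable (std_normal_distribution \<Otimes>\<^sub>M M) (\<lambda>(x, \<omega>). iexp (((Y \<omega> - r) / c) * x))"
      by (rule GM.P.integrable_const_bound[of _ 1]) (auto simp: split_beta)
    have "complex_of_real (\<integral>\<omega>. exp (- ((Y \<omega> - r) / c)\<^sup>2 / 2) \<partial>M)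
        = (\<integral>\<omega>. char std_normal_distribution ((Y \<omega> - r) / c) \<partial>M)"
      by (subst integral_complex_of_real[symmetric], rule Bochner_Integration.integral_cong[OF refl])
        (simp add: char_std_normal_distribution)
    also have "\<dots> = (\<integral>\<omega>. \<integral>x. iexp (((Y \<omega> - r) / c) * x) \<partial>std_normal_distribution \<partial>M)"
      by (simp add: char_def)
    also have "\<dots> = (\<integral>x. \<integral>\<omega>. iexp (((Y \<omega> - r) / c) * x) \<partial>M \<partial>std_normal_distribution)"
      by (rule GM.Fubini_integral[OF int])
    also have "\<dots> = (\<integral>x. iexp (- r * x / c) * char (distr M borel Y) (x / c) \<partial>std_normal_distribution)"
    proof (rule Bochner_Integration.integral_cong[OF refl])
      fix x :: real
      have "iexp (((Y \<omega> - r) / c) * x) = iexp (- r * x / c) * iexp (x / c * Y \<omega>)" for \<omega>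
      proof -
        have "((Y \<omega> - r) / c) * x = - r * x / c + x / c * Y \<omega>" using c by (simp add: field_simps)
        then show ?thesis by (simp only: of_real_add distrib_left exp_add)
      qed
      then have "(\<integral>\<omega>. iexp (((Y \<omega> - r) / c) * x) \<partial>M) = (\<integral>\<omega>. iexp (- r * x / c) * iexp (x / c * Y \<omega>) \<partial>M)"
        by presburger
      also have "\<dots> = iexp (- r * x / c) * char (distr M borel Y) (x / c)"
        by (simp add: char_def integral_distr)
      finally show "(\<integral>\<omega>. iexp (((Y \<omega> - r) / c) * x) \<partial>M) = iexp (- r * x / c) * char (distr M borel Y) (x / c)" .
    qed
    finally have eq: "complex_of_real (\<integral>\<omega>. exp (- ((Y \<omega> - r) / c)\<^sup>2 / 2) \<partial>M)
        = (\<integral>x. iexp (- r * x / c) * char (distr M borel Y) (x / c) \<partial>std_normal_distribution)" .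
    have "\<bar>\<integral>\<omega>. exp (- ((Y \<omega> - r) / c)\<^sup>2 / 2) \<partial>M\<bar>
        = cmod (\<integral>x. iexp (- r * x / c) * char (distr M borel Y) (x / c) \<partial>std_normal_distribution)"
      by (simp only: eq[symmetric] norm_of_real)
    also have "\<dots> \<le> (\<integral>x. cmod (iexp (- r * x / c) * char (distr M borel Y) (x / c)) \<partial>std_normal_distribution)"
      by (rule integral_norm_bound)
    also have "\<dots> = (\<integral>x. cmod (char (distr M borel Y) (x / c)) \<partial>std_normal_distribution)"
      by (simp add: norm_mult)
    finally show ?thesis by linarith
  qed
  finally show ?thesis by (simp add: A_def mult_left_mono)
qed

text \<open>Decay off the origin is enough: at 0 every characteristic function equals 1, but the
  normal law does not charge 0, and dominated convergence applies to the bound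
  \<open>concentration_le_char\<close>.\<close>

lemma concentration_tendsto_0:
  fixes Y :: "nat \<Rightarrow> 'a \<Rightarrow> real"
  assumes M: "prob_space M" and Y: "\<And>n. Y n \<in> borel_measurable M" and c: "c > 0"
    and char0: "\<And>t. t \<noteq> 0 \<Longrightarrow> (\<lambda>n. char (distr M borel (Y n)) t) \<longlonglongrightarrow> 0"
  shows "(\<lambda>n. SUP r. measure M {\<omega> \<in> space M. r - c < Y n \<omega> \<and> Y n \<omega> < r + c}) \<longlonglongrightarrow> 0"
proof -
  interpret prob_space M by fact
  interpret G: real_distribution std_normal_distribution by (rule real_dist_normal_dist)
  define B where "B n = exp (1/2) * (\<integral>x. cmod (char (distr M borel (Y n)) (x / c)) \<partial>std_normal_distribution)" for n
  have rd: "real_distribution (distr M borel (Y n))" for n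
    using Y by (rule real_distribution_distr)
  note [measurable] = real_distribution.char_measurable[OF rd]
  have mes: "(\<lambda>x. cmod (char (distr M borel (Y n)) (x / c))) \<in> borel_measurable borel" for n
    by measurable
  have [simp]: "AE x in std_normal_distribution. x \<noteq> (0::real)"
  proof -
    have "AE x in lborel. x \<noteq> (0::real)" by (rule AE_lborel_singleton)
    then show ?thesis by (subst AE_density) (auto elim: eventually_mono)
  qed
  have "(\<lambda>n. \<integral>x. cmod (char (distr M borel (Y n)) (x / c)) \<partial>std_normal_distribution) \<longlonglongrightarrow> (\<integral>x. 0 \<partial>std_normal_distribution)"
  proof (rule integral_dominated_convergence[where w="\<lambda>_. 1"])
    have "AE x in std_normal_distribution. x \<noteq> (0::real)" by simp
    then show "AE x in std_normal_distribution. (\<lambda>n. cmod (char (distr M borel (Y n)) (x / c))) \<longlonglongrightarrow> 0"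
    proof eventually_elim
      case (elim x)
      then show ?case using char0[of "x / c"] c by (intro tendsto_norm_zero) auto
    qed
    show "AE x in std_normal_distribution. norm (cmod (char (distr M borel (Y n)) (x / c))) \<le> 1" for n
      using real_distribution.cmod_char_le_1[OF rd] by (intro AE_I2) simp
    show "(\<lambda>x. cmod (char (distr M borel (Y n)) (x / c))) \<in> borel_measurable std_normal_distribution" for n
      using mes[of n] by simp
  qed simp_all
  then have I0: "(\<lambda>n. \<integral>x. cmod (char (distr M borel (Y n)) (x / c)) \<partial>std_normal_distribution) \<longlonglongrightarrow> 0"
    by simp
  have B0: "B \<longlonglongrightarrow> 0"
    using tendsto_mult_left[OF I0, of "exp (1/2)"] by (simp add: B_def[abs_def])
  have bdd: "bdd_above (range (\<lambda>r. measure M {\<omega> \<in> space M. r - c < Y n \<omega> \<and> Y n \<omega> < r + c}))" for n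
    by (rule bdd_aboveI[of _ 1]) auto
  show ?thesis
  proof (rule tendsto_sandwich[OF _ _ tendsto_const B0])
    show "\<forall>\<^sub>F n in sequentially. 0 \<le> (SUP r. measure M {\<omega> \<in> space M. r - c < Y n \<omega> \<and> Y n \<omega> < r + c})"
      by (intro always_eventually allI cSUP_upper2[OF bdd, of 0]) auto
    show "\<forall>\<^sub>F n in sequentially. (SUP r. measure M {\<omega> \<in> space M. r - c < Y n \<omega> \<and> Y n \<omega> < r + c}) \<le> B n"
    proof (intro always_eventually allI)
      fix n
      show "(SUP r. measure M {\<omega> \<in> space M. r - c < Y n \<omega> \<and> Y n \<omega> < r + c}) \<le> B n"
        unfolding B_def by (rule cSUP_least[OF UNIV_not_empty concentration_le_char[OF M Y c]])
    qed
  qed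
qed

section \<open>Slow-fast recursion for the characteristic function of a three-state chain\<close>

lemma norm_one_minus_of_real: "0 \<le> r \<Longrightarrow> r \<le> 1 \<Longrightarrow> cmod (1 - complex_of_real r) = 1 - r"
  by (metis abs_of_nonneg diff_ge_0_iff_ge norm_of_real of_real_1 of_real_diff)

text \<open>
  In the recursion of \<open>cf_recursion_bound\<close> the sequence $x$ varies slowly while $z^+$ and $z^-$ relax
  quickly; \<open>kap\<close> is the quasi-stationary ratio $z^+/x$.
\<close>
definition kap :: "real \<Rightarrow> complex \<Rightarrow> complex" where
  "kap \<rho> e = (1 - \<rho>) * e / (1 - \<rho> * e)"

lemma
  fixes e :: complex and \<rho> :: real
  assumes e: "cmod e = 1" and r: "0 < \<rho>" "\<rho> < 1"
  shows norm_one_minus_mult_ge: "1 - \<rho> \<le> cmod (1 - \<rho> * e)"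
    and kap_denom_nonzero: "1 - \<rho> * e \<noteq> 0"
proof -
  have "1 - \<rho> = cmod 1 - cmod (\<rho> * e)" using e r by (simp add: norm_mult)
  also have "\<dots> \<le> cmod (1 - \<rho> * e)" by (rule norm_triangle_ineq2)
  finally show "1 - \<rho> \<le> cmod (1 - \<rho> * e)" .
  then show "1 - \<rho> * e \<noteq> 0" using r by auto
qed

text \<open>\<open>kap \<rho> e\<close> is the series of (1 - \<rho>) \<rho>^(k-1) e^k over k \<ge>
  1, the generating function of a geometric excursion length with mean 1/(1 - \<rho>). The fixed
  point equation is the step rule of \<open>zp\<close> below with \<open>H\<close> frozen at 1. The
  bounds by \<open>cmod (1 - e)\<close> make the error terms vanish when \<rho> is fixed and
  \<open>e\<close> tends to 1.\<close>

lemma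
  fixes e :: complex and \<rho> :: real
  assumes e: "cmod e = 1" and r: "0 < \<rho>" "\<rho> < 1"
  shows norm_kap_le: "cmod (kap \<rho> e) \<le> 1"
    and norm_one_minus_kap_le: "cmod (1 - kap \<rho> e) \<le> cmod (1 - e) / (1 - \<rho>)"
    and norm_minus_kap_le: "cmod (e - kap \<rho> e) \<le> cmod (1 - e) / (1 - \<rho>)"
    and kap_fixpoint: "kap \<rho> e = e * (\<rho> * kap \<rho> e + (1 - \<rho>))"
proof -
  note d = kap_denom_nonzero[OF assms] and le = norm_one_minus_mult_ge[OF assms]
  have nz: "0 < cmod (1 - \<rho> * e)" using d by simp
  have 1: "1 - kap \<rho> e = (1 - e) / (1 - \<rho> * e)"
    using d by (simp add: kap_def field_simps)
  have 2: "e - kap \<rho> e = e * \<rho> * (1 - e) / (1 - \<rho> * e)"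
    using d by (simp add: kap_def field_simps)
  have "cmod (kap \<rho> e) = (1 - \<rho>) / cmod (1 - \<rho> * e)"
    using e r by (simp add: kap_def norm_divide norm_mult norm_one_minus_of_real)
  also have "\<dots> \<le> 1" using le nz by simp
  finally show "cmod (kap \<rho> e) \<le> 1" .
  have m: "cmod (1 - e) / cmod (1 - \<rho> * e) \<le> cmod (1 - e) / (1 - \<rho>)"
    using le r nz by (intro divide_left_mono mult_pos_pos) auto
  then show "cmod (1 - kap \<rho> e) \<le> cmod (1 - e) / (1 - \<rho>)"
    by (simp add: 1 norm_divide)
  have "cmod (e - kap \<rho> e) = \<rho> * (cmod (1 - e) / cmod (1 - \<rho> * e))"
    using e r by (simp add: 2 norm_divide norm_mult)
  also have "\<dots> \<le> 1 * (cmod (1 - e) / cmod (1 - \<rho> * e))"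
    using r by (intro mult_right_mono) auto
  finally show "cmod (e - kap \<rho> e) \<le> cmod (1 - e) / (1 - \<rho>)" using m by linarith
  show "kap \<rho> e = e * (\<rho> * kap \<rho> e + (1 - \<rho>))"
    using d by (simp add: kap_def field_simps)
qed

text \<open>Both asymptotic regimes are read off from this exact expression: \<theta> to 0 with
  \<rho> fixed, and \<theta> proportional to 1 - \<rho>.\<close>

lemma one_minus_Re_kap:
  assumes r: "0 < \<rho>" "\<rho> < 1"
  shows "1 - Re (kap \<rho> (cis \<theta>)) = (1 + \<rho>) * (1 - cos \<theta>) / ((1 - \<rho>)\<^sup>2 + 2 * \<rho> * (1 - cos \<theta>))"
proof -
  have d: "1 - \<rho> * cis \<theta> \<noteq> 0" by (rule kap_denom_nonzero) (use r in auto)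
  have sc: "sin \<theta> * sin \<theta> = 1 - cos \<theta> * cos \<theta>"
    using sin_cos_squared_add2[of \<theta>] by (simp add: power2_eq_square algebra_simps)
  have n2: "(Re (1 - \<rho> * cis \<theta>))\<^sup>2 + (Im (1 - \<rho> * cis \<theta>))\<^sup>2 = (1 - \<rho>)\<^sup>2 + 2 * \<rho> * (1 - cos \<theta>)"
    by (simp add: power2_eq_square algebra_simps sc)
  have pos: "0 < (1 - \<rho>)\<^sup>2 + 2 * \<rho> * (1 - cos \<theta>)"
    using r by (intro add_pos_nonneg) auto
  have "Re (kap \<rho> (cis \<theta>)) = (1 - \<rho>) * (cos \<theta> - \<rho>) / ((1 - \<rho>)\<^sup>2 + 2 * \<rho> * (1 - cos \<theta>))"
    unfolding kap_def Re_divide n2 by (simp add: algebra_simps sc)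
  then show ?thesis using pos
    by (simp add: field_simps) (simp add: power2_eq_square algebra_simps)
qed

text \<open>In the application \<open>x\<close>, \<open>zp\<close>, \<open>zm\<close> are the
  conditional expectations of the phase given that the chain currently sits at 0, 1, -1, and
  \<open>H\<close> is the characteristic function. If \<open>zp\<close> and \<open>zm\<close> are
  replaced by \<open>kap\<close> and its conjugate times \<open>x\<close>, then \<open>H - x\<close>
  becomes \<open>- w * \<delta> * x\<close>, and \<open>x\<close> is multiplied by the factor in the
  claim at each step. The proof controls the deviation from this idealised motion: it starts at
  \<open>E\<close>, contracts at a rate of order 1 - \<rho>, and is fed only by the drift of
  \<open>x\<close>, which is small of order \<open>w\<close>.\<close>

lemma cf_recursion_bound:
  fixes x zp zm H :: "nat \<Rightarrow> complex" and e :: complex and w \<rho> :: real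
  assumes e: "cmod e = 1" and r: "0 < \<rho>" "\<rho> < 1" and w: "0 \<le> w" "w \<le> 1/4"
    and init: "x 0 = 1" "zp 0 = 1" "zm 0 = 1"
    and H: "\<And>n. H n = (1 - w) * x n + w / 2 * (zp n + zm n)"
    and x: "\<And>n. x (Suc n) = \<rho> * x n + (1 - \<rho>) * H n"
    and zp: "\<And>n. zp (Suc n) = e * (\<rho> * zp n + (1 - \<rho>) * H n)"
    and zm: "\<And>n. zm (Suc n) = cnj e * (\<rho> * zm n + (1 - \<rho>) * H n)"
  defines "\<delta> \<equiv> 1 - Re (kap \<rho> e)" and "\<eta> \<equiv> cmod (e - kap \<rho> e)" and "E \<equiv> cmod (1 - kap \<rho> e)"
  shows "cmod (H n - of_real ((1 - (1 - \<rho>) * w * \<delta>) ^ n))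
    \<le> 3 * w * E + 2 * real n * (1 - \<rho>) * w\<^sup>2 * \<eta> * \<delta> + 2 * w\<^sup>2 * \<eta> * \<delta> + w * \<delta>"
proof -
  define k where "k = kap \<rho> e"
  define f where "f = (1 - (1 - \<rho>) * w * \<delta>)"
  have nk: "cmod k \<le> 1" unfolding k_def by (rule norm_kap_le[OF e r])
  have fixk: "k = e * (\<rho> * k + (1 - \<rho>))" using kap_fixpoint[OF e r] by (simp add: k_def)
  have fixc: "cnj k = cnj e * (\<rho> * cnj k + (1 - \<rho>))"
    by (subst fixk) simp
  have "\<bar>Re k\<bar> \<le> 1" using abs_Re_le_cmod[of k] nk by linarith
  then have d: "0 \<le> \<delta>" "\<delta> \<le> 2" by (auto simp: \<delta>_def k_def)
  have eta: "0 \<le> \<eta>" "\<eta> \<le> 2"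
    using norm_triangle_ineq4[of e k] nk e by (auto simp: \<eta>_def k_def)
  have wd: "0 \<le> (1 - \<rho>) * w * \<delta>" "(1 - \<rho>) * w * \<delta> \<le> 1"
  proof -
    show "0 \<le> (1 - \<rho>) * w * \<delta>" using r w d by simp
    have "(1 - \<rho>) * w * \<delta> \<le> 1 * (1/4) * 2" using r w d by (intro mult_mono) auto
    then show "(1 - \<rho>) * w * \<delta> \<le> 1" by simp
  qed
  have f: "0 \<le> f" "f \<le> 1" using wd by (auto simp: f_def)
  define ep where "ep n = zp n - k * x n" for n
  define em where "em n = zm n - cnj k * x n" for n
  define M where "M n = max (cmod (ep n)) (cmod (em n))" for n
  have M0: "M 0 = E"
  proof -
    have "cmod (1 - cnj k) = cmod (1 - k)"
      by (metis complex_cnj_diff complex_cnj_one complex_mod_cnj)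
    then show ?thesis by (simp add: M_def ep_def em_def init E_def k_def)
  qed
  have conv: "cmod (\<rho> * a + (1 - \<rho>) * b) \<le> 1" if "cmod a \<le> 1" "cmod b \<le> 1" for a b :: complex
  proof -
    have "cmod (\<rho> * a + (1 - \<rho>) * b) \<le> cmod (\<rho> * a) + cmod ((1 - \<rho>) * b)" by (rule norm_triangle_ineq)
    also have "\<dots> = \<rho> * cmod a + (1 - \<rho>) * cmod b"
      using r by (simp add: norm_mult norm_one_minus_of_real)
    also have "\<dots> \<le> \<rho> * 1 + (1 - \<rho>) * 1" using that r by (intro add_mono mult_left_mono) auto
    finally show ?thesis by simp
  qed
  have nH: "cmod (H n) \<le> 1" if "cmod (x n) \<le> 1" "cmod (zp n) \<le> 1" "cmod (zm n) \<le> 1" for n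
  proof -
    have "cmod (H n) \<le> cmod ((1 - w) * x n) + cmod (w / 2 * (zp n + zm n))"
      unfolding H by (rule norm_triangle_ineq)
    also have "\<dots> = (1 - w) * cmod (x n) + w / 2 * cmod (zp n + zm n)"
    proof -
      have "cmod (complex_of_real (w / 2)) = w / 2" using w by (subst norm_of_real) simp
      then show ?thesis using w by (simp add: norm_mult norm_divide norm_one_minus_of_real)
    qed
    also have "\<dots> \<le> (1 - w) * 1 + w / 2 * (1 + 1)"
      using that w norm_triangle_ineq[of "zp n" "zm n"] by (intro add_mono mult_left_mono) auto
    finally show ?thesis by simp
  qed
  have bd: "cmod (x n) \<le> 1 \<and> cmod (zp n) \<le> 1 \<and> cmod (zm n) \<le> 1" for n
  proof (induction n)
    case (Suc n)
    then show ?case using nH[of n] conv[of "x n" "H n"] conv[of "zp n" "H n"] conv[of "zm n" "H n"] e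
      by (simp add: x zp zm norm_mult)
  qed (simp add: init)
  \<comment> \<open>The two conjugate ratios average to a real part, so the main term is real and
    involves \<open>\<delta>\<close> only.\<close>
  have Hx: "H n - x n = w / 2 * (ep n + em n) - w * \<delta> * x n" for n
  proof -
    have d2: "complex_of_real \<delta> = 1 - (k + cnj k) / 2"
      by (simp add: \<delta>_def k_def complex_add_cnj)
    show ?thesis unfolding of_real_mult d2 by (simp add: H ep_def em_def field_simps)
  qed
  have nw2: "cmod (complex_of_real w / 2) = w / 2" using w by (simp add: norm_divide)
  have nepem: "cmod (w / 2 * (ep n + em n)) \<le> w * M n" for n
  proof -
    have "cmod (ep n + em n) \<le> cmod (ep n) + cmod (em n)" by (rule norm_triangle_ineq)
    also have "\<dots> \<le> 2 * M n" by (auto simp: M_def)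
    finally have "w / 2 * cmod (ep n + em n) \<le> w / 2 * (2 * M n)" using w by (intro mult_left_mono) auto
    then show ?thesis by (simp add: norm_mult norm_divide w)
  qed
  have nHx: "cmod (H n - x n) \<le> w * M n + w * \<delta>" for n
  proof -
    have "cmod (H n - x n) \<le> cmod (w / 2 * (ep n + em n)) + cmod (w * \<delta> * x n)"
      unfolding Hx by (rule norm_triangle_ineq4)
    also have "cmod (w * \<delta> * x n) \<le> w * \<delta> * 1"
      using w d bd[of n] by (simp add: norm_mult mult_left_le)
    finally show ?thesis using nepem[of n] by linarith
  qed
  \<comment> \<open>The fixed point equation of \<open>kap\<close> cancels what is proportional to
    \<open>x n\<close>; the source that remains is a multiple of the increment (1 - \<rho>) (H - x)
    of the slow sequence.\<close>
  have epS: "ep (Suc n) = e * \<rho> * ep n + (1 - \<rho>) * (e - k) * (H n - x n)" for n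
  proof -
    have "k * x n = e * (\<rho> * k + (1 - \<rho>)) * x n" using fixk by simp
    then show ?thesis unfolding ep_def x zp by (simp add: algebra_simps)
  qed
  have emS: "em (Suc n) = cnj e * \<rho> * em n + (1 - \<rho>) * (cnj e - cnj k) * (H n - x n)" for n
  proof -
    have "cnj k * x n = cnj e * (\<rho> * cnj k + (1 - \<rho>)) * x n" using fixc by simp
    then show ?thesis unfolding em_def x zm by (simp add: algebra_simps)
  qed
  have n1: "cmod (1 - complex_of_real \<rho>) = 1 - \<rho>"
    using r by (simp add: norm_one_minus_of_real)
  have step: "cmod (e' * \<rho> * u + (1 - \<rho>) * (e' - k') * v) \<le> \<rho> * cmod u + (1 - \<rho>) * \<eta> * cmod v"
    if "cmod e' = 1" "cmod (e' - k') = \<eta>" for e' k' u v :: complex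
    using norm_triangle_ineq[of "e' * \<rho> * u" "(1 - \<rho>) * (e' - k') * v"] that r
    by (simp add: norm_mult n1)
  have MS: "M (Suc n) \<le> \<rho> * M n + (1 - \<rho>) * \<eta> * (w * M n + w * \<delta>)" for n
  proof -
    have c: "cmod (cnj e - cnj k) = \<eta>"
      by (metis complex_cnj_diff complex_mod_cnj \<eta>_def k_def)
    have a: "(1 - \<rho>) * \<eta> * cmod (H n - x n) \<le> (1 - \<rho>) * \<eta> * (w * M n + w * \<delta>)"
      using r eta by (intro mult_left_mono nHx) auto
    have b: "\<rho> * cmod (ep n) \<le> \<rho> * M n" "\<rho> * cmod (em n) \<le> \<rho> * M n"
      using r by (auto simp: M_def)
    have "cmod (ep (Suc n)) \<le> \<rho> * cmod (ep n) + (1 - \<rho>) * \<eta> * cmod (H n - x n)"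
      unfolding epS by (rule step) (auto simp: e \<eta>_def k_def)
    moreover have "cmod (em (Suc n)) \<le> \<rho> * cmod (em n) + (1 - \<rho>) * \<eta> * cmod (H n - x n)"
      unfolding emS by (rule step) (auto simp: e c)
    ultimately show ?thesis using a b unfolding M_def[of "Suc n"] by (simp add: max_def)
  qed
  have Mpos: "0 \<le> M n" for n by (simp add: M_def le_max_iff_disj)
  \<comment> \<open>With \<open>w \<le> 1/4\<close> the feedback of the deviation through
    \<open>H - x\<close> uses up at most half of the contraction.\<close>
  have etaw: "\<eta> * w \<le> 1/2"
  proof -
    have "\<eta> * w \<le> 2 * (1/4)" using eta w by (intro mult_mono) auto
    then show ?thesis by simp
  qed
  have MS': "M (Suc n) \<le> M n - (1 - \<rho>) / 2 * M n + (1 - \<rho>) * \<eta> * w * \<delta>" for n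
  proof -
    have "(1 - \<rho>) * M n * (\<eta> * w) \<le> (1 - \<rho>) * M n * (1/2)"
      using r Mpos etaw by (intro mult_left_mono) auto
    then show ?thesis using MS[of n] by (simp add: field_simps)
  qed
  \<comment> \<open>\<open>2 * w * \<eta> * \<delta>\<close> is the fixed point of the recursion in
    \<open>MS'\<close>, and \<open>E\<close> is the initial value.\<close>
  have Mbd: "M n \<le> E + 2 * w * \<eta> * \<delta>" for n
  proof (induction n)
    case 0
    then show ?case using w eta d by (simp add: M0)
  next
    case (Suc n)
    have "M (Suc n) \<le> (1 + \<rho>) / 2 * M n + (1 - \<rho>) * \<eta> * w * \<delta>"
      using MS'[of n] by (simp add: field_simps)
    also have "\<dots> \<le> (1 + \<rho>) / 2 * (E + 2 * w * \<eta> * \<delta>) + (1 - \<rho>) * \<eta> * w * \<delta>"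
      using mult_left_mono[OF Suc, of "(1 + \<rho>) / 2"] r by simp
    also have "\<dots> = E + 2 * w * \<eta> * \<delta> - (1 - \<rho>) / 2 * E" by (simp add: field_simps)
    also have "\<dots> \<le> E + 2 * w * \<eta> * \<delta>" using r by (simp add: E_def)
    finally show ?case .
  qed
  have xS: "x (Suc n) = f * x n + (1 - \<rho>) * (w / 2 * (ep n + em n))" for n
  proof -
    have "x (Suc n) = x n + (1 - \<rho>) * (H n - x n)" by (simp add: x algebra_simps)
    also have "\<dots> = f * x n + (1 - \<rho>) * (w / 2 * (ep n + em n))"
      unfolding Hx f_def by (simp add: algebra_simps)
    finally show ?thesis .
  qed
  \<comment> \<open>The multiple \<open>2 * w\<close> of the fast deviation \<open>M\<close> pays for the drift it causes in \<open>x\<close>, so the sum increases only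
    through the source term of the recursion for \<open>M\<close>.\<close>
  have err: "cmod (x n - of_real (f ^ n)) + 2 * w * M n \<le> 2 * w * E + 2 * real n * (1 - \<rho>) * w\<^sup>2 * \<eta> * \<delta>" for n
  proof (induction n)
    case 0
    then show ?case by (simp add: init M0)
  next
    case (Suc n)
    have "x (Suc n) - of_real (f ^ Suc n) = f * (x n - of_real (f ^ n)) + (1 - \<rho>) * (w / 2 * (ep n + em n))"
      by (simp add: xS algebra_simps)
    then have "cmod (x (Suc n) - of_real (f ^ Suc n)) \<le> cmod (f * (x n - of_real (f ^ n))) + cmod ((1 - \<rho>) * (w / 2 * (ep n + em n)))"
      by (metis norm_triangle_ineq)
    also have "\<dots> \<le> cmod (x n - of_real (f ^ n)) + (1 - \<rho>) * (w * M n)"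
    proof (rule add_mono)
      show "cmod (f * (x n - of_real (f ^ n))) \<le> cmod (x n - of_real (f ^ n))"
        using f by (simp add: norm_mult mult_left_le_one_le)
      have "cmod ((1 - \<rho>) * (w / 2 * (ep n + em n))) = (1 - \<rho>) * cmod (w / 2 * (ep n + em n))"
        by (subst norm_mult) (simp add: n1)
      also have "\<dots> \<le> (1 - \<rho>) * (w * M n)" using nepem[of n] r by (intro mult_left_mono) auto
      finally show "cmod ((1 - \<rho>) * (w / 2 * (ep n + em n))) \<le> (1 - \<rho>) * (w * M n)" .
    qed
    finally have 1: "cmod (x (Suc n) - of_real (f ^ Suc n)) \<le> cmod (x n - of_real (f ^ n)) + (1 - \<rho>) * (w * M n)" .
    have 2: "2 * w * M (Suc n) \<le> 2 * w * (M n - (1 - \<rho>) / 2 * M n + (1 - \<rho>) * \<eta> * w * \<delta>)"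
      using MS'[of n] w by (intro mult_left_mono) auto
    have "2 * w * (M n - (1 - \<rho>) / 2 * M n + (1 - \<rho>) * \<eta> * w * \<delta>)
      = 2 * w * M n - (1 - \<rho>) * (w * M n) + 2 * (1 - \<rho>) * w\<^sup>2 * \<eta> * \<delta>"
      by (simp add: field_simps power2_eq_square)
    moreover have "2 * real (Suc n) * (1 - \<rho>) * w\<^sup>2 * \<eta> * \<delta>
      = 2 * real n * (1 - \<rho>) * w\<^sup>2 * \<eta> * \<delta> + 2 * (1 - \<rho>) * w\<^sup>2 * \<eta> * \<delta>"
      by (simp add: algebra_simps)
    ultimately show ?case using 1 2 Suc by linarith
  qed
  \<comment> \<open>The passage from \<open>x\<close> to \<open>H\<close> adds
    \<open>w * M n + w * \<delta>\<close>: this is the third copy of \<open>w * E\<close> and the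
    source of the two further terms without the factor \<open>n\<close>.\<close>
  have "cmod (H n - of_real (f ^ n)) \<le> cmod (H n - x n) + cmod (x n - of_real (f ^ n))"
    using norm_triangle_ineq[of "H n - x n" "x n - of_real (f ^ n)"] by simp
  also have "\<dots> \<le> (w * M n + w * \<delta>) + (2 * w * E + 2 * real n * (1 - \<rho>) * w\<^sup>2 * \<eta> * \<delta>)"
  proof (rule add_mono[OF nHx])
    have "0 \<le> 2 * w * M n" using w Mpos by simp
    then show "cmod (x n - of_real (f ^ n)) \<le> 2 * w * E + 2 * real n * (1 - \<rho>) * w\<^sup>2 * \<eta> * \<delta>"
      using err[of n] by linarith
  qed
  also have "w * M n \<le> w * (E + 2 * w * \<eta> * \<delta>)" using w Mbd by (intro mult_left_mono) auto
  finally show ?thesis unfolding f_def by (simp add: algebra_simps power2_eq_square)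
qed

section \<open>From path probabilities to the chain properties\<close>

definition cyl :: "'w measure \<Rightarrow> (int \<Rightarrow> 'w \<Rightarrow> real) \<Rightarrow> int set \<Rightarrow> (int \<Rightarrow> real) \<Rightarrow> 'w set" where
  "cyl M X I s = {\<omega> \<in> space M. \<forall>i\<in>I. X i \<omega> = s i}"

lemma sets_cyl [measurable]:
  assumes "finite I" "\<And>k. X k \<in> borel_measurable M"
  shows "cyl M X I s \<in> sets M"
  using assms by (auto simp: cyl_def intro!: sets.sets_Collect_finite_All)

text \<open>Refines a condition on the times in \<open>J\<close> to full paths over
  \<open>I\<close>. When \<open>I\<close> is finite and \<open>S\<close> countable, the union is
  countable and path probabilities determine the event.\<close>

lemma cyl_eq_Union:
  assumes X: "\<And>k \<omega>. \<omega> \<in> space M \<Longrightarrow> X k \<omega> \<in> S" and JI: "J \<subseteq> I"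
  shows "{\<omega> \<in> space M. \<forall>j\<in>J. X j \<omega> \<in> A j} = (\<Union>s\<in>{s \<in> I \<rightarrow>\<^sub>E S. \<forall>j\<in>J. s j \<in> A j}. cyl M X I s)"
    (is "?L = ?R")
proof (intro equalityI subsetI)
  fix \<omega> assume "\<omega> \<in> ?L"
  then have "restrict (\<lambda>k. X k \<omega>) I \<in> {s \<in> I \<rightarrow>\<^sub>E S. \<forall>j\<in>J. s j \<in> A j}" "\<omega> \<in> cyl M X I (restrict (\<lambda>k. X k \<omega>) I)"
    using X JI by (auto simp: cyl_def subset_iff)
  then show "\<omega> \<in> ?R" by blast
qed (use JI in \<open>auto simp: cyl_def\<close>)

lemma disjoint_cyl: "disjoint_family_on (cyl M X I) (I \<rightarrow>\<^sub>E S)"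
  unfolding disjoint_family_on_def
proof (intro ballI impI)
  fix s t assume st: "s \<in> I \<rightarrow>\<^sub>E S" "t \<in> I \<rightarrow>\<^sub>E S" "s \<noteq> t"
  then obtain i where "i \<in> I" "s i \<noteq> t i" using PiE_ext[OF st(1,2)] by blast
  then show "cyl M X I s \<inter> cyl M X I t = {}" by (force simp: cyl_def)
qed

text \<open>Over nested windows two cylinders are either comparable or disjoint, which is why the
  empty set is adjoined.\<close>

lemma Int_stable_cyl:
  assumes chain: "\<And>I J. I \<in> F \<Longrightarrow> J \<in> F \<Longrightarrow> I \<subseteq> J \<or> J \<subseteq> I"
  shows "Int_stable (insert {} {cyl M X I s |I s. I \<in> F})"
proof (rule Int_stableI)
  have *: "cyl M X I s \<inter> cyl M X J s' \<in> insert {} {cyl M X I s |I s. I \<in> F}" if "I \<subseteq> J" "J \<in> F" for I J s s'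
  proof (cases "\<forall>i\<in>I. s i = s' i")
    case True
    then have "cyl M X I s \<inter> cyl M X J s' = cyl M X J s'" using that by (auto simp: cyl_def)
    then show ?thesis using that by blast
  next
    case False
    then have "cyl M X I s \<inter> cyl M X J s' = {}" using that by (force simp: cyl_def)
    then show ?thesis by simp
  qed
  fix a b assume a: "a \<in> insert {} {cyl M X I s |I s. I \<in> F}" and b: "b \<in> insert {} {cyl M X I s |I s. I \<in> F}"
  show "a \<inter> b \<in> insert {} {cyl M X I s |I s. I \<in> F}"
  proof (cases "a = {} \<or> b = {}")
    case False
    then obtain I s J s' where ab: "a = cyl M X I s" "I \<in> F" "b = cyl M X J s'" "J \<in> F" using a b by auto
    then show ?thesis using chain[of I J] *[of I J s s'] *[of J I s' s] by (auto simp: Int_commute)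
  qed auto
qed

lemma process_sigma_subset_cyl:
  assumes X: "\<And>k \<omega>. \<omega> \<in> space M \<Longrightarrow> X k \<omega> \<in> S" and S: "countable S"
    and F: "\<And>k. k \<in> K \<Longrightarrow> \<exists>I\<in>F. k \<in> I \<and> finite I"
  shows "process_sigma M X K \<subseteq> sigma_sets (space M) (insert {} {cyl M X I s |I s. I \<in> F})"
  unfolding process_sigma_def
proof (rule sigma_sets_mono, safe)
  fix k and B :: "real set" assume "k \<in> K" "B \<in> sets borel"
  then obtain I where I: "I \<in> F" "k \<in> I" "finite I" using F by blast
  have "X k -` B \<inter> space M = {\<omega> \<in> space M. \<forall>j\<in>{k}. X j \<omega> \<in> B}" by auto
  also have "\<dots> = (\<Union>s\<in>{s \<in> I \<rightarrow>\<^sub>E S. \<forall>j\<in>{k}. s j \<in> B}. cyl M X I s)"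
    using I by (intro cyl_eq_Union[OF X]) auto
  also have "\<dots> \<in> sigma_sets (space M) (insert {} {cyl M X I s |I s. I \<in> F})"
  proof (rule sigma_sets_UNION)
    have "countable (I \<rightarrow>\<^sub>E S)" using I S by (intro countable_PiE) auto
    then show "countable (cyl M X I ` {s \<in> I \<rightarrow>\<^sub>E S. \<forall>j\<in>{k}. s j \<in> B})"
      by (intro countable_image) (rule countable_subset[rotated], auto)
  qed (use I in blast)
  finally show "X k -` B \<inter> space M \<in> sigma_sets (space M) (insert {} {cyl M X I s |I s. I \<in> F})" .
qed

text \<open>Any finite set of times lies in a symmetric window, and a finite-dimensional event is a
  countable disjoint union of window paths. Paths with values outside \<open>S\<close> never occur,
  so path formulas are only asked for inside \<open>S\<close>.\<close>

lemma distr_eq_of_windows: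
  fixes X Y :: "int \<Rightarrow> 'w \<Rightarrow> real"
  assumes M: "prob_space M" and S: "countable S"
    and X: "\<And>k. X k \<in> borel_measurable M" "\<And>k \<omega>. \<omega> \<in> space M \<Longrightarrow> X k \<omega> \<in> S"
    and Y: "\<And>k. Y k \<in> borel_measurable M" "\<And>k \<omega>. \<omega> \<in> space M \<Longrightarrow> Y k \<omega> \<in> S"
    and eq: "\<And>n s. \<forall>i\<in>{-n..n}. s i \<in> S \<Longrightarrow> measure M (cyl M X {-n..n} s) = measure M (cyl M Y {-n..n} s)"
  shows "distr M (\<Pi>\<^sub>M k\<in>UNIV. borel) (\<lambda>\<omega> k. X k \<omega>) = distr M (\<Pi>\<^sub>M k\<in>UNIV. borel) (\<lambda>\<omega> k. Y k \<omega>)"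
proof -
  interpret prob_space M by fact
  have meas: "(\<lambda>\<omega> k. Z k \<omega>) \<in> measurable M (\<Pi>\<^sub>M k\<in>UNIV. borel)" if "\<And>k. Z k \<in> borel_measurable M" for Z :: "int \<Rightarrow> 'w \<Rightarrow> real"
    using that by (intro measurable_PiM_single') (auto simp: space_PiM)
  have em: "emeasure M {\<omega> \<in> space M. \<forall>j\<in>J. Z j \<omega> \<in> A j}
      = (\<integral>\<^sup>+s. emeasure M (cyl M Z {-n..n} s) \<partial>count_space {s \<in> {-n..n} \<rightarrow>\<^sub>E S. \<forall>j\<in>J. s j \<in> A j})"
    if Z: "\<And>k. Z k \<in> borel_measurable M" "\<And>k \<omega>. \<omega> \<in> space M \<Longrightarrow> Z k \<omega> \<in> S" and J: "J \<subseteq> {-n..n}"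
    for Z :: "int \<Rightarrow> 'w \<Rightarrow> real" and A J n
  proof (subst cyl_eq_Union[of M Z S J "{-n..n}" A], rule Z(2), assumption, rule J, rule emeasure_UN_countable)
    have "countable ({-n..n} \<rightarrow>\<^sub>E S)" using S by (intro countable_PiE) auto
    then show "countable {s \<in> {-n..n} \<rightarrow>\<^sub>E S. \<forall>j\<in>J. s j \<in> A j}"
      by (rule countable_subset[rotated]) auto
    show "disjoint_family_on (cyl M Z {-n..n}) {s \<in> {-n..n} \<rightarrow>\<^sub>E S. \<forall>j\<in>J. s j \<in> A j}"
      by (rule disjoint_family_on_mono[OF _ disjoint_cyl]) auto
  qed (use Z in auto)
  show ?thesis
  proof (rule measure_eqI_PiM_infinite)
    show "finite_measure (distr M (\<Pi>\<^sub>M k\<in>UNIV. borel) (\<lambda>\<omega> k. X k \<omega>))"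
      by (intro finite_measure_distr meas X)
    fix A :: "int \<Rightarrow> real set" and J :: "int set"
    assume J: "finite J" "J \<subseteq> UNIV" and A: "\<And>i. i \<in> J \<Longrightarrow> A i \<in> sets borel"
    obtain n where n: "J \<subseteq> {-n..n}"
    proof
      show "J \<subseteq> {- Max (abs ` insert 0 J)..Max (abs ` insert 0 J)}"
      proof
        fix x assume "x \<in> J"
        then have "\<bar>x\<bar> \<le> Max (abs ` insert 0 J)" using J by (intro Max_ge) auto
        then show "x \<in> {- Max (abs ` insert 0 J)..Max (abs ` insert 0 J)}" by auto
      qed
    qed
    have pre: "emeasure (distr M (\<Pi>\<^sub>M k\<in>UNIV. borel) (\<lambda>\<omega> k. Z k \<omega>)) (prod_emb UNIV (\<lambda>_. borel) J (Pi\<^sub>E J A))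
       = emeasure M {\<omega> \<in> space M. \<forall>j\<in>J. Z j \<omega> \<in> A j}" if "\<And>k. Z k \<in> borel_measurable M" for Z :: "int \<Rightarrow> 'w \<Rightarrow> real"
    proof (subst emeasure_distr[OF meas[OF that]])
      show "prod_emb UNIV (\<lambda>_. borel) J (Pi\<^sub>E J A) \<in> sets (\<Pi>\<^sub>M k\<in>UNIV. borel)"
        using J A by (intro sets_PiM_I) auto
    qed (auto intro!: arg_cong[where f="emeasure M"] simp: prod_emb_def space_PiM PiE_iff)
    show "emeasure (distr M (\<Pi>\<^sub>M k\<in>UNIV. borel) (\<lambda>\<omega> k. X k \<omega>)) (prod_emb UNIV (\<lambda>_. borel) J (Pi\<^sub>E J A))
      = emeasure (distr M (\<Pi>\<^sub>M k\<in>UNIV. borel) (\<lambda>\<omega> k. Y k \<omega>)) (prod_emb UNIV (\<lambda>_. borel) J (Pi\<^sub>E J A))"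
      unfolding pre[OF X(1)] pre[OF Y(1)]
    proof (rule trans[OF em[OF X n] trans[OF _ em[OF Y n, symmetric]]])
      show "(\<integral>\<^sup>+s. emeasure M (cyl M X {-n..n} s) \<partial>count_space {s \<in> {-n..n} \<rightarrow>\<^sub>E S. \<forall>j\<in>J. s j \<in> A j})
        = (\<integral>\<^sup>+s. emeasure M (cyl M Y {-n..n} s) \<partial>count_space {s \<in> {-n..n} \<rightarrow>\<^sub>E S. \<forall>j\<in>J. s j \<in> A j})"
        by (intro nn_integral_cong) (auto simp: emeasure_eq_measure PiE_iff intro!: eq)
    qed assumption+
  qed auto
qed

text \<open>\<open>markov\<close> is the Markov property at time \<open>k\<close> cleared of
  denominators and symmetric in past and future; it makes sense for null paths and passes to limits
  of products. \<open>charge\<close> gives every one-step transition positive mass, from which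
  irreducibility and aperiodicity follow at once. \<open>asymp_indep\<close> is only pointwise in
  the pair of states; uniformity over partitions is gained in \<open>beta_sum_le\<close>.\<close>

locale window_chain = prob_space M for M :: "'w measure" +
  fixes S :: "real set" and X :: "int \<Rightarrow> 'w \<Rightarrow> real"
  assumes S: "countable S"
    and X_meas [measurable]: "\<And>k. X k \<in> borel_measurable M"
    and X_in: "\<And>k \<omega>. \<omega> \<in> space M \<Longrightarrow> X k \<omega> \<in> S"
    and shift: "\<And>a b m s. \<forall>i\<in>{a..b}. s i \<in> S \<Longrightarrow>
      prob (cyl M (\<lambda>k. X (k + m)) {a..b} s) = prob (cyl M X {a..b} s)"
    and reflect: "\<And>a b s. \<forall>i\<in>{a..b}. s i \<in> S \<Longrightarrow>
      prob (cyl M (\<lambda>k. X (- k)) {a..b} s) = prob (cyl M X {a..b} s)"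
    and markov: "\<And>a b k s. a \<le> k \<Longrightarrow> k \<le> b \<Longrightarrow> \<forall>i\<in>{a..b}. s i \<in> S \<Longrightarrow>
      prob (cyl M X {a..b} s) * prob (cyl M X {k..k} s) = prob (cyl M X {a..k} s) * prob (cyl M X {k..b} s)"
    and charge: "\<And>s t. s \<in> S \<Longrightarrow> t \<in> S \<Longrightarrow> prob {\<omega> \<in> space M. X 0 \<omega> = s \<and> X 1 \<omega> = t} > 0"
    and asymp_indep: "\<And>s t. s \<in> S \<Longrightarrow> t \<in> S \<Longrightarrow>
      (\<lambda>n. prob {\<omega> \<in> space M. X 0 \<omega> = s \<and> X (int n) \<omega> = t})
        \<longlonglongrightarrow> prob {\<omega> \<in> space M. X 0 \<omega> = s} * prob {\<omega> \<in> space M. X 0 \<omega> = t}"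
begin

section \<open>Stationarity, reversibility, irreducibility, aperiodicity and the Markov
  property\<close>

lemma sets_cyl' [measurable]: "finite I \<Longrightarrow> cyl M X I s \<in> events"
  by (rule sets_cyl) auto

lemma prob_X_pos: "s \<in> S \<Longrightarrow> 0 < prob {\<omega> \<in> space M. X 0 \<omega> = s}"
  by (rule less_le_trans[OF charge[of s s]]) (auto intro!: finite_measure_mono)

lemma prob_X_shift: "prob {\<omega> \<in> space M. X k \<omega> = s} = prob {\<omega> \<in> space M. X 0 \<omega> = s}"
proof (cases "s \<in> S")
  case True
  then show ?thesis using shift[of 0 0 "\<lambda>_. s" k] by (simp add: cyl_def)
next
  case False
  then have e: "{\<omega> \<in> space M. X j \<omega> = s} = {}" for j using X_in by auto
  show ?thesis unfolding e ..
qed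

lemma stationary: "strictly_stationary M X"
  unfolding strictly_stationary_def
  by (intro allI distr_eq_of_windows[OF prob_space_axioms S]) (auto simp: X_in intro!: shift)

lemma reversible: "reversible M X"
  unfolding reversible_def
  by (intro distr_eq_of_windows[OF prob_space_axioms S]) (auto simp: X_in intro!: reflect)

lemma irreducible: "irreducible_chain M S X"
  unfolding irreducible_chain_def cond_prob_def
proof (intro ballI exI[of _ "1::nat"] conjI)
  fix s t assume "s \<in> S" "t \<in> S"
  then show "0 < prob {\<omega> \<in> space M. X (int 1) \<omega> = t \<and> X 0 \<omega> = s} / prob {\<omega> \<in> space M. X 0 \<omega> = s}"
    using charge[of s t] prob_X_pos[of s] by (simp add: conj_commute)
qed simp

lemma aperiodic: "aperiodic_chain M S X"
  unfolding aperiodic_chain_def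
proof
  fix s assume s: "s \<in> S"
  have "1 \<in> {n::nat. n \<ge> 1 \<and> \<P>(\<omega> in M. X (int n) \<omega> = s \<bar> X 0 \<omega> = s) > 0}"
    using charge[OF s s] prob_X_pos[OF s] by (simp add: cond_prob_def conj_commute)
  then have "Gcd {n::nat. n \<ge> 1 \<and> \<P>(\<omega> in M. X (int n) \<omega> = s \<bar> X 0 \<omega> = s) > 0} dvd 1"
    by (rule Gcd_dvd)
  then show "Gcd {n::nat. n \<ge> 1 \<and> \<P>(\<omega> in M. X (int n) \<omega> = s \<bar> X 0 \<omega> = s) > 0} = 1" by simp
qed

lemma countable_markov: "countable_state_markov_chain M S X"
  unfolding countable_state_markov_chain_def
proof (intro conjI allI ballI impI)
  fix k :: int and n :: nat and s :: "nat \<Rightarrow> real" and t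
  assume t: "t \<in> S" and pos: "0 < prob {\<omega> \<in> space M. \<forall>i\<le>n. X (k - int i) \<omega> = s i}"
  let ?H = "{\<omega> \<in> space M. \<forall>i\<le>n. X (k - int i) \<omega> = s i}"
  \<comment> \<open>A history of positive probability is attained at some sample point and therefore
    runs inside \<open>S\<close>.\<close>
  from pos have "?H \<noteq> {}" by (metis less_irrefl measure_empty)
  then obtain \<omega>0 where w0: "\<omega>0 \<in> space M" "\<And>i. i \<le> n \<Longrightarrow> X (k - int i) \<omega>0 = s i" by auto
  then have sS: "s i \<in> S" if "i \<le> n" for i using X_in[of \<omega>0 "k - int i"] that by simp
  \<comment> \<open>\<open>s\<close> lists the history backwards from time \<open>k\<close>;
    \<open>s'\<close> reorders it by absolute time and appends \<open>t\<close> at time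
    \<open>k + 1\<close>.\<close>
  define s' where "s' j = (if j = k + 1 then t else s (nat (k - j)))" for j
  have inS: "\<forall>i\<in>{k - int n..k + 1}. s' i \<in> S"
    using t sS by (auto simp: s'_def)
  have H: "cyl M X {k - int n..k} s' = ?H"
  proof (intro equalityI subsetI)
    fix \<omega> assume "\<omega> \<in> cyl M X {k - int n..k} s'"
    then have *: "\<omega> \<in> space M" "\<And>j. k - int n \<le> j \<Longrightarrow> j \<le> k \<Longrightarrow> X j \<omega> = s' j" by (auto simp: cyl_def)
    have "X (k - int i) \<omega> = s i" if "i \<le> n" for i
      using *(2)[of "k - int i"] that by (simp add: s'_def)
    then show "\<omega> \<in> ?H" using * by simp
  next
    fix \<omega> assume w: "\<omega> \<in> ?H"
    have "X j \<omega> = s' j" if "j \<in> {k - int n..k}" for j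
    proof -
      have "nat (k - j) \<le> n" and j: "k - int (nat (k - j)) = j" "j \<noteq> k + 1" using that by auto
      then have "X (k - int (nat (k - j))) \<omega> = s (nat (k - j))" using w by blast
      then show ?thesis unfolding j(1) using j(2) by (simp add: s'_def)
    qed
    then show "\<omega> \<in> cyl M X {k - int n..k} s'" using w by (simp add: cyl_def)
  qed
  have split: "{k - int n..k + 1} = insert (k + 1) {k - int n..k}" by auto
  have H1: "cyl M X {k - int n..k + 1} s' = {\<omega> \<in> space M. X (k + 1) \<omega> = t \<and> (\<forall>i\<le>n. X (k - int i) \<omega> = s i)}"
  proof -
    have "cyl M X {k - int n..k + 1} s' = {\<omega> \<in> space M. X (k + 1) \<omega> = t} \<inter> cyl M X {k - int n..k} s'"
      unfolding split by (auto simp: cyl_def s'_def)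
    then show ?thesis unfolding H by auto
  qed
  have K: "cyl M X {k..k} s' = {\<omega> \<in> space M. X k \<omega> = s 0}" by (auto simp: cyl_def s'_def)
  have kk: "{k..k + 1} = {k, k + 1}" by auto
  have K1: "cyl M X {k..k + 1} s' = {\<omega> \<in> space M. X (k + 1) \<omega> = t \<and> X k \<omega> = s 0}"
    unfolding kk by (auto simp: cyl_def s'_def)
  have "prob {\<omega> \<in> space M. X k \<omega> = s 0} > 0"
    using prob_X_shift[of k "s 0"] prob_X_pos[of "s 0"] sS by simp
  moreover have "prob (cyl M X {k - int n..k + 1} s') * prob (cyl M X {k..k} s')
      = prob (cyl M X {k - int n..k} s') * prob (cyl M X {k..k + 1} s')"
    by (rule markov) (use inS in auto)
  ultimately show "\<P>(\<omega> in M. X (k + 1) \<omega> = t \<bar> \<forall>i\<le>n. X (k - int i) \<omega> = s i) = \<P>(\<omega> in M. X (k + 1) \<omega> = t \<bar> X k \<omega> = s 0)"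
    using pos unfolding cond_prob_def H H1 K K1 by (simp add: field_simps)
qed (use prob_space_axioms S X_in in auto)

section \<open>Conditional independence of past and future, and absolute regularity\<close>

lemma process_sigma_events: "process_sigma M X K \<subseteq> events"
  unfolding process_sigma_def by (intro sets.sigma_sets_subset) (auto intro: measurable_sets)

text \<open>A path that leaves \<open>S\<close> already does so in one of the two pieces, so both
  sides vanish and the restriction to \<open>S\<close> disappears.\<close>

lemma markov_cyl:
  assumes "a \<le> k" "k \<le> b"
  shows "prob (cyl M X {a..b} s) * prob (cyl M X {k..k} s) = prob (cyl M X {a..k} s) * prob (cyl M X {k..b} s)"
proof (cases "\<forall>i\<in>{a..b}. s i \<in> S")
  case True
  then show ?thesis using markov assms by blast
next
  case False
  then obtain i where i: "i \<in> {a..b}" "s i \<notin> S" by blast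
  then have "X i \<omega> \<noteq> s i" if "\<omega> \<in> space M" for \<omega> using X_in[OF that, of i] by auto
  then have e: "cyl M X I s = {}" if "i \<in> I" for I using that by (auto simp: cyl_def)
  have "i \<in> {a..k} \<or> i \<in> {k..b}" using i by auto
  then show ?thesis using e[OF i(1)] e[of "{a..k}"] e[of "{k..b}"] by auto
qed

text \<open>Under the law conditioned on \<open>D\<close>, past and future cylinders are independent
  by \<open>markov_cyl\<close>. The windows that end, respectively start, at \<open>k\<close> are
  nested, so both families are stable under intersection and independence extends to the generated
  \<sigma>-algebras.\<close>

lemma past_future_indep:
  assumes A: "A \<in> process_sigma M X {..k}" and B: "B \<in> process_sigma M X {k..}" and x: "x \<in> S"
  defines "D \<equiv> {\<omega> \<in> space M. X k \<omega> = x}"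
  shows "prob (A \<inter> B \<inter> D) * prob D = prob (A \<inter> D) * prob (B \<inter> D)"
proof -
  have D: "D \<in> events" "0 < prob D" using prob_X_shift[of k x] prob_X_pos[OF x] by (auto simp: D_def)
  then have D0: "emeasure M D \<noteq> 0" "emeasure M D \<noteq> \<infinity>" by (auto simp: emeasure_eq_measure)
  define N where "N = uniform_measure M D"
  have N[simp]: "space N = space M" "sets N = sets M" by (auto simp: N_def)
  interpret N: prob_space N unfolding N_def by (rule prob_space_uniform_measure[OF D0])
  have mN: "measure N E = prob (E \<inter> D) / prob D" if "E \<in> events" for E
    using that D0 by (simp add: N_def Int_commute)
  let ?G = "\<lambda>F. insert {} {cyl M X I s |I s. I \<in> F}"
  let ?P = "range (\<lambda>a. {a..k})" and ?Q = "range (\<lambda>b. {k..b})"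
  have "N.indep_set (?G ?P) (?G ?Q)"
  proof (rule N.indep_setI)
    show "?G ?P \<subseteq> N.events" "?G ?Q \<subseteq> N.events" by auto
    fix u v assume uv: "u \<in> ?G ?P" "v \<in> ?G ?Q"
    show "N.prob (u \<inter> v) = N.prob u * N.prob v"
    proof (cases "u = {} \<or> v = {}")
      case False
      then obtain a s b s' where u: "u = cyl M X {a..k} s" and v: "v = cyl M X {k..b} s'" using uv by auto
      have [simp]: "u \<in> events" "v \<in> events" by (auto simp: u v)
      have "prob (u \<inter> v \<inter> D) * prob D = prob (u \<inter> D) * prob (v \<inter> D)"
      proof (cases "a \<le> k \<and> k \<le> b \<and> s k = x \<and> s' k = x")
        case True
        \<comment> \<open>Both paths take the value \<open>x\<close> at time \<open>k\<close>, so
          they can be glued there.\<close>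
        define s'' where "s'' i = (if i \<le> k then s i else s' i)" for i
        have 1: "u \<inter> D = cyl M X {a..k} s''" using True by (auto simp: u D_def cyl_def s''_def)
        have 2: "v \<inter> D = cyl M X {k..b} s''"
        proof -
          have *: "s'' i = s' i" if "k \<le> i" for i using that True by (auto simp: s''_def)
          have "D = {\<omega> \<in> space M. X k \<omega> = s' k}" using True by (simp add: D_def)
          moreover have "cyl M X {k..b} s'' = cyl M X {k..b} s'" by (auto simp: cyl_def *)
          ultimately show ?thesis using True by (auto simp: v cyl_def)
        qed
        have sp: "{a..b} = {a..k} \<union> {k..b}" using True by auto
        have 3: "u \<inter> v \<inter> D = cyl M X {a..b} s''"
        proof -
          have "u \<inter> v \<inter> D = (u \<inter> D) \<inter> (v \<inter> D)" by auto
          also have "\<dots> = cyl M X {a..b} s''" unfolding 1 2 sp cyl_def by blast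
          finally show ?thesis .
        qed
        have 4: "D = cyl M X {k..k} s''" using True by (auto simp: D_def cyl_def s''_def)
        show ?thesis unfolding 1 2 3 unfolding 4 by (rule markov_cyl) (use True in auto)
      next
        case False
        \<comment> \<open>Degenerate cases: an empty window gives the whole space, and a path with
          the wrong value at \<open>k\<close> misses \<open>D\<close>.\<close>
        then consider "\<not> a \<le> k" | "\<not> k \<le> b" | "a \<le> k" "s k \<noteq> x" | "k \<le> b" "s' k \<noteq> x" by blast
        then show ?thesis
        proof cases
          case 1
          then have "u = space M" by (auto simp: u cyl_def)
          moreover have "space M \<inter> v \<inter> D = v \<inter> D" "space M \<inter> D = D" using sets.sets_into_space[OF D(1)] by auto
          ultimately show ?thesis by simp
        next
          case 2
          then have "v = space M" by (auto simp: v cyl_def)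
          moreover have "u \<inter> space M \<inter> D = u \<inter> D" "space M \<inter> D = D" using sets.sets_into_space[OF D(1)] by auto
          ultimately show ?thesis by simp
        next
          case 3
          then have "u \<inter> D = {}" by (auto simp: u D_def cyl_def)
          moreover then have "u \<inter> v \<inter> D = {}" by auto
          ultimately show ?thesis by simp
        next
          case 4
          then have "v \<inter> D = {}" by (auto simp: v D_def cyl_def)
          moreover then have "u \<inter> v \<inter> D = {}" by auto
          ultimately show ?thesis by simp
        qed
      qed
      then show ?thesis using D mN[OF sets.Int[OF \<open>u \<in> events\<close> \<open>v \<in> events\<close>]] by (simp add: mN field_simps)
    qed auto
  qed
  then have I: "N.indep_set (sigma_sets (space N) (?G ?P)) (sigma_sets (space N) (?G ?Q))"
  proof (rule N.indep_set_sigma_sets)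
    show "Int_stable (?G ?P)" by (rule Int_stable_cyl) force
    show "Int_stable (?G ?Q)" by (rule Int_stable_cyl) force
  qed
  have P: "process_sigma M X {..k} \<subseteq> sigma_sets (space N) (?G ?P)"
    unfolding N(1) by (rule process_sigma_subset_cyl[OF X_in S]) force+
  have Q: "process_sigma M X {k..} \<subseteq> sigma_sets (space N) (?G ?Q)"
    unfolding N(1) by (rule process_sigma_subset_cyl[OF X_in S]) force+
  have "N.prob (A \<inter> B) = N.prob A * N.prob B"
    by (rule N.indep_setD[OF I subsetD[OF P A] subsetD[OF Q B]])
  moreover have "A \<in> events" "B \<in> events" using A B process_sigma_events by auto
  ultimately show ?thesis using D mN[OF sets.Int[of A M B]] by (simp add: mN field_simps)
qed

lemma process_sigma_mono: "K \<subseteq> L \<Longrightarrow> process_sigma M X K \<subseteq> process_sigma M X L"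
  unfolding process_sigma_def by (rule sigma_sets_mono') blast

lemma process_sigma_X: "k \<in> K \<Longrightarrow> {\<omega> \<in> space M. X k \<omega> = x} \<in> process_sigma M X K"
proof -
  assume "k \<in> K"
  then have "X k -` {x} \<inter> space M \<in> process_sigma M X K"
    unfolding process_sigma_def by (intro sigma_sets.Basic) (auto intro!: exI[of _ "{x}"])
  moreover have "X k -` {x} \<inter> space M = {\<omega> \<in> space M. X k \<omega> = x}" by auto
  ultimately show ?thesis by simp
qed

lemma process_sigma_Int:
  assumes "A \<in> process_sigma M X K" "B \<in> process_sigma M X K"
  shows "A \<inter> B \<in> process_sigma M X K"
proof -
  interpret sigma_algebra "space M" "process_sigma M X K"
    unfolding process_sigma_def by (rule sigma_algebra_sigma_sets) auto
  show ?thesis using assms by auto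
qed

text \<open>Conditional independence is applied twice, at time \<open>n\<close> with
  \<open>A \<inter> C\<close> in the past and at time 0 with \<open>D\<close> in the future. The
  dependence between \<open>A\<close> and \<open>B\<close> is thereby reduced to the ratio by which
  \<open>C\<close> and \<open>D\<close> fail to be independent.\<close>

lemma four_point:
  assumes A: "A \<in> process_sigma M X {..0}" and B: "B \<in> process_sigma M X {int n..}" and s: "s \<in> S" and t: "t \<in> S"
  defines "C \<equiv> {\<omega> \<in> space M. X 0 \<omega> = s}" and "D \<equiv> {\<omega> \<in> space M. X (int n) \<omega> = t}"
  shows "prob (A \<inter> C \<inter> (B \<inter> D)) = prob (A \<inter> C) * prob (B \<inter> D) * prob (C \<inter> D) / (prob C * prob D)"
proof -
  have pos: "0 < prob C" "0 < prob D"
    using prob_X_pos[OF s] prob_X_pos[OF t] prob_X_shift[of "int n" t] by (auto simp: C_def D_def)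
  have A': "A \<in> process_sigma M X {..int n}" using A process_sigma_mono[of "{..0}" "{..int n}"] by auto
  have C': "C \<in> process_sigma M X {..int n}" unfolding C_def by (rule process_sigma_X) auto
  have "prob (A \<inter> C \<inter> B \<inter> D) * prob D = prob (A \<inter> C \<inter> D) * prob (B \<inter> D)"
    unfolding D_def by (rule past_future_indep[OF process_sigma_Int[OF A' C'] B t])
  moreover have "prob (A \<inter> D \<inter> C) * prob C = prob (A \<inter> C) * prob (D \<inter> C)"
    unfolding C_def by (rule past_future_indep[OF A _ s]) (auto simp: D_def intro: process_sigma_X)
  moreover have "A \<inter> D \<inter> C = A \<inter> C \<inter> D" "D \<inter> C = C \<inter> D" "A \<inter> C \<inter> B \<inter> D = A \<inter> C \<inter> (B \<inter> D)" by auto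
  ultimately have "prob (A \<inter> C \<inter> (B \<inter> D)) * prob D = prob (A \<inter> C \<inter> D) * prob (B \<inter> D)"
    "prob (A \<inter> C \<inter> D) * prob C = prob (A \<inter> C) * prob (C \<inter> D)" by simp_all
  then have "prob (A \<inter> C \<inter> D) = prob (A \<inter> C) * prob (C \<inter> D) / prob C"
    "prob (A \<inter> C \<inter> (B \<inter> D)) = prob (A \<inter> C \<inter> D) * prob (B \<inter> D) / prob D"
    using pos by (simp_all add: field_simps)
  then show ?thesis by simp
qed

lemma sum_prob_partition:
  assumes P: "finite P" "partition_on (space M) P" "P \<subseteq> events" and C: "C \<in> events"
  shows "(\<Sum>A\<in>P. prob (A \<inter> C)) = prob C"
proof -
  have "(\<Sum>A\<in>P. prob (A \<inter> C)) = prob (\<Union>A\<in>P. A \<inter> C)"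
  proof (rule finite_measure_finite_Union[symmetric])
    show "disjoint_family_on (\<lambda>A. A \<inter> C) P"
      using partition_onD2[OF P(2)] by (auto simp: disjoint_family_on_def disjoint_def)
  qed (use P C in auto)
  also have "(\<Union>A\<in>P. A \<inter> C) = C"
    using partition_onD1[OF P(2)] sets.sets_into_space[OF C] by auto
  finally show ?thesis .
qed

text \<open>
  Past and future interact only through $(X_0, X_n)$. Cutting down to a finite set $F$ of states keeps all
  sums finite and costs at most $4\varepsilon$, uniformly in the partitions.
\<close>
lemma beta_sum_le:
  assumes F: "finite F" "F \<subseteq> S" and e: "prob {\<omega> \<in> space M. X 0 \<omega> \<notin> F} \<le> \<epsilon>"
    and P: "finite P" "partition_on (space M) P" "P \<subseteq> process_sigma M X {..0}"
    and Q: "finite Q" "partition_on (space M) Q" "Q \<subseteq> process_sigma M X {int n..}"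
  shows "(\<Sum>A\<in>P. \<Sum>B\<in>Q. \<bar>prob (A \<inter> B) - prob A * prob B\<bar>)
    \<le> 4 * \<epsilon> + (\<Sum>s\<in>F. \<Sum>t\<in>F. \<bar>prob {\<omega> \<in> space M. X 0 \<omega> = s \<and> X (int n) \<omega> = t}
        - prob {\<omega> \<in> space M. X 0 \<omega> = s} * prob {\<omega> \<in> space M. X 0 \<omega> = t}\<bar>)"
proof -
  define C where "C s = {\<omega> \<in> space M. X 0 \<omega> = s}" for s
  define D where "D t = {\<omega> \<in> space M. X (int n) \<omega> = t}" for t
  define C' where "C' = {\<omega> \<in> space M. X 0 \<omega> \<notin> F}"
  define D' where "D' = {\<omega> \<in> space M. X (int n) \<omega> \<notin> F}"
  define d where "d s t = \<bar>prob (C s \<inter> D t) - prob (C s) * prob (D t)\<bar>" for s t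
  have Pe: "P \<subseteq> events" and Qe: "Q \<subseteq> events" using P Q process_sigma_events by blast+
  have Fb: "F \<in> sets borel" using F by (simp add: finite_imp_closed)
  have [measurable]: "C s \<in> events" "D s \<in> events" for s unfolding C_def D_def by measurable
  have C'm[measurable]: "C' \<in> events"
    using measurable_sets[OF X_meas[of 0], of "- F"] Fb by (simp add: C'_def vimage_def Int_def conj_commute)
  have D'm[measurable]: "D' \<in> events"
    using measurable_sets[OF X_meas[of "int n"], of "- F"] Fb by (simp add: D'_def vimage_def Int_def conj_commute)
  have C'e: "prob C' \<le> \<epsilon>" using e by (simp add: C'_def)
  \<comment> \<open>Stationarity is at hand for single states, hence the detour through the
    complement and a finite sum.\<close>
  have D'e: "prob D' \<le> \<epsilon>"
  proof -
    have "prob (space M - C') = prob (\<Union>s\<in>F. C s)" by (rule arg_cong[where f=prob]) (auto simp: C_def C'_def)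
    also have "\<dots> = (\<Sum>s\<in>F. prob (C s))" using F
      by (intro finite_measure_finite_Union) (auto simp: disjoint_family_on_def C_def)
    also have "\<dots> = (\<Sum>s\<in>F. prob (D s))" by (simp add: C_def D_def prob_X_shift[of "int n"])
    also have "\<dots> = prob (\<Union>s\<in>F. D s)" using F
      by (intro finite_measure_finite_Union[symmetric]) (auto simp: disjoint_family_on_def D_def)
    also have "\<dots> = prob (space M - D')" by (rule arg_cong[where f=prob]) (auto simp: D_def D'_def)
    finally show ?thesis using C'e by (simp add: prob_compl)
  qed
  have splitF: "prob (A \<inter> E) = prob (A \<inter> E \<inter> {\<omega> \<in> space M. X k \<omega> \<notin> F}) + (\<Sum>s\<in>F. prob (A \<inter> E \<inter> {\<omega> \<in> space M. X k \<omega> = s}))"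
    if [measurable]: "A \<in> events" "E \<in> events" and N[measurable]: "{\<omega> \<in> space M. X k \<omega> \<notin> F} \<in> events" for A E k
  proof -
    have "prob (A \<inter> E) = prob ((A \<inter> E \<inter> {\<omega> \<in> space M. X k \<omega> \<notin> F}) \<union> (\<Union>s\<in>F. A \<inter> E \<inter> {\<omega> \<in> space M. X k \<omega> = s}))"
      using sets.sets_into_space[OF that(1)] by (intro arg_cong[where f=prob]) auto
    also have "\<dots> = prob (A \<inter> E \<inter> {\<omega> \<in> space M. X k \<omega> \<notin> F}) + prob (\<Union>s\<in>F. A \<inter> E \<inter> {\<omega> \<in> space M. X k \<omega> = s})"
      using F N that by (intro finite_measure_Union sets.finite_UN) auto
    also have "prob (\<Union>s\<in>F. A \<inter> E \<inter> {\<omega> \<in> space M. X k \<omega> = s}) = (\<Sum>s\<in>F. prob (A \<inter> E \<inter> {\<omega> \<in> space M. X k \<omega> = s}))"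
      using F that by (intro finite_measure_finite_Union) (auto simp: disjoint_family_on_def)
    finally show ?thesis .
  qed
  \<comment> \<open>Once both times are confined to \<open>F\<close>, joint probability and product
    split over the cells \<open>(s, t)\<close>; by \<open>four_point\<close> their difference on a
    cell is \<open>prob (A \<inter> C s) * prob (B \<inter> D t)\<close> times the relative
    dependence of \<open>C s\<close> and \<open>D t\<close>. Each of the four correction terms will
    sum to at most \<open>\<epsilon>\<close> over the partitions.\<close>
  have pt: "\<bar>prob (A \<inter> B) - prob A * prob B\<bar>
      \<le> prob (A \<inter> (B \<inter> C')) + prob (A \<inter> (B \<inter> D')) + prob (A \<inter> C') * prob B + prob A * prob (B \<inter> D')
        + (\<Sum>s\<in>F. \<Sum>t\<in>F. prob (A \<inter> C s) * prob (B \<inter> D t) * (d s t / (prob (C s) * prob (D t))))"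
    if AP: "A \<in> P" and BQ: "B \<in> Q" for A B
  proof -
    have Ae[measurable]: "A \<in> events" and Be[measurable]: "B \<in> events" using AP BQ Pe Qe by auto
    define T where "T = (\<Sum>s\<in>F. \<Sum>t\<in>F. prob (A \<inter> C s \<inter> (B \<inter> D t)))"
    have 1: "prob (A \<inter> B) = prob (A \<inter> B \<inter> C') + (\<Sum>s\<in>F. prob (A \<inter> B \<inter> C s))"
      unfolding C_def C'_def by (rule splitF[OF Ae Be C'm[unfolded C'_def]])
    have 2: "prob (A \<inter> B \<inter> C s) = prob (A \<inter> B \<inter> C s \<inter> D') + (\<Sum>t\<in>F. prob (A \<inter> B \<inter> C s \<inter> D t))" for s
      unfolding D_def D'_def by (rule splitF[OF _ _ D'm[unfolded D'_def]]) auto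
    have 3: "(\<Sum>s\<in>F. prob (A \<inter> B \<inter> C s \<inter> D')) \<le> prob (A \<inter> (B \<inter> D'))"
    proof -
      have "(\<Sum>s\<in>F. prob (A \<inter> B \<inter> C s \<inter> D')) = prob (\<Union>s\<in>F. A \<inter> B \<inter> C s \<inter> D')"
        using F by (intro finite_measure_finite_Union[symmetric]) (auto simp: disjoint_family_on_def C_def)
      also have "\<dots> \<le> prob (A \<inter> (B \<inter> D'))" by (intro finite_measure_mono) auto
      finally show ?thesis .
    qed
    have T: "(\<Sum>s\<in>F. \<Sum>t\<in>F. prob (A \<inter> B \<inter> C s \<inter> D t)) = T"
      unfolding T_def by (intro sum.cong refl arg_cong[where f=prob]) auto
    have "0 \<le> (\<Sum>s\<in>F. prob (A \<inter> B \<inter> C s \<inter> D'))" by (intro sum_nonneg) simp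
    moreover have "prob (A \<inter> B) = prob (A \<inter> B \<inter> C') + ((\<Sum>s\<in>F. prob (A \<inter> B \<inter> C s \<inter> D')) + T)"
      by (simp only: 1 2 sum.distrib T)
    ultimately have up: "\<bar>prob (A \<inter> B) - T\<bar> \<le> prob (A \<inter> (B \<inter> C')) + prob (A \<inter> (B \<inter> D'))"
      using 3 measure_nonneg[of M "A \<inter> B \<inter> C'"] by (simp only: Int_assoc abs_le_iff) linarith
    have a: "prob A = prob (A \<inter> C') + (\<Sum>s\<in>F. prob (A \<inter> C s))"
      using splitF[OF Ae sets.top C'm[unfolded C'_def]] sets.sets_into_space[OF Ae]
      unfolding C_def C'_def by (simp add: Int_absorb2)
    have b: "prob B = prob (B \<inter> D') + (\<Sum>s\<in>F. prob (B \<inter> D s))"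
      using splitF[OF Be sets.top D'm[unfolded D'_def]] sets.sets_into_space[OF Be]
      unfolding D_def D'_def by (simp add: Int_absorb2)
    define U where "U = (\<Sum>s\<in>F. prob (A \<inter> C s)) * (\<Sum>t\<in>F. prob (B \<inter> D t))"
    have sA: "0 \<le> (\<Sum>s\<in>F. prob (A \<inter> C s))" "(\<Sum>s\<in>F. prob (A \<inter> C s)) \<le> prob A"
      using a by (auto intro: sum_nonneg simp: measure_nonneg)
    have "prob A * prob B - U = prob (A \<inter> C') * prob B + (\<Sum>s\<in>F. prob (A \<inter> C s)) * prob (B \<inter> D')"
      unfolding U_def using a b by (simp add: algebra_simps)
    moreover have "0 \<le> (\<Sum>s\<in>F. prob (A \<inter> C s)) * prob (B \<inter> D')" "(\<Sum>s\<in>F. prob (A \<inter> C s)) * prob (B \<inter> D') \<le> prob A * prob (B \<inter> D')"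
      using sA by (auto intro: mult_right_mono)
    moreover have "0 \<le> prob (A \<inter> C') * prob B" by simp
    ultimately have up2: "\<bar>prob A * prob B - U\<bar> \<le> prob (A \<inter> C') * prob B + prob A * prob (B \<inter> D')" by linarith
    have "\<bar>T - U\<bar> \<le> (\<Sum>s\<in>F. \<Sum>t\<in>F. \<bar>prob (A \<inter> C s \<inter> (B \<inter> D t)) - prob (A \<inter> C s) * prob (B \<inter> D t)\<bar>)"
      unfolding T_def U_def sum_product sum_subtractf[symmetric]
      by (intro order_trans[OF sum_abs] sum_mono order_refl)
    also have "\<dots> = (\<Sum>s\<in>F. \<Sum>t\<in>F. prob (A \<inter> C s) * prob (B \<inter> D t) * (d s t / (prob (C s) * prob (D t))))"
    proof (intro sum.cong refl)
      fix s t assume "s \<in> F" "t \<in> F"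
      then have st: "s \<in> S" "t \<in> S" using F by auto
      have pos: "0 < prob (C s)" "0 < prob (D t)"
        using prob_X_pos[OF st(1)] prob_X_pos[OF st(2)] prob_X_shift[of "int n" t] by (auto simp: C_def D_def)
      have "prob (A \<inter> C s \<inter> (B \<inter> D t)) = prob (A \<inter> C s) * prob (B \<inter> D t) * prob (C s \<inter> D t) / (prob (C s) * prob (D t))"
        using AP BQ P Q st unfolding C_def D_def by (intro four_point) auto
      then have "prob (A \<inter> C s \<inter> (B \<inter> D t)) - prob (A \<inter> C s) * prob (B \<inter> D t)
        = prob (A \<inter> C s) * prob (B \<inter> D t) * ((prob (C s \<inter> D t) - prob (C s) * prob (D t)) / (prob (C s) * prob (D t)))"
        using pos by (simp add: field_simps)
      then show "\<bar>prob (A \<inter> C s \<inter> (B \<inter> D t)) - prob (A \<inter> C s) * prob (B \<inter> D t)\<bar>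
        = prob (A \<inter> C s) * prob (B \<inter> D t) * (d s t / (prob (C s) * prob (D t)))"
        by (simp add: d_def abs_mult)
    qed
    finally show ?thesis using up up2 by linarith
  qed
  have tot: "(\<Sum>A\<in>R. prob A) = prob (space M)" if R: "finite R" "partition_on (space M) R" "R \<subseteq> events" for R
  proof -
    have "(\<Sum>A\<in>R. prob A) = (\<Sum>A\<in>R. prob (A \<inter> space M))"
      using R(3) sets.sets_into_space by (intro sum.cong refl arg_cong[where f=prob]) blast
    also have "\<dots> = prob (space M)" by (rule sum_prob_partition[OF R sets.top])
    finally show ?thesis .
  qed
  have "(\<Sum>A\<in>P. \<Sum>B\<in>Q. \<bar>prob (A \<inter> B) - prob A * prob B\<bar>)
    \<le> (\<Sum>A\<in>P. \<Sum>B\<in>Q. prob (A \<inter> (B \<inter> C')) + prob (A \<inter> (B \<inter> D')) + prob (A \<inter> C') * prob B + prob A * prob (B \<inter> D')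
        + (\<Sum>s\<in>F. \<Sum>t\<in>F. prob (A \<inter> C s) * prob (B \<inter> D t) * (d s t / (prob (C s) * prob (D t)))))"
    by (intro sum_mono pt)
  also have "\<dots> = (\<Sum>A\<in>P. \<Sum>B\<in>Q. prob (A \<inter> (B \<inter> C'))) + (\<Sum>A\<in>P. \<Sum>B\<in>Q. prob (A \<inter> (B \<inter> D')))
      + (\<Sum>A\<in>P. \<Sum>B\<in>Q. prob (A \<inter> C') * prob B) + (\<Sum>A\<in>P. \<Sum>B\<in>Q. prob A * prob (B \<inter> D'))
      + (\<Sum>A\<in>P. \<Sum>B\<in>Q. \<Sum>s\<in>F. \<Sum>t\<in>F. prob (A \<inter> C s) * prob (B \<inter> D t) * (d s t / (prob (C s) * prob (D t))))"
    by (simp only: sum.distrib)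
  also have "(\<Sum>A\<in>P. \<Sum>B\<in>Q. prob (A \<inter> (B \<inter> C'))) = prob C'"
  proof -
    have "(\<Sum>A\<in>P. \<Sum>B\<in>Q. prob (A \<inter> (B \<inter> C'))) = (\<Sum>B\<in>Q. \<Sum>A\<in>P. prob (A \<inter> (B \<inter> C')))" by (rule sum.swap)
    also have "\<dots> = (\<Sum>B\<in>Q. prob (B \<inter> C'))"
      using Qe by (intro sum.cong refl sum_prob_partition[OF P(1,2) Pe]) auto
    also have "\<dots> = prob C'" by (rule sum_prob_partition[OF Q(1,2) Qe]) simp
    finally show ?thesis .
  qed
  also have "(\<Sum>A\<in>P. \<Sum>B\<in>Q. prob (A \<inter> (B \<inter> D'))) = prob D'"
  proof -
    have "(\<Sum>A\<in>P. \<Sum>B\<in>Q. prob (A \<inter> (B \<inter> D'))) = (\<Sum>B\<in>Q. \<Sum>A\<in>P. prob (A \<inter> (B \<inter> D')))" by (rule sum.swap)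
    also have "\<dots> = (\<Sum>B\<in>Q. prob (B \<inter> D'))"
      using Qe by (intro sum.cong refl sum_prob_partition[OF P(1,2) Pe]) auto
    also have "\<dots> = prob D'" by (rule sum_prob_partition[OF Q(1,2) Qe]) simp
    finally show ?thesis .
  qed
  also have "(\<Sum>A\<in>P. \<Sum>B\<in>Q. prob (A \<inter> C') * prob B) = prob C' * prob (space M)"
    unfolding sum_product[symmetric] by (simp only: sum_prob_partition[OF P(1,2) Pe C'm] tot[OF Q(1,2) Qe])
  also have "(\<Sum>A\<in>P. \<Sum>B\<in>Q. prob A * prob (B \<inter> D')) = prob (space M) * prob D'"
    unfolding sum_product[symmetric] by (simp only: sum_prob_partition[OF Q(1,2) Qe D'm] tot[OF P(1,2) Pe])
  \<comment> \<open>Summation over the partitions turns the two factors into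
    \<open>prob (C s)\<close> and \<open>prob (D t)\<close>, exactly the denominators, so
    \<open>d s t\<close> is left whatever the partitions are.\<close>
  also have "(\<Sum>A\<in>P. \<Sum>B\<in>Q. \<Sum>s\<in>F. \<Sum>t\<in>F. prob (A \<inter> C s) * prob (B \<inter> D t) * (d s t / (prob (C s) * prob (D t))))
      = (\<Sum>s\<in>F. \<Sum>t\<in>F. d s t)"
  proof -
    have "(\<Sum>A\<in>P. \<Sum>B\<in>Q. \<Sum>s\<in>F. \<Sum>t\<in>F. prob (A \<inter> C s) * prob (B \<inter> D t) * (d s t / (prob (C s) * prob (D t))))
      = (\<Sum>A\<in>P. \<Sum>s\<in>F. \<Sum>B\<in>Q. \<Sum>t\<in>F. prob (A \<inter> C s) * prob (B \<inter> D t) * (d s t / (prob (C s) * prob (D t))))"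
      by (intro sum.cong refl) (rule sum.swap)
    also have "\<dots> = (\<Sum>s\<in>F. \<Sum>A\<in>P. \<Sum>B\<in>Q. \<Sum>t\<in>F. prob (A \<inter> C s) * prob (B \<inter> D t) * (d s t / (prob (C s) * prob (D t))))"
      by (rule sum.swap)
    also have "\<dots> = (\<Sum>s\<in>F. \<Sum>A\<in>P. \<Sum>t\<in>F. \<Sum>B\<in>Q. prob (A \<inter> C s) * prob (B \<inter> D t) * (d s t / (prob (C s) * prob (D t))))"
      by (intro sum.cong refl) (rule sum.swap)
    also have "\<dots> = (\<Sum>s\<in>F. \<Sum>t\<in>F. \<Sum>A\<in>P. \<Sum>B\<in>Q. prob (A \<inter> C s) * prob (B \<inter> D t) * (d s t / (prob (C s) * prob (D t))))"
      by (intro sum.cong refl) (rule sum.swap)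
    also have "\<dots> = (\<Sum>s\<in>F. \<Sum>t\<in>F. d s t)"
    proof (intro sum.cong refl)
      fix s t assume "s \<in> F" "t \<in> F"
      then have st: "s \<in> S" "t \<in> S" using F by auto
      have pos: "0 < prob (C s)" "0 < prob (D t)"
        using prob_X_pos[OF st(1)] prob_X_pos[OF st(2)] prob_X_shift[of "int n" t] by (auto simp: C_def D_def)
      have "(\<Sum>A\<in>P. \<Sum>B\<in>Q. prob (A \<inter> C s) * prob (B \<inter> D t) * (d s t / (prob (C s) * prob (D t))))
        = (\<Sum>A\<in>P. prob (A \<inter> C s)) * (\<Sum>B\<in>Q. prob (B \<inter> D t)) * (d s t / (prob (C s) * prob (D t)))"
        unfolding sum_product by (simp only: sum_distrib_right)
      also have "\<dots> = d s t"
        using pos sum_prob_partition[OF P(1,2) Pe, of "C s"] sum_prob_partition[OF Q(1,2) Qe, of "D t"] by simp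
      finally show "(\<Sum>A\<in>P. \<Sum>B\<in>Q. prob (A \<inter> C s) * prob (B \<inter> D t) * (d s t / (prob (C s) * prob (D t)))) = d s t" .
    qed
    finally show ?thesis .
  qed
  finally have "(\<Sum>A\<in>P. \<Sum>B\<in>Q. \<bar>prob (A \<inter> B) - prob A * prob B\<bar>) \<le> prob C' + prob D' + prob C' + prob D' + (\<Sum>s\<in>F. \<Sum>t\<in>F. d s t)"
    by (simp add: prob_space)
  moreover have "d s t = \<bar>prob {\<omega> \<in> space M. X 0 \<omega> = s \<and> X (int n) \<omega> = t}
        - prob {\<omega> \<in> space M. X 0 \<omega> = s} * prob {\<omega> \<in> space M. X 0 \<omega> = t}\<bar>" for s t
  proof -
    have "C s \<inter> D t = {\<omega> \<in> space M. X 0 \<omega> = s \<and> X (int n) \<omega> = t}" by (auto simp: C_def D_def)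
    moreover have "prob (D t) = prob {\<omega> \<in> space M. X 0 \<omega> = t}" unfolding D_def by (rule prob_X_shift)
    ultimately show ?thesis by (simp add: d_def C_def)
  qed
  ultimately show ?thesis using C'e D'e by simp
qed

text \<open>Exhaustion of the countable \<open>S\<close> along an enumeration, and continuity from
  below.\<close>

lemma finite_core:
  assumes "0 < \<epsilon>"
  obtains F where "finite F" "F \<subseteq> S" "prob {\<omega> \<in> space M. X 0 \<omega> \<notin> F} \<le> \<epsilon>"
proof -
  have "S \<noteq> {}" using X_in not_empty by blast
  define G where "G n = from_nat_into S ` {..<n::nat}" for n
  have GS: "G n \<subseteq> S" for n using from_nat_into[OF \<open>S \<noteq> {}\<close>] by (auto simp: G_def)
  define E where "E n = (\<Union>s\<in>G n. {\<omega> \<in> space M. X 0 \<omega> = s})" for n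
  have Em: "E n \<in> events" for n unfolding E_def by (intro sets.finite_UN) (auto simp: G_def)
  have "(\<lambda>n. prob (E n)) \<longlonglongrightarrow> prob (\<Union>n. E n)"
  proof (rule finite_Lim_measure_incseq)
    show "range E \<subseteq> events" using Em by auto
    have "G m \<subseteq> G n" if "m \<le> n" for m n using that by (force simp: G_def)
    then show "incseq E" unfolding incseq_def E_def by blast
  qed
  moreover have "(\<Union>n. E n) = space M"
  proof -
    have "\<omega> \<in> (\<Union>n. E n)" if w: "\<omega> \<in> space M" for \<omega>
    proof -
      obtain m where "from_nat_into S m = X 0 \<omega>" using from_nat_into_surj[OF S X_in[OF w]] by blast
      moreover have "from_nat_into S m \<in> G (Suc m)" by (simp add: G_def)
      ultimately have "\<omega> \<in> E (Suc m)" using w by (simp add: E_def)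
      then show ?thesis by blast
    qed
    then show ?thesis by (auto simp: E_def)
  qed
  ultimately have "(\<lambda>n. prob (E n)) \<longlonglongrightarrow> 1" by (simp add: prob_space)
  then have "\<forall>\<^sub>F n in sequentially. 1 - \<epsilon> < prob (E n)" using assms by (intro order_tendstoD) auto
  then obtain n where n: "1 - \<epsilon> < prob (E n)" by (auto simp: eventually_sequentially)
  have "{\<omega> \<in> space M. X 0 \<omega> \<notin> G n} = space M - E n" by (auto simp: E_def)
  then have "prob {\<omega> \<in> space M. X 0 \<omega> \<notin> G n} \<le> \<epsilon>" using n Em[of n] by (simp add: prob_compl)
  then show ?thesis using that[of "G n"] GS by (auto simp: G_def)
qed

lemma beta_mixing: "beta_mixing M X"
  unfolding beta_mixing_def
proof (rule LIMSEQ_I)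
  fix r :: real assume r: "0 < r"
  \<comment> \<open>Four errors of size \<open>r / 8\<close>, halved by the factor in
    \<open>beta_coeff\<close>, make \<open>r / 4\<close>; half of \<open>d n < r\<close> is added,
    and the total stays below \<open>r\<close>.\<close>
  obtain F where F: "finite F" "F \<subseteq> S" "prob {\<omega> \<in> space M. X 0 \<omega> \<notin> F} \<le> r / 8"
    using finite_core[of "r / 8"] r by auto
  define d where "d n = (\<Sum>s\<in>F. \<Sum>t\<in>F. \<bar>prob {\<omega> \<in> space M. X 0 \<omega> = s \<and> X (int n) \<omega> = t}
        - prob {\<omega> \<in> space M. X 0 \<omega> = s} * prob {\<omega> \<in> space M. X 0 \<omega> = t}\<bar>)" for n
  have "d \<longlonglongrightarrow> (\<Sum>s\<in>F. \<Sum>t\<in>F. 0)"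
    unfolding d_def using F(2)
    by (intro tendsto_sum tendsto_rabs_zero LIM_zero asymp_indep) auto
  then have "\<forall>\<^sub>F n in sequentially. d n < r" using r by (intro order_tendstoD) auto
  then obtain N where N: "\<And>n. n \<ge> N \<Longrightarrow> d n < r" by (auto simp: eventually_sequentially)
  show "\<exists>no. \<forall>n\<ge>no. norm (beta_coeff M (process_sigma M X {..0}) (process_sigma M X {int n..}) - 0) < r"
  proof (intro exI[of _ N] allI impI)
    fix n assume n: "N \<le> n"
    define V where "V = {(1 / 2) * (\<Sum>A\<in>P. \<Sum>B\<in>Q. \<bar>measure M (A \<inter> B) - measure M A * measure M B\<bar>) | P Q.
       finite P \<and> partition_on (space M) P \<and> P \<subseteq> process_sigma M X {..0} \<and>
       finite Q \<and> partition_on (space M) Q \<and> Q \<subseteq> process_sigma M X {int n..}}"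
    have b: "beta_coeff M (process_sigma M X {..0}) (process_sigma M X {int n..}) = Sup V"
      by (simp add: beta_coeff_def V_def)
    have V: "v \<le> (4 * (r / 8) + d n) / 2" if "v \<in> V" for v
    proof -
      obtain P Q where v: "v = (1 / 2) * (\<Sum>A\<in>P. \<Sum>B\<in>Q. \<bar>prob (A \<inter> B) - prob A * prob B\<bar>)"
        and PQ: "finite P" "partition_on (space M) P" "P \<subseteq> process_sigma M X {..0}"
          "finite Q" "partition_on (space M) Q" "Q \<subseteq> process_sigma M X {int n..}"
        using \<open>v \<in> V\<close> unfolding V_def mem_Collect_eq by (elim exE conjE) (rule that, assumption+)
      show ?thesis unfolding v using beta_sum_le[OF F PQ] by (simp add: d_def)
    qed
    have sp: "space M \<in> process_sigma M X K" for K unfolding process_sigma_def by (rule sigma_sets_top)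
    \<comment> \<open>The trivial partition yields the value 0, so the set is nonempty and its
      supremum nonnegative.\<close>
    have "(1 / 2) * (\<Sum>A\<in>{space M}. \<Sum>B\<in>{space M}. \<bar>prob (A \<inter> B) - prob A * prob B\<bar>) \<in> V"
      unfolding V_def using not_empty sp by (intro CollectI exI[of _ "{space M}"]) (auto simp: partition_on_def)
    then have 0: "0 \<in> V" by (simp add: prob_space)
    have "Sup V \<le> (4 * (r / 8) + d n) / 2" using 0 V by (intro cSup_least) auto
    moreover have "0 \<le> Sup V" using 0 V by (intro cSup_upper bdd_aboveI)
    ultimately show "norm (beta_coeff M (process_sigma M X {..0}) (process_sigma M X {int n..}) - 0) < r"
      unfolding b using N[OF n] r by simp
  qed
qed

end

section \<open>A single three-state component\<close>

definition depends_only :: "'i set \<Rightarrow> (('i \<Rightarrow> 'b) \<Rightarrow> 'c) \<Rightarrow> bool" where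
  "depends_only I f \<longleftrightarrow> (\<forall>\<omega> \<omega>'. (\<forall>i\<in>I. \<omega> i = \<omega>' i) \<longrightarrow> f \<omega> = f \<omega>')"

lemma depends_onlyD: "depends_only I f \<Longrightarrow> (\<And>i. i \<in> I \<Longrightarrow> \<omega> i = \<omega>' i) \<Longrightarrow> f \<omega> = f \<omega>'"
  by (auto simp: depends_only_def)

lemma depends_only_mono: "depends_only I f \<Longrightarrow> I \<subseteq> J \<Longrightarrow> depends_only J f"
  unfolding depends_only_def by blast

lemma depends_only_const: "depends_only I (\<lambda>_. c)"
  by (simp add: depends_only_def)

lemma depends_only_compose: "depends_only I f \<Longrightarrow> depends_only I (\<lambda>\<omega>. h (f \<omega>))"
  unfolding depends_only_def by (metis (no_types))

lemma depends_only_compose2: "depends_only I f \<Longrightarrow> depends_only I g \<Longrightarrow> depends_only I (\<lambda>\<omega>. h (f \<omega>) (g \<omega>))"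
  unfolding depends_only_def by (metis (no_types))

lemma depends_only_indicator: "depends_only I (\<lambda>\<omega>. \<omega> \<in> A) \<Longrightarrow> depends_only I (indicator A)"
  using depends_only_compose[of I "\<lambda>\<omega>. \<omega> \<in> A" of_bool] by (simp add: indicator_def[abs_def])

lemma depends_only_fun:
  assumes "\<And>j. depends_only I (f j)"
  shows "depends_only I (\<lambda>\<omega>. h (\<lambda>j. f j \<omega>))"
proof -
  have "(\<lambda>j. f j \<omega>) = (\<lambda>j. f j \<omega>')" if "\<forall>i\<in>I. \<omega> i = \<omega>' i" for \<omega> \<omega>'
    using assms that unfolding depends_only_def by blast
  then show ?thesis unfolding depends_only_def by (metis (no_types))
qed

locale pmf_product =
  fixes p :: "'i \<Rightarrow> 'b pmf"
begin

definition PM :: "('i \<Rightarrow> 'b) measure" where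
  "PM = (\<Pi>\<^sub>M i\<in>UNIV. measure_pmf (p i))"

sublocale P: product_prob_space "\<lambda>i. measure_pmf (p i)" UNIV
  by unfold_locales

sublocale prob_space PM
  unfolding PM_def by unfold_locales

lemma space_PM [simp]: "space PM = UNIV"
  by (simp add: PM_def space_PiM)

lemma UNIV_events [simp]: "UNIV \<in> events"
  using sets.top[of PM] by simp

lemma measurable_coord_pmf: "(\<lambda>\<omega>. \<omega> i) \<in> measurable PM (measure_pmf (p i))"
  unfolding PM_def by (rule measurable_component_singleton) simp

lemma measurable_coord [measurable]: "(\<lambda>\<omega>. \<omega> i) \<in> measurable PM (count_space UNIV)"
  using measurable_coord_pmf[of i] by simp

lemma measurable_coord': "(\<lambda>\<omega>. f (\<omega> i)) \<in> measurable PM N" if "f \<in> UNIV \<rightarrow> space N"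
  by (rule measurable_compose[OF measurable_coord]) (use that in simp)

lemma distr_coord: "distr PM (measure_pmf (p i)) (\<lambda>\<omega>. \<omega> i) = measure_pmf (p i)"
  unfolding PM_def by (rule P.PiM_component) simp

lemma prob_coord: "prob {\<omega>. \<omega> i \<in> A} = measure (measure_pmf (p i)) A"
proof -
  have "measure (measure_pmf (p i)) A = measure (distr PM (measure_pmf (p i)) (\<lambda>\<omega>. \<omega> i)) A"
    by (simp add: distr_coord)
  also have "\<dots> = prob ((\<lambda>\<omega>. \<omega> i) -` A \<inter> space PM)"
    by (rule measure_distr[OF measurable_coord_pmf]) simp
  finally show ?thesis by (simp add: vimage_def)
qed

lemma indep_coords: "indep_vars (\<lambda>i. measure_pmf (p i)) (\<lambda>i \<omega>. \<omega> i) UNIV"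
proof (subst indep_vars_iff_distr_eq_PiM)
  show "random_variable (measure_pmf (p i)) (\<lambda>\<omega>. \<omega> i)" for i by (rule measurable_coord_pmf)
  have "distr PM (\<Pi>\<^sub>M i\<in>UNIV. measure_pmf (p i)) (\<lambda>x. \<lambda>i\<in>UNIV. x i) = distr PM PM (\<lambda>x. x)"
    by (intro distr_cong) (simp_all add: PM_def restrict_def)
  then show "distr PM (\<Pi>\<^sub>M i\<in>UNIV. measure_pmf (p i)) (\<lambda>x. \<lambda>i\<in>UNIV. x i) = (\<Pi>\<^sub>M i\<in>UNIV. distr PM (measure_pmf (p i)) (\<lambda>\<omega>. \<omega> i))"
    by (simp add: distr_coord distr_id) (simp add: PM_def)
qed simp

text \<open>\<open>depends_only\<close> is a plain statement about functions, free of
  \<sigma>-algebras. \<open>ext\<close> pads a restricted point by \<open>undefined\<close>, so that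
  such a function factors measurably through the restriction to its coordinates and inherits the
  independence of the restrictions.\<close>

lemma indep_var_depends_only:
  assumes f: "f \<in> measurable PM N1" "depends_only I f" and g: "g \<in> measurable PM N2" "depends_only J g"
    and IJ: "I \<inter> J = {}"
  shows "indep_var N1 f N2 g"
proof -
  define ext where "ext A \<eta> i = (if i \<in> A then \<eta> i else undefined :: 'b)" for A \<eta> and i :: 'i
  have ext: "ext A \<in> measurable (\<Pi>\<^sub>M i\<in>A. measure_pmf (p i)) PM" for A
    unfolding PM_def
  proof (rule measurable_PiM_single')
    fix i show "(\<lambda>\<eta>. ext A \<eta> i) \<in> measurable (\<Pi>\<^sub>M i\<in>A. measure_pmf (p i)) (measure_pmf (p i))"
    proof (cases "i \<in> A")
      case True
      then have "(\<lambda>\<eta>. ext A \<eta> i) = (\<lambda>\<eta>. \<eta> i)" by (simp add: ext_def)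
      then show ?thesis using measurable_component_singleton[OF True, of "\<lambda>i. measure_pmf (p i)"] by simp
    next
      case False
      then have "(\<lambda>\<eta>. ext A \<eta> i) = (\<lambda>_. undefined)" by (simp add: ext_def)
      then show ?thesis by simp
    qed
  qed (auto simp: space_PiM)
  have restr: "h \<circ> ext A \<circ> (\<lambda>\<omega>. restrict (\<lambda>i. \<omega> i) A) = h" if "depends_only A h" for h :: "_ \<Rightarrow> 'x" and A
  proof
    fix \<omega>
    show "(h \<circ> ext A \<circ> (\<lambda>\<omega>. restrict (\<lambda>i. \<omega> i) A)) \<omega> = h \<omega>"
      unfolding comp_def by (rule depends_onlyD[OF that]) (simp add: ext_def)
  qed
  have "indep_var (\<Pi>\<^sub>M i\<in>I. measure_pmf (p i)) (\<lambda>\<omega>. restrict (\<lambda>i. \<omega> i) I) (\<Pi>\<^sub>M i\<in>J. measure_pmf (p i)) (\<lambda>\<omega>. restrict (\<lambda>i. \<omega> i) J)"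
    by (rule indep_var_restrict[OF indep_coords IJ]) auto
  then have "indep_var N1 (f \<circ> ext I \<circ> (\<lambda>\<omega>. restrict (\<lambda>i. \<omega> i) I)) N2 (g \<circ> ext J \<circ> (\<lambda>\<omega>. restrict (\<lambda>i. \<omega> i) J))"
    by (rule indep_var_compose[OF _ measurable_comp[OF ext f(1)] measurable_comp[OF ext g(1)]])
  then show ?thesis by (simp only: restr[OF f(2)] restr[OF g(2)])
qed

lemma integral_mult_depends_only:
  fixes f g :: "('i \<Rightarrow> 'b) \<Rightarrow> 'c::{real_normed_field, banach, second_countable_topology}"
  assumes f: "integrable PM f" "depends_only I f" and g: "integrable PM g" "depends_only J g"
    and IJ: "I \<inter> J = {}"
  shows "(\<integral>\<omega>. f \<omega> * g \<omega> \<partial>PM) = (\<integral>\<omega>. f \<omega> \<partial>PM) * (\<integral>\<omega>. g \<omega> \<partial>PM)"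
proof -
  have mf: "f \<in> borel_measurable PM" and mg: "g \<in> borel_measurable PM"
    using f g by auto
  have i: "indep_var borel f borel g"
    by (rule indep_var_depends_only[OF mf f(2) mg g(2) IJ])
  show ?thesis by (rule indep_var_lebesgue_integral[OF i f(1) g(1)])
qed

lemma integral_mult_coord:
  fixes f :: "('i \<Rightarrow> 'b) \<Rightarrow> 'c::{real_normed_field, banach, second_countable_topology}"
  assumes f: "integrable PM f" "depends_only I f" and i: "i \<notin> I"
  shows "(\<integral>\<omega>. f \<omega> * of_real (indicator A (\<omega> i)) \<partial>PM) = (\<integral>\<omega>. f \<omega> \<partial>PM) * of_real (measure (measure_pmf (p i)) A)"
proof -
  have int: "integrable PM (\<lambda>\<omega>. of_real (indicator A (\<omega> i)) :: 'c)"
  proof (rule integrable_const_bound[of _ 1])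
    show "(\<lambda>\<omega>. of_real (indicator A (\<omega> i)) :: 'c) \<in> borel_measurable PM"
      by (rule measurable_coord') simp
  qed (simp add: indicator_def)
  have "(\<integral>\<omega>. of_real (indicator A (\<omega> i)) \<partial>PM) = (of_real (\<integral>\<omega>. indicator A (\<omega> i) \<partial>PM) :: 'c)"
  proof (rule integral_bounded_linear[OF bounded_linear_of_real])
    show "integrable PM (\<lambda>\<omega>. indicator A (\<omega> i) :: real)"
    proof (rule integrable_const_bound[of _ 1])
      show "(\<lambda>\<omega>. indicator A (\<omega> i) :: real) \<in> borel_measurable PM"
        by (rule measurable_coord') simp
    qed (simp add: indicator_def)
  qed
  also have "(\<integral>\<omega>. indicator A (\<omega> i) \<partial>PM) = (\<integral>\<omega>. indicator {\<omega>. \<omega> i \<in> A} \<omega> \<partial>PM :: real)"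
    by (intro Bochner_Integration.integral_cong) (auto simp: indicator_def)
  also have "\<dots> = prob {\<omega>. \<omega> i \<in> A}" by simp
  finally have "(\<integral>\<omega>. of_real (indicator A (\<omega> i)) \<partial>PM) = (of_real (measure (measure_pmf (p i)) A) :: 'c)"
    by (simp add: prob_coord)
  then show ?thesis
    by (subst integral_mult_depends_only[OF f int, of "{i}"]) (use i in \<open>auto simp: depends_only_def\<close>)
qed

lemma prob_Int_depends_only:
  assumes A: "A \<in> events" "depends_only I (\<lambda>\<omega>. \<omega> \<in> A)" and B: "B \<in> events" "depends_only J (\<lambda>\<omega>. \<omega> \<in> B)"
    and IJ: "I \<inter> J = {}"
  shows "prob (A \<inter> B) = prob A * prob B"
proof -
  have "(\<integral>\<omega>. indicator A \<omega> * indicator B \<omega> \<partial>PM) = (\<integral>\<omega>. indicator A \<omega> \<partial>PM) * (\<integral>\<omega>. indicator B \<omega> \<partial>PM :: real)"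
    using A B by (intro integral_mult_depends_only[OF _ _ _ _ IJ] depends_only_indicator) (simp_all add: emeasure_eq_measure)
  then show ?thesis using A B by (simp add: indicator_inter_arith[symmetric])
qed

end

section \<open>Stationary law, innovations and two-sided construction of a component\<close>

definition pmass :: "real \<Rightarrow> real \<Rightarrow> real" where
  "pmass w y = (if y = 0 then 1 - w else if y = 1 \<or> y = -1 then w / 2 else 0)"

definition kern :: "real \<Rightarrow> real \<Rightarrow> real \<Rightarrow> real \<Rightarrow> real" where
  "kern \<rho> w x y = \<rho> * (if x = y then 1 else 0) + (1 - \<rho>) * pmass w y"

definition tri :: "real set" where
  "tri = {0, 1, -1}"

definition stat_pmf :: "real \<Rightarrow> real pmf" where
  "stat_pmf w = bind_pmf (bernoulli_pmf w) (\<lambda>b. if b then pmf_of_set {1, -1} else return_pmf 0)"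

text \<open>The innovation \<open>2\<close>, or any other number outside \<open>tri\<close>, stands for keeping the present value; see \<open>step\<close> below.\<close>
definition refresh_pmf :: "real \<Rightarrow> real \<Rightarrow> real pmf" where
  "refresh_pmf \<rho> w = bind_pmf (bernoulli_pmf \<rho>) (\<lambda>b. if b then return_pmf 2 else stat_pmf w)"

lemma sum_pmass: "(\<Sum>y\<in>tri. pmass w y) = 1"
  by (simp add: tri_def pmass_def)

lemma pmf_stat: "0 \<le> w \<Longrightarrow> w \<le> 1 \<Longrightarrow> pmf (stat_pmf w) y = pmass w y"
  by (auto simp: stat_pmf_def pmf_bind pmass_def)

lemma pmf_refresh: "0 \<le> w \<Longrightarrow> w \<le> 1 \<Longrightarrow> 0 \<le> \<rho> \<Longrightarrow> \<rho> \<le> 1 \<Longrightarrow>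
    pmf (refresh_pmf \<rho> w) y = \<rho> * (if y = 2 then 1 else 0) + (1 - \<rho>) * pmass w y"
  by (auto simp: refresh_pmf_def pmf_bind pmf_stat)

lemma measure_refresh_outside:
  assumes "0 \<le> w" "w \<le> 1" "0 \<le> \<rho>" "\<rho> \<le> 1"
  shows "measure (measure_pmf (refresh_pmf \<rho> w)) (- tri) = \<rho>"
proof -
  have "measure (measure_pmf (refresh_pmf \<rho> w)) tri = (\<Sum>y\<in>tri. pmf (refresh_pmf \<rho> w) y)"
    by (rule measure_measure_pmf_finite) (simp add: tri_def)
  also have "\<dots> = (1 - \<rho>) * (\<Sum>y\<in>tri. pmass w y)"
    unfolding sum_distrib_left by (intro sum.cong refl) (auto simp: pmf_refresh assms tri_def)
  finally have "measure (measure_pmf (refresh_pmf \<rho> w)) tri = 1 - \<rho>" by (simp add: sum_pmass)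
  moreover have "measure (measure_pmf (refresh_pmf \<rho> w)) (- tri) = 1 - measure (measure_pmf (refresh_pmf \<rho> w)) tri"
    using measure_pmf.prob_compl[of tri "refresh_pmf \<rho> w"] by (simp add: Compl_eq_Diff_UNIV)
  ultimately show ?thesis by simp
qed

definition step :: "real \<Rightarrow> real \<Rightarrow> real" where
  "step x u = (if u \<in> tri then u else x)"

text \<open>Applying \<open>step 0\<close> to the initial value as well keeps the walk in
  \<open>tri\<close> at every sample point; under \<open>stat_pmf\<close> this alters the initial
  value with probability 0 only.\<close>

primrec walk :: "(nat \<Rightarrow> real) \<Rightarrow> nat \<Rightarrow> real" where
  "walk u 0 = step 0 (u 0)"
| "walk u (Suc n) = step (walk u n) (u (Suc n))"

lemma walk_cong: "(\<And>i. i \<le> n \<Longrightarrow> u i = v i) \<Longrightarrow> walk u n = walk v n"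
  by (induction n) auto

lemma walk_in_tri: "walk u n \<in> tri"
  by (induction n) (auto simp: step_def tri_def)

text \<open>The innovations of all components at all times form one family over the integers, so
  that the sample space has the type \<open>int \<Rightarrow> real\<close> of the theorem.\<close>

definition enc :: "nat \<Rightarrow> int \<Rightarrow> int" where
  "enc m k = int (to_nat (m, k))"

lemma enc_inject [simp]: "enc m k = enc m' k' \<longleftrightarrow> m = m' \<and> k = k'"
  by (simp add: enc_def)

text \<open>
  The chain is run from time $0$ in both directions with separate innovations; by reversibility the
  resulting two-sided process is stationary.
\<close>
definition Z :: "nat \<Rightarrow> int \<Rightarrow> (int \<Rightarrow> real) \<Rightarrow> real" where
  "Z m k \<omega> = walk (\<lambda>n. \<omega> (enc m (sgn k * int n))) (nat \<bar>k\<bar>)"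

lemma Z_in_tri: "Z m k \<omega> \<in> tri"
  by (simp add: Z_def walk_in_tri)

lemma Z_0: "Z m 0 \<omega> = step 0 (\<omega> (enc m 0))"
  by (simp add: Z_def)

lemma Z_forward: "0 \<le> k \<Longrightarrow> Z m (k + 1) \<omega> = step (Z m k \<omega>) (\<omega> (enc m (k + 1)))"
proof -
  assume k: "0 \<le> k"
  then have 1: "nat \<bar>k + 1\<bar> = Suc (nat \<bar>k\<bar>)" "sgn (k + 1) = 1" "int (Suc (nat \<bar>k\<bar>)) = k + 1" by (auto simp: sgn_if)
  \<comment> \<open>At \<open>k = 0\<close> the sign changes, but a walk of length 0 reads only the
    innovation at time 0.\<close>
  have "walk (\<lambda>n. \<omega> (enc m (sgn (k + 1) * int n))) (nat \<bar>k\<bar>) = walk (\<lambda>n. \<omega> (enc m (sgn k * int n))) (nat \<bar>k\<bar>)"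
    using k by (cases "k = 0") (auto simp: sgn_if)
  then show ?thesis unfolding Z_def 1(1) by (simp del: of_nat_Suc add: 1(2) 1(3))
qed

lemma Z_backward: "k \<le> 0 \<Longrightarrow> Z m (k - 1) \<omega> = step (Z m k \<omega>) (\<omega> (enc m (k - 1)))"
proof -
  assume k: "k \<le> 0"
  then have 1: "nat \<bar>k - 1\<bar> = Suc (nat \<bar>k\<bar>)" "sgn (k - 1) = -1" "- int (Suc (nat \<bar>k\<bar>)) = k - 1" by (auto simp: sgn_if)
  have "walk (\<lambda>n. \<omega> (enc m (sgn (k - 1) * int n))) (nat \<bar>k\<bar>) = walk (\<lambda>n. \<omega> (enc m (sgn k * int n))) (nat \<bar>k\<bar>)"
    using k by (cases "k = 0") (auto simp: sgn_if)
  then show ?thesis unfolding Z_def 1(1) by (simp del: of_nat_Suc add: 1(2) 1(3))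
qed

lemma Z_depends:
  assumes "\<And>j. min 0 k \<le> j \<Longrightarrow> j \<le> max 0 k \<Longrightarrow> enc m j \<in> I"
  shows "depends_only I (Z m k)"
  unfolding depends_only_def Z_def
proof (intro allI impI walk_cong)
  fix \<omega> \<omega>' :: "int \<Rightarrow> real" and i
  assume eq: "\<forall>i\<in>I. \<omega> i = \<omega>' i" and i: "i \<le> nat \<bar>k\<bar>"
  have "enc m (sgn k * int i) \<in> I" using i by (intro assms) (auto simp: sgn_if)
  then show "\<omega> (enc m (sgn k * int i)) = \<omega>' (enc m (sgn k * int i))" using eq by blast
qed

locale refresh_chain =
  fixes L w :: "nat \<Rightarrow> real"
  assumes L: "\<And>m. 1 < L m" and w: "\<And>m. 0 < w m" "\<And>m. w m \<le> 1/4"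
begin

definition \<rho> :: "nat \<Rightarrow> real" where
  "\<rho> m = 1 - 1 / L m"

lemma \<rho>: "0 < \<rho> m" "\<rho> m < 1"
  using L[of m] by (auto simp: \<rho>_def)

lemma w': "0 \<le> w m" "w m \<le> 1"
  using w[of m] by auto

text \<open>Time 0 receives the stationary law, every other time a refreshment or the signal to keep
  the value. Coordinates not of the form \<open>enc m k\<close>, such as the negative ones, get some
  law too but are read by no component.\<close>

definition innov :: "int \<Rightarrow> real pmf" where
  "innov i = (case from_nat (nat i) of (m, k::int) \<Rightarrow> if k = 0 then stat_pmf (w m) else refresh_pmf (\<rho> m) (w m))"

lemma innov_enc: "innov (enc m k) = (if k = 0 then stat_pmf (w m) else refresh_pmf (\<rho> m) (w m))"
  by (simp add: innov_def enc_def)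

sublocale pmf_product innov .

section \<open>One-step recursion and path probabilities of a component\<close>

lemma measurable_Z [measurable]: "Z m k \<in> borel_measurable PM"
proof -
  have "(\<lambda>\<omega>. walk (\<lambda>n. \<omega> (h n)) n) \<in> borel_measurable PM" for h n
  proof (induction n)
    case 0
    show ?case unfolding walk.simps by (rule measurable_coord') simp
  next
    case (Suc n)
    have [measurable]: "(\<lambda>\<omega>. walk (\<lambda>n. \<omega> (h n)) n) \<in> borel_measurable PM" by fact
    have [measurable]: "(\<lambda>\<omega>. \<omega> (h (Suc n))) \<in> borel_measurable PM" by (rule measurable_coord') simp
    have [measurable]: "tri \<in> sets borel" by (simp add: tri_def)
    show ?case unfolding walk.simps step_def by measurable
  qed
  then show ?thesis by (simp add: Z_def[abs_def])
qed

lemma Z_events [measurable]: "{\<omega>. Z m k \<omega> = y} \<in> events"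
proof -
  have "{\<omega>\<in>space PM. Z m k \<omega> = y} \<in> events" by measurable
  then show ?thesis by simp
qed

text \<open>The new innovation is independent of all that lives on \<open>I\<close>: with
  probability \<rho> it keeps the old value, otherwise it hits \<open>y\<close> with the stationary
  mass regardless of the past. The weight \<open>f\<close> may be real or complex, so path
  probabilities, covariances and characteristic functions share this recursion, and
  \<open>k'\<close> may lie on either side of \<open>k\<close>.\<close>

lemma integral_step:
  fixes f :: "(int \<Rightarrow> real) \<Rightarrow> 'c::{real_normed_field, banach, second_countable_topology}"
  assumes f: "integrable PM f" "depends_only I f" and Zk: "depends_only I (Z m k)" and i: "enc m k' \<notin> I" "k' \<noteq> 0"
    and st: "\<And>\<omega>. Z m k' \<omega> = step (Z m k \<omega>) (\<omega> (enc m k'))" and y: "y \<in> tri"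
  shows "(\<integral>\<omega>. f \<omega> * of_real (indicator {y} (Z m k' \<omega>)) \<partial>PM)
    = of_real (\<rho> m) * (\<integral>\<omega>. f \<omega> * of_real (indicator {y} (Z m k \<omega>)) \<partial>PM)
      + of_real ((1 - \<rho> m) * pmass (w m) y) * (\<integral>\<omega>. f \<omega> \<partial>PM)"
proof -
  let ?g = "\<lambda>\<omega>. f \<omega> * of_real (indicator {y} (Z m k \<omega>))"
  have r': "0 \<le> \<rho> m" "\<rho> m \<le> 1" using \<rho>[of m] by auto
  note [measurable] = borel_measurable_integrable[OF f(1)]
  have [measurable]: "(\<lambda>\<omega>. indicator A (\<omega> i) :: real) \<in> borel_measurable PM" for A i
    by (rule measurable_coord') simp
  have g: "integrable PM ?g"
  proof (rule Bochner_Integration.integrable_bound[OF f(1)])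
    show "?g \<in> borel_measurable PM" by measurable
  qed (simp add: indicator_def)
  have gd: "depends_only I ?g"
    by (rule depends_only_compose2[OF f(2) Zk, of "\<lambda>a b. a * of_real (indicator {y} b)"])
  have i1: "integrable PM (\<lambda>\<omega>. ?g \<omega> * of_real (indicator (- tri) (\<omega> (enc m k'))))"
  proof (rule Bochner_Integration.integrable_bound[OF g])
    show "(\<lambda>\<omega>. ?g \<omega> * of_real (indicator (- tri) (\<omega> (enc m k')))) \<in> borel_measurable PM" by measurable
  qed (simp add: indicator_def)
  have i2: "integrable PM (\<lambda>\<omega>. f \<omega> * of_real (indicator {y} (\<omega> (enc m k'))))"
  proof (rule Bochner_Integration.integrable_bound[OF f(1)])
    show "(\<lambda>\<omega>. f \<omega> * of_real (indicator {y} (\<omega> (enc m k')))) \<in> borel_measurable PM" by measurable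
  qed (simp add: indicator_def)
  \<comment> \<open>As \<open>y\<close> lies in \<open>tri\<close>, the new value is
    \<open>y\<close> in exactly two disjoint ways: the innovation is \<open>y\<close>, or it is
    outside \<open>tri\<close> and the old value was \<open>y\<close>.\<close>
  have "(\<integral>\<omega>. f \<omega> * of_real (indicator {y} (Z m k' \<omega>)) \<partial>PM)
    = (\<integral>\<omega>. ?g \<omega> * of_real (indicator (- tri) (\<omega> (enc m k'))) + f \<omega> * of_real (indicator {y} (\<omega> (enc m k'))) \<partial>PM)"
    using y by (intro Bochner_Integration.integral_cong) (auto simp: st step_def indicator_def)
  also have "\<dots> = (\<integral>\<omega>. ?g \<omega> * of_real (indicator (- tri) (\<omega> (enc m k'))) \<partial>PM) + (\<integral>\<omega>. f \<omega> * of_real (indicator {y} (\<omega> (enc m k'))) \<partial>PM)"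
    by (rule Bochner_Integration.integral_add[OF i1 i2])
  also have "(\<integral>\<omega>. ?g \<omega> * of_real (indicator (- tri) (\<omega> (enc m k'))) \<partial>PM) = (\<integral>\<omega>. ?g \<omega> \<partial>PM) * of_real (\<rho> m)"
    using i by (subst integral_mult_coord[OF g gd i(1)]) (simp add: innov_enc measure_refresh_outside w' r')
  also have "(\<integral>\<omega>. f \<omega> * of_real (indicator {y} (\<omega> (enc m k'))) \<partial>PM) = (\<integral>\<omega>. f \<omega> \<partial>PM) * of_real ((1 - \<rho> m) * pmass (w m) y)"
  proof -
    \<comment> \<open>The atom of \<open>refresh_pmf\<close> at the keep signal must not be counted
      as a value.\<close>
    have "y \<noteq> 2" using y by (auto simp: tri_def)
    then show ?thesis
      using i by (subst integral_mult_coord[OF f i(1)]) (simp add: innov_enc measure_pmf_single pmf_refresh w' r')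
  qed
  finally show ?thesis by (simp add: mult.commute)
qed

lemma prob_step:
  assumes E: "E \<in> events" "depends_only I (\<lambda>\<omega>. \<omega> \<in> E)" and Zk: "depends_only I (Z m k)" and i: "enc m k' \<notin> I" "k' \<noteq> 0"
    and st: "\<And>\<omega>. Z m k' \<omega> = step (Z m k \<omega>) (\<omega> (enc m k'))" and y: "y \<in> tri"
  shows "prob {\<omega>\<in>E. Z m k' \<omega> = y} = \<rho> m * prob {\<omega>\<in>E. Z m k \<omega> = y} + (1 - \<rho> m) * pmass (w m) y * prob E"
proof -
  have ind: "(\<integral>\<omega>. indicator E \<omega> * of_real (indicator {y} (Z m j \<omega>)) \<partial>PM) = prob {\<omega>\<in>E. Z m j \<omega> = y}" for j
  proof -
    have "{\<omega>\<in>E. Z m j \<omega> = y} = E \<inter> {\<omega>\<in>space PM. Z m j \<omega> = y}" by auto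
    also have "\<dots> \<in> events" using E by (intro sets.Int) auto
    finally have "(\<integral>\<omega>. indicator {\<omega>\<in>E. Z m j \<omega> = y} \<omega> \<partial>PM) = prob {\<omega>\<in>E. Z m j \<omega> = y}" by simp
    moreover have "(\<integral>\<omega>. indicator E \<omega> * of_real (indicator {y} (Z m j \<omega>)) \<partial>PM) = (\<integral>\<omega>. indicator {\<omega>\<in>E. Z m j \<omega> = y} \<omega> \<partial>PM :: real)"
      by (intro Bochner_Integration.integral_cong) (auto simp: indicator_def)
    ultimately show ?thesis by simp
  qed
  have int: "integrable PM (indicator E :: _ \<Rightarrow> real)" using E by (simp add: emeasure_eq_measure)
  have dep: "depends_only I (indicator E :: _ \<Rightarrow> real)"
    by (rule depends_only_indicator[OF E(2)])
  show ?thesis using integral_step[OF int dep Zk i st y] unfolding ind using E by simp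
qed

lemma prob_Z_0: "y \<in> tri \<Longrightarrow> prob {\<omega>. Z m 0 \<omega> = y} = pmass (w m) y"
proof -
  assume y: "y \<in> tri"
  have ae: "AE u in measure_pmf (stat_pmf (w m)). u \<in> tri"
    by (auto simp: AE_measure_pmf_iff stat_pmf_def tri_def set_pmf_of_set split: if_splits)
  have "prob {\<omega>. Z m 0 \<omega> = y} = prob {\<omega>. \<omega> (enc m 0) \<in> {u. step 0 u = y}}"
    by (simp add: Z_0)
  also have "\<dots> = measure (measure_pmf (stat_pmf (w m))) {u. step 0 u = y}"
    by (simp add: prob_coord innov_enc del: mem_Collect_eq)
  also have "\<dots> = measure (measure_pmf (stat_pmf (w m))) {y}"
    by (rule measure_pmf.finite_measure_eq_AE) (use ae y in \<open>auto simp: step_def\<close>)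
  finally show ?thesis by (simp add: measure_pmf_single pmf_stat w')
qed

lemma prob_Z: "y \<in> tri \<Longrightarrow> prob {\<omega>. Z m k \<omega> = y} = pmass (w m) y"
proof (induction k rule: int_induct[where k=0])
  case base
  then show ?case by (rule prob_Z_0)
next
  case (step1 k)
  have "prob {\<omega>\<in>UNIV. Z m (k + 1) \<omega> = y} = \<rho> m * prob {\<omega>\<in>UNIV. Z m k \<omega> = y} + (1 - \<rho> m) * pmass (w m) y * prob UNIV"
    by (rule prob_step[where I="enc m ` {0..k}"])
      (use step1 in \<open>auto simp: Z_forward depends_only_const intro!: Z_depends\<close>)
  then show ?case using step1 prob_space by (simp add: algebra_simps)
next
  case (step2 k)
  have "prob {\<omega>\<in>UNIV. Z m (k - 1) \<omega> = y} = \<rho> m * prob {\<omega>\<in>UNIV. Z m k \<omega> = y} + (1 - \<rho> m) * pmass (w m) y * prob UNIV"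
    by (rule prob_step[where I="enc m ` {k..0}"])
      (use step2 in \<open>auto simp: Z_backward depends_only_const intro!: Z_depends\<close>)
  then show ?case using step2 prob_space by (simp add: algebra_simps)
qed

definition pathp :: "nat \<Rightarrow> int \<Rightarrow> int \<Rightarrow> (int \<Rightarrow> real) \<Rightarrow> real" where
  "pathp m a b s = pmass (w m) (s a) * (\<Prod>i\<in>{a..<b}. kern (\<rho> m) (w m) (s i) (s (i + 1)))"

lemma detailed_balance: "pmass (w m) x * kern (\<rho> m) (w m) x y = pmass (w m) y * kern (\<rho> m) (w m) y x"
  by (simp add: kern_def algebra_simps)

lemma pathp_forward: "a \<le> b \<Longrightarrow> pathp m a (b + 1) s = pathp m a b s * kern (\<rho> m) (w m) (s b) (s (b + 1))"
proof -
  assume "a \<le> b"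
  then have "{a..<b + 1} = insert b {a..<b}" by auto
  then show ?thesis by (simp add: pathp_def)
qed

text \<open>Detailed balance trades the new initial mass and forward step for the old initial mass
  and a step run backwards, which is how values at negative times are produced.\<close>

lemma pathp_backward: "a \<le> b \<Longrightarrow> pathp m (a - 1) b s = pathp m a b s * kern (\<rho> m) (w m) (s a) (s (a - 1))"
proof -
  assume "a \<le> b"
  then have "{a - 1..<b} = insert (a - 1) {a..<b}" by auto
  then show ?thesis using detailed_balance[of m "s (a - 1)" "s a"] by (simp add: pathp_def mult_ac)
qed

lemma cyl_events [measurable]: "finite I \<Longrightarrow> cyl PM (Z m) I s \<in> events"
  by (rule sets_cyl) auto

lemma cyl_Z_depends:
  assumes "\<And>i. i \<in> K \<Longrightarrow> depends_only I (Z m i)"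
  shows "depends_only I (\<lambda>\<omega>. \<omega> \<in> cyl PM (Z m) K s)"
  unfolding depends_only_def
proof (intro allI impI)
  fix \<omega> \<omega>' :: "int \<Rightarrow> real" assume "\<forall>i\<in>I. \<omega> i = \<omega>' i"
  then have "Z m i \<omega> = Z m i \<omega>'" if "i \<in> K" for i using assms[OF that] by (auto simp: depends_only_def)
  then show "(\<omega> \<in> cyl PM (Z m) K s) = (\<omega>' \<in> cyl PM (Z m) K s)" by (auto simp: cyl_def)
qed

text \<open>\<open>0 \<le> b\<close> ensures that the innovation at \<open>b + 1\<close> is fresh:
  the window reads innovations from \<open>min 0 a\<close> to \<open>b\<close> only.\<close>

lemma prob_cyl_forward:
  assumes ab: "a \<le> b" "0 \<le> b" and s: "s (b + 1) \<in> tri"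
  shows "prob (cyl PM (Z m) {a..b + 1} s) = prob (cyl PM (Z m) {a..b} s) * kern (\<rho> m) (w m) (s b) (s (b + 1))"
proof -
  let ?E = "cyl PM (Z m) {a..b} s"
  have d: "depends_only (enc m ` {min 0 a..b}) (Z m i)" if "i \<in> {a..b}" for i
    using that ab by (intro Z_depends imageI) auto
  have "{a..b + 1} = insert (b + 1) {a..b}" using ab by auto
  then have 1: "cyl PM (Z m) {a..b + 1} s = {\<omega>\<in>?E. Z m (b + 1) \<omega> = s (b + 1)}" by (auto simp: cyl_def)
  have 2: "prob {\<omega>\<in>?E. Z m (b + 1) \<omega> = s (b + 1)} = \<rho> m * prob {\<omega>\<in>?E. Z m b \<omega> = s (b + 1)} + (1 - \<rho> m) * pmass (w m) (s (b + 1)) * prob ?E"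
    by (rule prob_step[OF _ cyl_Z_depends[OF d] d]) (use ab s in \<open>auto simp: Z_forward\<close>)
  have 3: "{\<omega>\<in>?E. Z m b \<omega> = s (b + 1)} = (if s b = s (b + 1) then ?E else {})"
  proof -
    have "Z m b \<omega> = s b" if "\<omega> \<in> ?E" for \<omega> using that ab by (simp add: cyl_def)
    then show ?thesis by auto
  qed
  show ?thesis unfolding 1 2 3 by (cases "s b = s (b + 1)") (simp_all add: kern_def algebra_simps)
qed

lemma prob_cyl_backward:
  assumes ab: "a \<le> b" "a \<le> 0" and s: "s (a - 1) \<in> tri"
  shows "prob (cyl PM (Z m) {a - 1..b} s) = prob (cyl PM (Z m) {a..b} s) * kern (\<rho> m) (w m) (s a) (s (a - 1))"
proof -
  let ?E = "cyl PM (Z m) {a..b} s"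
  have d: "depends_only (enc m ` {a..max 0 b}) (Z m i)" if "i \<in> {a..b}" for i
    using that ab by (intro Z_depends imageI) auto
  have "{a - 1..b} = insert (a - 1) {a..b}" using ab by auto
  then have 1: "cyl PM (Z m) {a - 1..b} s = {\<omega>\<in>?E. Z m (a - 1) \<omega> = s (a - 1)}" by (auto simp: cyl_def)
  have 2: "prob {\<omega>\<in>?E. Z m (a - 1) \<omega> = s (a - 1)} = \<rho> m * prob {\<omega>\<in>?E. Z m a \<omega> = s (a - 1)} + (1 - \<rho> m) * pmass (w m) (s (a - 1)) * prob ?E"
    by (rule prob_step[OF _ cyl_Z_depends[OF d] d]) (use ab s in \<open>auto simp: Z_backward\<close>)
  have 3: "{\<omega>\<in>?E. Z m a \<omega> = s (a - 1)} = (if s a = s (a - 1) then ?E else {})"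
  proof -
    have "Z m a \<omega> = s a" if "\<omega> \<in> ?E" for \<omega> using that ab by (simp add: cyl_def)
    then show ?thesis by auto
  qed
  show ?thesis unfolding 1 2 3 by (cases "s a = s (a - 1)") (simp_all add: kern_def algebra_simps)
qed

text \<open>Windows to the right of 0 grow forwards from a single time, windows reaching below 0
  grow backwards. Since \<open>pathp\<close> obeys both extension rules, one formula covers all
  windows, and it does not see the origin at which the two halves are glued.\<close>

lemma prob_cyl_Z:
  assumes "a \<le> b" "\<And>i. s i \<in> tri"
  shows "prob (cyl PM (Z m) {a..b} s) = pathp m a b s"
proof -
  have sing: "prob (cyl PM (Z m) {k} s) = pathp m k k s" for k
    using prob_Z[OF assms(2), of m k k] by (simp add: cyl_def pathp_def)
  have nonneg: "prob (cyl PM (Z m) {a..b} s) = pathp m a b s" if "0 \<le> a" "a \<le> b" for a b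
    using that(2,1) by (induction b rule: int_ge_induct) (auto simp: sing prob_cyl_forward pathp_forward assms(2))
  show ?thesis
  proof (cases "0 \<le> a")
    case True
    then show ?thesis using nonneg assms by blast
  next
    case False
    \<comment> \<open>\<open>{c..b}\<close> is \<open>{0..b}\<close> for nonnegative
      \<open>b\<close> and the single time \<open>b\<close> otherwise; all times further left are
      added backwards.\<close>
    define c where "c = min 0 b"
    have c: "c \<le> b" "c \<le> 0" "a \<le> c" using False assms(1) by (auto simp: c_def)
    have base: "prob (cyl PM (Z m) {c..b} s) = pathp m c b s"
      using nonneg[of 0 b] sing[of b] by (cases "0 \<le> b") (auto simp: c_def)
    show ?thesis using \<open>a \<le> c\<close>
    proof (induction a rule: int_le_induct)
      case base
      show ?case by fact
    next
      case (step i)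
      then show ?case using c by (subst prob_cyl_backward) (auto simp: pathp_backward assms(2))
    qed
  qed
qed

lemma prob_two_times:
  assumes "x \<in> tri" "y \<in> tri"
  shows "prob {\<omega>. Z m 0 \<omega> = x \<and> Z m (int n) \<omega> = y}
    = pmass (w m) x * (\<rho> m ^ n * (if x = y then 1 else 0) + (1 - \<rho> m ^ n) * pmass (w m) y)"
proof (induction n)
  case 0
  have "{\<omega>. Z m 0 \<omega> = x \<and> Z m (int 0) \<omega> = y} = (if x = y then {\<omega>. Z m 0 \<omega> = x} else {})" by auto
  then show ?case using prob_Z[OF assms(1), of m 0] prob_Z[OF assms(2), of m 0] by auto
next
  case (Suc n)
  let ?E = "{\<omega>. Z m 0 \<omega> = x}"
  have d0: "depends_only (enc m ` {0..int n}) (Z m 0)" and dn: "depends_only (enc m ` {0..int n}) (Z m (int n))"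
    by (rule Z_depends; force)+
  have dE: "depends_only (enc m ` {0..int n}) (\<lambda>\<omega>. \<omega> \<in> ?E)"
    using depends_only_compose[OF d0, of "\<lambda>z. z = x"] by simp
  have "prob {\<omega>\<in>?E. Z m (int n + 1) \<omega> = y} = \<rho> m * prob {\<omega>\<in>?E. Z m (int n) \<omega> = y} + (1 - \<rho> m) * pmass (w m) y * prob ?E"
    by (rule prob_step[OF _ dE dn]) (use assms in \<open>auto simp: Z_forward\<close>)
  then show ?case using Suc prob_Z[OF assms(1), of m 0] by (simp add: algebra_simps)
qed

end

section \<open>Superposition of the components\<close>

definition val :: "(nat \<Rightarrow> real) \<Rightarrow> real" where
  "val v = (\<Sum>m. (1/4) ^ m * v m)"

text \<open>Finite support makes the set countable; the set of all sequences in \<open>tri\<close>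
  is not.\<close>

definition vecs :: "(nat \<Rightarrow> real) set" where
  "vecs = {v. (\<forall>m. v m \<in> tri) \<and> finite {m. v m \<noteq> 0}}"

lemma tri_abs_le: "x \<in> tri \<Longrightarrow> \<bar>x\<bar> \<le> 1"
  by (auto simp: tri_def)

lemma summable_quarter: "summable (\<lambda>m. (1/4::real) ^ m)"
  by (rule summable_geometric) simp

lemma summable_val:
  fixes v :: "nat \<Rightarrow> real"
  assumes "\<And>m. \<bar>v m\<bar> \<le> c"
  shows "summable (\<lambda>m. (1/4) ^ m * v m)"
proof (rule summable_comparison_test')
  show "summable (\<lambda>m. c * (1/4::real) ^ m)" using summable_quarter by (rule summable_mult)
  show "norm ((1/4) ^ m * v m) \<le> c * (1/4) ^ m" if "m \<ge> 0" for m
    using assms[of m] by (simp add: abs_mult mult.commute mult_right_mono)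
qed

lemma abs_val_le:
  assumes "\<And>m. \<bar>v m\<bar> \<le> 1"
  shows "\<bar>val v\<bar> \<le> 4/3"
proof -
  have "\<bar>val v\<bar> \<le> (\<Sum>m. (1/4::real) ^ m)"
    unfolding val_def real_norm_def[symmetric]
    by (rule norm_suminf_le[OF _ summable_quarter]) (use assms in \<open>simp add: abs_mult mult_left_le\<close>)
  also have "\<dots> = 4/3" by (simp add: suminf_geometric)
  finally show ?thesis .
qed

text \<open>At the first index m where the digits differ the gap is at least 4^{-m}, while all later
  digits, with differences at most 2, contribute at most (2/3) 4^{-m}. With base 3 the two bounds
  would coincide, hence base 4.\<close>

lemma val_inject:
  assumes v: "\<And>m. v m \<in> tri" and u: "\<And>m. u m \<in> tri" and eq: "val v = val u"
  shows "v = u"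
proof (rule ccontr)
  assume ne: "v \<noteq> u"
  define d where "d m = v m - u m" for m
  from ne have "\<exists>m. d m \<noteq> 0" by (auto simp: d_def)
  define m where "m = (LEAST m. d m \<noteq> 0)"
  have dm: "d m \<noteq> 0" unfolding m_def by (rule LeastI_ex) fact
  have d0: "d j = 0" if "j < m" for j using not_less_Least[of j "\<lambda>m. d m \<noteq> 0"] that by (auto simp: m_def)
  have d2: "\<bar>d j\<bar> \<le> 2" for j using tri_abs_le[OF v[of j]] tri_abs_le[OF u[of j]] by (simp add: d_def)
  have d1: "1 \<le> \<bar>d m\<bar>" using dm v[of m] u[of m] by (auto simp: d_def tri_def)
  let ?f = "\<lambda>j. (1/4::real) ^ j * d j"
  have sf: "summable ?f" by (rule summable_val[OF d2])
  have "suminf ?f = val v - val u"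
    unfolding val_def d_def using tri_abs_le v u
    by (subst suminf_diff) (auto intro!: summable_val[of _ 1] simp: right_diff_distrib)
  then have "0 = (\<Sum>n. ?f (n + Suc m)) + (\<Sum>i<Suc m. ?f i)"
    using suminf_split_initial_segment[OF sf, of "Suc m"] eq by simp
  also have "(\<Sum>i<Suc m. ?f i) = ?f m" by (simp add: d0)
  finally have "\<bar>?f m\<bar> = \<bar>\<Sum>n. ?f (n + Suc m)\<bar>" by linarith
  also have "\<dots> \<le> (\<Sum>n. 2 * (1/4) ^ Suc m * (1/4::real) ^ n)"
    unfolding real_norm_def[symmetric]
  proof (rule norm_suminf_le)
    show "summable (\<lambda>n. 2 * (1/4) ^ Suc m * (1/4::real) ^ n)" using summable_quarter by (rule summable_mult)
    show "norm (?f (n + Suc m)) \<le> 2 * (1/4) ^ Suc m * (1/4) ^ n" for n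
      using d2[of "n + Suc m"] by (simp add: abs_mult power_add mult_ac)
  qed
  also have "\<dots> = 2 * (1/4) ^ Suc m * (4/3)"
    by (subst suminf_mult[OF summable_quarter]) (simp add: suminf_geometric)
  also have "\<dots> < (1/4) ^ m" by simp
  also have "\<dots> \<le> \<bar>?f m\<bar>" using d1 by (simp add: abs_mult)
  finally show False by simp
qed

definition states :: "real set" where
  "states = val ` vecs"

lemma countable_vecs: "countable vecs"
proof -
  have "vecs \<subseteq> (\<Union>n. {v. \<forall>m. (m \<in> {..<n} \<longrightarrow> v m \<in> tri) \<and> (m \<notin> {..<n} \<longrightarrow> v m = 0)})"
  proof
    fix v assume v: "v \<in> vecs"
    then obtain n where "\<And>m. v m \<noteq> 0 \<Longrightarrow> m < n"
      unfolding vecs_def by (auto dest!: finite_nat_bounded)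
    then have "v m = 0" if "m \<notin> {..<n}" for m using that by auto
    then have "v \<in> {v. \<forall>m. (m \<in> {..<n} \<longrightarrow> v m \<in> tri) \<and> (m \<notin> {..<n} \<longrightarrow> v m = 0)}"
      using v by (simp add: vecs_def)
    then show "v \<in> (\<Union>n. {v. \<forall>m. (m \<in> {..<n} \<longrightarrow> v m \<in> tri) \<and> (m \<notin> {..<n} \<longrightarrow> v m = 0)})"
      by blast
  qed
  moreover have "countable (\<Union>n. {v. \<forall>m. (m \<in> {..<n} \<longrightarrow> v m \<in> tri) \<and> (m \<notin> {..<n::nat} \<longrightarrow> v m = 0)})"
    by (rule countable_UN[OF countableI_type], rule countable_finite, rule finite_set_of_finite_funs) (auto simp: tri_def)
  ultimately show ?thesis by (rule countable_subset)
qed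

lemma countable_states: "countable states"
  unfolding states_def by (intro countable_image countable_vecs)

lemma zero_vecs: "(\<lambda>_. 0) \<in> vecs"
  by (simp add: vecs_def tri_def)

lemma zero_states: "0 \<in> states"
proof -
  have "val (\<lambda>_. 0) = 0" by (simp add: val_def)
  then show ?thesis unfolding states_def using zero_vecs by (metis imageI)
qed

text \<open>The zero vector off \<open>states\<close> lets \<open>dig_tri\<close> and
  \<open>dig_finite\<close> hold without side conditions.\<close>

definition dig :: "real \<Rightarrow> nat \<Rightarrow> real" where
  "dig x = (if x \<in> states then (SOME v. v \<in> vecs \<and> val v = x) else (\<lambda>_. 0))"

lemma dig_val: "x \<in> states \<Longrightarrow> dig x \<in> vecs \<and> val (dig x) = x"
proof -
  assume x: "x \<in> states"
  then have "\<exists>v. v \<in> vecs \<and> val v = x" by (auto simp: states_def)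
  from someI_ex[OF this] show ?thesis using x by (simp add: dig_def)
qed

lemma dig_vecs: "dig x \<in> vecs"
  using dig_val[of x] zero_vecs by (cases "x \<in> states") (auto simp: dig_def)

lemma dig_tri: "dig x m \<in> tri"
  using dig_vecs[of x] by (simp add: vecs_def)

lemma dig_finite: "finite {m. dig x m \<noteq> 0}"
  using dig_vecs[of x] by (simp add: vecs_def)

locale product_chain = refresh_chain +
  assumes sw: "summable w"
begin

definition Y :: "int \<Rightarrow> (int \<Rightarrow> real) \<Rightarrow> real" where
  "Y k \<omega> = val (\<lambda>m. Z m k \<omega>)"

text \<open>Only on a null set does \<open>Y k\<close> leave the countable set \<open>states\<close>.\<close>
definition X :: "int \<Rightarrow> (int \<Rightarrow> real) \<Rightarrow> real" where
  "X k \<omega> = (if Y k \<omega> \<in> states then Y k \<omega> else 0)"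

lemma X_in_states: "X k \<omega> \<in> states"
  by (simp add: X_def zero_states)

lemma measurable_Y [measurable]: "Y k \<in> borel_measurable PM"
  unfolding Y_def[abs_def] val_def by measurable

lemma measurable_X [measurable]: "X k \<in> borel_measurable PM"
proof -
  have [measurable]: "states \<in> sets borel"
    using countable_states by (rule sets.countable[rotated]) auto
  show ?thesis unfolding X_def[abs_def] by measurable
qed

section \<open>Path probabilities of the superposition as limits of products\<close>

lemma pathp_shift: "pathp m (a + c) (b + c) (\<lambda>i. s (i - c)) = pathp m a b s"
proof -
  have "(\<Prod>i\<in>{a + c..<b + c}. kern (\<rho> m) (w m) (s (i - c)) (s (i + 1 - c))) = (\<Prod>i\<in>{a..<b}. kern (\<rho> m) (w m) (s i) (s (i + 1)))"
    by (rule prod.reindex_bij_witness[of _ "\<lambda>i. i + c" "\<lambda>i. i - c"]) (auto simp: algebra_simps)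
  then show ?thesis by (simp add: pathp_def)
qed

lemma pathp_reflect: "a \<le> b \<Longrightarrow> pathp m (- b) (- a) (\<lambda>i. s (- i)) = pathp m a b s"
proof (induction b rule: int_ge_induct)
  case base
  show ?case by (simp add: pathp_def)
next
  case (step b)
  have "pathp m (- b - 1) (- a) (\<lambda>i. s (- i)) = pathp m (- b) (- a) (\<lambda>i. s (- i)) * kern (\<rho> m) (w m) (s b) (s (b + 1))"
    using step by (subst pathp_backward) (simp_all add: algebra_simps)
  then show ?case using step by (simp add: pathp_forward)
qed

lemma pathp_markov:
  assumes "a \<le> k" "k \<le> b"
  shows "pathp m a b s * pathp m k k s = pathp m a k s * pathp m k b s"
proof -
  have "{a..<b} = {a..<k} \<union> {k..<b}" using assms by auto
  then have "(\<Prod>i\<in>{a..<b}. kern (\<rho> m) (w m) (s i) (s (i + 1)))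
      = (\<Prod>i\<in>{a..<k}. kern (\<rho> m) (w m) (s i) (s (i + 1))) * (\<Prod>i\<in>{k..<b}. kern (\<rho> m) (w m) (s i) (s (i + 1)))"
    by (simp add: prod.union_disjoint)
  then show ?thesis by (simp add: pathp_def)
qed

lemma prob_Z_nonzero: "prob {\<omega>. Z m k \<omega> \<noteq> 0} = w m"
proof -
  have "{\<omega>. Z m k \<omega> \<noteq> 0} = space PM - {\<omega>. Z m k \<omega> = 0}" by auto
  then have "prob {\<omega>. Z m k \<omega> \<noteq> 0} = prob (space PM - {\<omega>. Z m k \<omega> = 0})" by (rule arg_cong)
  also have "\<dots> = 1 - prob {\<omega>. Z m k \<omega> = 0}" by (rule prob_compl) (rule Z_events)
  finally show ?thesis using prob_Z[of 0 m k] by (simp add: tri_def pmass_def)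
qed

definition good :: "(int \<Rightarrow> real) \<Rightarrow> bool" where
  "good \<omega> \<longleftrightarrow> (\<forall>k. finite {m. Z m k \<omega> \<noteq> 0})"

text \<open>Borel-Cantelli: component \<open>m\<close> is nonzero at time \<open>k\<close> with
  probability \<open>w m\<close>, and these sum up. Almost surely only finitely many digits are
  nonzero, which keeps the state space countable.\<close>

lemma AE_good: "AE \<omega> in PM. good \<omega>"
  unfolding good_def
proof (rule AE_all_countable[THEN iffD2], rule allI)
  fix k
  have [measurable]: "{\<omega>. Z m k \<omega> \<noteq> 0} \<in> events" for m
  proof -
    have "{\<omega>\<in>space PM. Z m k \<omega> \<noteq> 0} \<in> events" by measurable
    then show ?thesis by simp
  qed
  have "AE \<omega> in PM. eventually (\<lambda>m. \<omega> \<in> space PM - {\<omega>. Z m k \<omega> \<noteq> 0}) sequentially"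
    by (rule borel_cantelli_AE1) (use sw in \<open>simp_all add: prob_Z_nonzero emeasure_eq_measure\<close>)
  then show "AE \<omega> in PM. finite {m. Z m k \<omega> \<noteq> 0}"
  proof eventually_elim
    case (elim \<omega>)
    then obtain N where "\<And>m. m \<ge> N \<Longrightarrow> Z m k \<omega> = 0" by (auto simp: eventually_sequentially)
    then have "{m. Z m k \<omega> \<noteq> 0} \<subseteq> {..<N}" using not_le by blast
    then show ?case by (rule finite_subset) simp
  qed
qed

lemma good_X:
  assumes "good \<omega>"
  shows "X k \<omega> = Y k \<omega>"
proof -
  have "(\<lambda>m. Z m k \<omega>) \<in> vecs" using assms by (auto simp: good_def vecs_def Z_in_tri)
  then have "Y k \<omega> \<in> states" by (auto simp: Y_def states_def)
  then show ?thesis by (simp add: X_def)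
qed

lemma good_X_eq_iff:
  assumes "good \<omega>" "x \<in> states"
  shows "X k \<omega> = x \<longleftrightarrow> (\<forall>m. Z m k \<omega> = dig x m)"
proof -
  have "X k \<omega> = x \<longleftrightarrow> val (\<lambda>m. Z m k \<omega>) = val (dig x)"
    using dig_val[OF assms(2)] by (simp add: good_X[OF assms(1)] Y_def)
  also have "\<dots> \<longleftrightarrow> (\<lambda>m. Z m k \<omega>) = dig x"
    using val_inject[of "\<lambda>m. Z m k \<omega>" "dig x"] Z_in_tri dig_tri by auto
  finally show ?thesis by (simp add: fun_eq_iff)
qed

lemma prob_blocks:
  assumes I: "finite I"
  shows "prob (\<Inter>m\<in>{..<M}. cyl PM (Z m) I (\<lambda>i. v i m)) = (\<Prod>m<M. prob (cyl PM (Z m) I (\<lambda>i. v i m)))"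
proof (induction M)
  case 0
  show ?case using prob_space by simp
next
  case (Suc M)
  let ?C = "\<lambda>m. cyl PM (Z m) I (\<lambda>i. v i m)"
  have dep: "depends_only (range (enc m)) (\<lambda>\<omega>. \<omega> \<in> ?C m)" for m
    by (rule cyl_Z_depends, rule Z_depends) simp
  have "prob ((\<Inter>m\<in>{..<M}. ?C m) \<inter> ?C M) = prob (\<Inter>m\<in>{..<M}. ?C m) * prob (?C M)"
  proof (rule prob_Int_depends_only[where I="\<Union>m\<in>{..<M}. range (enc m)" and J="range (enc M)"])
    show "(\<Inter>m\<in>{..<M}. ?C m) \<in> events"
      using I by (cases "M = 0") (auto intro!: sets.finite_INT)
    show "?C M \<in> events" using I by simp
    show "depends_only (range (enc M)) (\<lambda>\<omega>. \<omega> \<in> ?C M)" by (rule dep)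
    show "depends_only (\<Union>m\<in>{..<M}. range (enc m)) (\<lambda>\<omega>. \<omega> \<in> (\<Inter>m\<in>{..<M}. ?C m))"
      unfolding depends_only_def
    proof (intro allI impI)
      fix \<omega> \<omega>' :: "int \<Rightarrow> real" assume eq: "\<forall>i\<in>\<Union>m\<in>{..<M}. range (enc m). \<omega> i = \<omega>' i"
      have "\<omega> \<in> ?C m \<longleftrightarrow> \<omega>' \<in> ?C m" if "m < M" for m
        by (rule depends_onlyD[OF dep]) (use eq that in auto)
      then show "(\<omega> \<in> (\<Inter>m\<in>{..<M}. ?C m)) = (\<omega>' \<in> (\<Inter>m\<in>{..<M}. ?C m))" by auto
    qed
  qed auto
  moreover have "(\<Inter>m\<in>{..<Suc M}. ?C m) = (\<Inter>m\<in>{..<M}. ?C m) \<inter> ?C M"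
    by (auto simp: lessThan_Suc)
  ultimately show ?case using Suc by (simp add: mult.commute)
qed

text \<open>By unique digits, and up to a null set, the path of \<open>X\<close> is \<open>s\<close>
  if and only if every component follows its digits. The events for the first \<open>M\<close>
  components decrease to this one and have product probabilities by independence.\<close>

lemma prob_cyl_X:
  assumes I: "finite I" and s: "\<And>i. i \<in> I \<Longrightarrow> s i \<in> states"
  shows "(\<lambda>M. \<Prod>m<M. prob (cyl PM (Z m) I (\<lambda>i. dig (s i) m))) \<longlonglongrightarrow> prob (cyl PM X I s)"
proof -
  let ?C = "\<lambda>m. cyl PM (Z m) I (\<lambda>i. dig (s i) m)"
  define E where "E M = (\<Inter>m\<in>{..<M}. ?C m)" for M
  have E: "E M \<in> events" for M
    unfolding E_def using I by (cases "M = 0") (auto intro!: sets.finite_INT)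
  have "(\<lambda>M. prob (E M)) \<longlonglongrightarrow> prob (\<Inter>M. E M)"
    by (rule finite_Lim_measure_decseq) (use E in \<open>auto simp: decseq_def E_def\<close>)
  also have "prob (\<Inter>M. E M) = prob (cyl PM X I s)"
  proof (rule finite_measure_eq_AE)
    show "AE \<omega> in PM. \<omega> \<in> (\<Inter>M. E M) \<longleftrightarrow> \<omega> \<in> cyl PM X I s"
      using AE_good
    proof eventually_elim
      case (elim \<omega>)
      have "\<omega> \<in> (\<Inter>M. E M) \<longleftrightarrow> (\<forall>m. \<omega> \<in> ?C m)" unfolding E_def by blast
      also have "\<dots> \<longleftrightarrow> (\<forall>i\<in>I. \<forall>m. Z m i \<omega> = dig (s i) m)" by (auto simp: cyl_def)
      also have "\<dots> \<longleftrightarrow> (\<forall>i\<in>I. X i \<omega> = s i)" using good_X_eq_iff[OF elim s] by blast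
      finally show ?case by (simp add: cyl_def)
    qed
  qed (use E I in \<open>auto intro!: sets_cyl sets.countable_INT''\<close>)
  finally show ?thesis unfolding E_def prob_blocks[OF I, of "\<lambda>i. dig (s i)"] .
qed

lemma cyl_shift: "cyl M (\<lambda>k. X (k + c)) {a..b} s = cyl M X {a + c..b + c} (\<lambda>i. s (i - c))" for c :: int
proof -
  have "(\<forall>i\<in>{a..b}. X (i + c) \<omega> = s i) \<longleftrightarrow> (\<forall>i\<in>{a + c..b + c}. X i \<omega> = s (i - c))" for \<omega>
  proof (intro iffI ballI)
    fix i assume "\<forall>i\<in>{a..b}. X (i + c) \<omega> = s i" "i \<in> {a + c..b + c}"
    then show "X i \<omega> = s (i - c)" by (auto dest!: bspec[of _ _ "i - c"])
  next
    fix i assume "\<forall>i\<in>{a + c..b + c}. X i \<omega> = s (i - c)" "i \<in> {a..b}"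
    then show "X (i + c) \<omega> = s i" by (auto dest!: bspec[of _ _ "i + c"])
  qed
  then show ?thesis by (simp add: cyl_def)
qed

lemma cyl_reflect: "cyl M (\<lambda>k. X (- k)) {a..b} s = cyl M X {- b..- a} (\<lambda>i. s (- i))" for a b :: int
proof -
  have "(\<forall>i\<in>{a..b}. X (- i) \<omega> = s i) \<longleftrightarrow> (\<forall>i\<in>{- b..- a}. X i \<omega> = s (- i))" for \<omega>
  proof (intro iffI ballI)
    fix i assume "\<forall>i\<in>{a..b}. X (- i) \<omega> = s i" "i \<in> {- b..- a}"
    then show "X i \<omega> = s (- i)" by (auto dest!: bspec[of _ _ "- i"])
  next
    fix i assume "\<forall>i\<in>{- b..- a}. X i \<omega> = s (- i)" "i \<in> {a..b}"
    then show "X (- i) \<omega> = s i" by (auto dest!: bspec[of _ _ "- i"])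
  qed
  then show ?thesis by (simp add: cyl_def)
qed

lemma prob_window:
  assumes "a \<le> b" "\<And>i. i \<in> {a..b} \<Longrightarrow> s i \<in> states"
  shows "(\<lambda>M. \<Prod>m<M. pathp m a b (\<lambda>i. dig (s i) m)) \<longlonglongrightarrow> prob (cyl PM X {a..b} s)"
  using prob_cyl_X[of "{a..b}" s] assms by (simp add: prob_cyl_Z dig_tri)

lemma prob_pair:
  assumes "s \<in> states" "t \<in> states" "0 < n"
  shows "(\<lambda>M. \<Prod>m<M. pmass (w m) (dig s m) * (\<rho> m ^ n * (if dig s m = dig t m then 1 else 0) + (1 - \<rho> m ^ n) * pmass (w m) (dig t m)))
    \<longlonglongrightarrow> prob {\<omega>\<in>space PM. X 0 \<omega> = s \<and> X (int n) \<omega> = t}"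
proof -
  \<comment> \<open>For \<open>n = 0\<close> the two times would coincide and \<open>t\<close> would
    be lost, hence the assumption \<open>0 < n\<close>.\<close>
  let ?s = "\<lambda>i::int. if i = 0 then s else t"
  have "cyl PM X {0, int n} ?s = {\<omega>\<in>space PM. X 0 \<omega> = s \<and> X (int n) \<omega> = t}"
    using assms(3) by (auto simp: cyl_def)
  moreover have "prob (cyl PM (Z m) {0, int n} (\<lambda>i. dig (?s i) m))
    = pmass (w m) (dig s m) * (\<rho> m ^ n * (if dig s m = dig t m then 1 else 0) + (1 - \<rho> m ^ n) * pmass (w m) (dig t m))" for m
  proof -
    have "cyl PM (Z m) {0, int n} (\<lambda>i. dig (?s i) m) = {\<omega>. Z m 0 \<omega> = dig s m \<and> Z m (int n) \<omega> = dig t m}"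
      using assms(3) by (auto simp: cyl_def)
    then show ?thesis using prob_two_times[OF dig_tri[of s m] dig_tri[of t m], of m n] by simp
  qed
  ultimately show ?thesis using prob_cyl_X[of "{0, int n}" ?s] assms by simp
qed

lemma prob_single:
  assumes "s \<in> states"
  shows "(\<lambda>M. \<Prod>m<M. pmass (w m) (dig s m)) \<longlonglongrightarrow> prob {\<omega>\<in>space PM. X 0 \<omega> = s}"
  using prob_window[of 0 0 "\<lambda>_. s"] assms by (simp add: pathp_def cyl_def)

section \<open>Positivity of transitions and asymptotic independence\<close>

lemma pmass_pos: "y \<in> tri \<Longrightarrow> 0 < pmass (w m) y"
  using w[of m] by (auto simp: tri_def pmass_def)

lemma pmass_le_1: "pmass (w m) y \<le> 1"
  using w[of m] by (auto simp: pmass_def)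

lemma dig_eventually_zero:
  obtains N where "\<And>m. N \<le> m \<Longrightarrow> dig s m = 0" "\<And>m. N \<le> m \<Longrightarrow> dig t m = 0"
proof -
  from finite_nat_bounded[OF dig_finite[of s]] obtain N1 where N1: "{m. dig s m \<noteq> 0} \<subseteq> {..<N1}" by blast
  from finite_nat_bounded[OF dig_finite[of t]] obtain N2 where N2: "{m. dig t m \<noteq> 0} \<subseteq> {..<N2}" by blast
  have "dig s m = 0 \<and> dig t m = 0" if "max N1 N2 \<le> m" for m
    using N1 N2 that by (auto simp: subset_iff)
  then show ?thesis using that by blast
qed

text \<open>Every factor of the infinite product is positive. Where both digits have become 0 the
  factor is at least \<open>1 - 2 * w m\<close>, so summability of \<open>w\<close> keeps the tail
  of the product away from 0.\<close>

lemma charge: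
  assumes "s \<in> states" "t \<in> states"
  shows "0 < prob {\<omega>\<in>space PM. X 0 \<omega> = s \<and> X 1 \<omega> = t}"
proof -
  define p where "p m = pmass (w m) (dig s m) * (\<rho> m * (if dig s m = dig t m then 1 else 0) + (1 - \<rho> m) * pmass (w m) (dig t m))" for m
  have lim: "(\<lambda>M. \<Prod>m<M. p m) \<longlonglongrightarrow> prob {\<omega>\<in>space PM. X 0 \<omega> = s \<and> X 1 \<omega> = t}"
    using prob_pair[OF assms, of 1] by (simp add: p_def)
  have ppos: "0 < p m" for m
    unfolding p_def using \<rho>[of m] pmass_pos[OF dig_tri, of m]
    by (intro mult_pos_pos add_nonneg_pos) auto
  have ple: "p m \<le> 1" for m
  proof -
    have "\<rho> m * (if dig s m = dig t m then 1 else 0) + (1 - \<rho> m) * pmass (w m) (dig t m) \<le> \<rho> m * 1 + (1 - \<rho> m) * 1"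
      using \<rho>[of m] pmass_le_1[of m] by (intro add_mono mult_left_mono) auto
    moreover have "0 \<le> \<rho> m * (if dig s m = dig t m then 1 else 0) + (1 - \<rho> m) * pmass (w m) (dig t m)"
      using \<rho>[of m] pmass_pos[OF dig_tri, of m t m] by (intro add_nonneg_nonneg mult_nonneg_nonneg) auto
    ultimately show ?thesis
      unfolding p_def using pmass_le_1[of m] pmass_pos[OF dig_tri, of m s m] by (intro mult_le_one) auto
  qed
  obtain N where N: "\<And>m. N \<le> m \<Longrightarrow> dig s m = 0" "\<And>m. N \<le> m \<Longrightarrow> dig t m = 0" using dig_eventually_zero by blast
  \<comment> \<open>A tail of \<open>w\<close> below 1/4 makes the defects \<open>2 * w m\<close>
    sum to at most 1/2, which leaves at least half of the head product.\<close>
  obtain K where K: "\<And>m n. K \<le> m \<Longrightarrow> \<bar>\<Sum>i\<in>{m..<n}. w i\<bar> < 1/4"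
    using sw[unfolded summable_Cauchy, rule_format, of "1/4"] by auto
  define M1 where "M1 = max N K"
  have pge: "1 - 2 * w m \<le> p m" if "M1 \<le> m" for m
  proof -
    have "p m = (1 - w m) * (1 - (1 - \<rho> m) * w m)"
      using N that by (simp add: p_def M1_def pmass_def algebra_simps)
    also have "\<dots> \<ge> (1 - w m) * (1 - w m)"
      using \<rho>[of m] w[of m] by (intro mult_left_mono) (auto simp: mult_left_le_one_le)
    also have "(1 - w m) * (1 - w m) \<ge> 1 - 2 * w m" by (simp add: algebra_simps)
    finally show ?thesis by simp
  qed
  have low: "(\<Prod>m<M1. p m) / 2 \<le> (\<Prod>m<M. p m)" if "M1 \<le> M" for M
  proof -
    have "norm ((\<Prod>m\<in>{M1..<M}. 1) - (\<Prod>m\<in>{M1..<M}. p m)) \<le> (\<Sum>m\<in>{M1..<M}. norm (1 - p m))"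
    proof (rule norm_prod_diff)
      show "norm (p m) \<le> 1" for m using ppos[of m] ple[of m] by simp
    qed simp
    also have "\<dots> \<le> (\<Sum>m\<in>{M1..<M}. 2 * w m)"
    proof (rule sum_mono)
      fix m assume "m \<in> {M1..<M}"
      then show "norm (1 - p m) \<le> 2 * w m" using pge[of m] ple[of m] by simp
    qed
    also have "\<dots> \<le> 1/2" using K[of M1 M] by (simp add: sum_distrib_left[symmetric] M1_def)
    finally have "1/2 \<le> (\<Prod>m\<in>{M1..<M}. p m)" by (simp only: prod.neutral_const real_norm_def)
    moreover have "(\<Prod>m<M. p m) = (\<Prod>m<M1. p m) * (\<Prod>m\<in>{M1..<M}. p m)"
      using that by (metis prod.atLeastLessThan_concat atLeast0LessThan le0)
    moreover have "0 \<le> (\<Prod>m<M1. p m)" using ppos by (intro prod_nonneg) (auto intro: less_imp_le)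
    ultimately show ?thesis using mult_left_mono[of "1/2" "\<Prod>m\<in>{M1..<M}. p m" "\<Prod>m<M1. p m"] by simp
  qed
  have "(\<Prod>m<M1. p m) / 2 \<le> prob {\<omega>\<in>space PM. X 0 \<omega> = s \<and> X 1 \<omega> = t}"
    by (rule LIMSEQ_le_const[OF lim]) (use low in blast)
  moreover have "0 < (\<Prod>m<M1. p m)" using ppos by (intro prod_pos) auto
  ultimately show ?thesis by linarith
qed

text \<open>The factor of component \<open>m\<close> converges at the rate
  \<open>\<rho> m ^ n\<close>, which need not be uniform in \<open>m\<close>. Beyond the supports of
  the digits, however, the factors differ by at most \<open>w m\<close> for every \<open>n\<close>.
  A tail small by summability is therefore cut off before \<open>n\<close> tends to
  infinity.\<close>

lemma asymp_indep:
  assumes "s \<in> states" "t \<in> states"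
  shows "(\<lambda>n. prob {\<omega>\<in>space PM. X 0 \<omega> = s \<and> X (int n) \<omega> = t})
    \<longlonglongrightarrow> prob {\<omega>\<in>space PM. X 0 \<omega> = s} * prob {\<omega>\<in>space PM. X 0 \<omega> = t}"
proof (rule LIMSEQ_I)
  fix r :: real assume r: "0 < r"
  define p where "p n m = pmass (w m) (dig s m) * (\<rho> m ^ n * (if dig s m = dig t m then 1 else 0) + (1 - \<rho> m ^ n) * pmass (w m) (dig t m))" for n m
  define u where "u m = pmass (w m) (dig s m) * pmass (w m) (dig t m)" for m
  obtain N where N: "\<And>m. N \<le> m \<Longrightarrow> dig s m = 0" "\<And>m. N \<le> m \<Longrightarrow> dig t m = 0" using dig_eventually_zero by blast
  obtain K where K: "\<And>m n. K \<le> m \<Longrightarrow> \<bar>\<Sum>i\<in>{m..<n}. w i\<bar> < r/3"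
    using sw[unfolded summable_Cauchy, rule_format, of "r/3"] r by auto
  define M1 where "M1 = max N K"
  have rn: "0 \<le> \<rho> m ^ n" "\<rho> m ^ n \<le> 1" for m n using \<rho>[of m] by (auto intro: power_le_one)
  have pm: "0 \<le> pmass (w m) (dig s m)" "0 \<le> pmass (w m) (dig t m)" for m
    using pmass_pos[OF dig_tri] less_imp_le by blast+
  have pu: "p n m - u m = pmass (w m) (dig s m) * (\<rho> m ^ n * ((if dig s m = dig t m then 1 else 0) - pmass (w m) (dig t m)))" for n m
    by (simp add: p_def u_def algebra_simps)
  have d1: "\<bar>p n m - u m\<bar> \<le> \<rho> m ^ n * \<bar>(if dig s m = dig t m then 1 else 0) - pmass (w m) (dig t m)\<bar>" for n m
    unfolding pu abs_mult using rn[of m n] pm[of m] pmass_le_1[of m]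
    by (simp add: mult_left_le_one_le)
  have d2: "\<bar>p n m - u m\<bar> \<le> \<rho> m ^ n" for n m
  proof -
    have "\<bar>(if dig s m = dig t m then 1 else 0) - pmass (w m) (dig t m)\<bar> \<le> 1"
      using pm[of m] pmass_le_1[of m "dig t m"] by auto
    then have "\<rho> m ^ n * \<bar>(if dig s m = dig t m then 1 else 0) - pmass (w m) (dig t m)\<bar> \<le> \<rho> m ^ n * 1"
      using rn by (intro mult_left_mono) auto
    then show ?thesis using d1[of n m] by linarith
  qed
  have d3: "\<bar>p n m - u m\<bar> \<le> w m" if "M1 \<le> m" for n m
  proof -
    have "\<bar>(if dig s m = dig t m then 1 else 0) - pmass (w m) (dig t m)\<bar> = w m"
      using N that w[of m] by (simp add: M1_def pmass_def)
    then have "\<rho> m ^ n * \<bar>(if dig s m = dig t m then 1 else 0) - pmass (w m) (dig t m)\<bar> \<le> 1 * w m"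
      using rn w[of m] by (intro mult_mono) auto
    then show ?thesis using d1[of n m] by linarith
  qed
  have pb: "\<bar>p n m\<bar> \<le> 1" "\<bar>u m\<bar> \<le> 1" for n m
  proof -
    show "\<bar>u m\<bar> \<le> 1" unfolding u_def abs_mult using pm[of m] pmass_le_1[of m] by (intro mult_le_one) auto
    have "\<rho> m ^ n * (if dig s m = dig t m then 1 else 0) + (1 - \<rho> m ^ n) * pmass (w m) (dig t m) \<le> \<rho> m ^ n * 1 + (1 - \<rho> m ^ n) * 1"
      using rn[of m n] pmass_le_1[of m] by (intro add_mono mult_left_mono) auto
    moreover have "0 \<le> \<rho> m ^ n * (if dig s m = dig t m then 1 else 0) + (1 - \<rho> m ^ n) * pmass (w m) (dig t m)"
      using rn[of m n] pm[of m] by (intro add_nonneg_nonneg mult_nonneg_nonneg) auto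
    ultimately show "\<bar>p n m\<bar> \<le> 1"
      unfolding p_def abs_mult using pm[of m] pmass_le_1[of m] by (intro mult_le_one) auto
  qed
  have "(\<lambda>n. \<Sum>m<M1. \<rho> m ^ n) \<longlonglongrightarrow> (\<Sum>m<M1. 0)"
    using \<rho> by (intro tendsto_sum LIMSEQ_realpow_zero) (auto intro: less_imp_le)
  then have "\<forall>\<^sub>F n in sequentially. (\<Sum>m<M1. \<rho> m ^ n) < r/3" using r by (intro order_tendstoD) auto
  then obtain N0 where N0: "\<And>n. N0 \<le> n \<Longrightarrow> (\<Sum>m<M1. \<rho> m ^ n) < r/3" by (auto simp: eventually_sequentially)
  have main: "\<bar>prob {\<omega>\<in>space PM. X 0 \<omega> = s \<and> X (int n) \<omega> = t} - prob {\<omega>\<in>space PM. X 0 \<omega> = s} * prob {\<omega>\<in>space PM. X 0 \<omega> = t}\<bar> < r"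
    if n: "max N0 1 \<le> n" for n
  proof -
    have l1: "(\<lambda>M. \<Prod>m<M. p n m) \<longlonglongrightarrow> prob {\<omega>\<in>space PM. X 0 \<omega> = s \<and> X (int n) \<omega> = t}"
      unfolding p_def using n by (intro prob_pair assms) auto
    have l2: "(\<lambda>M. \<Prod>m<M. u m) \<longlonglongrightarrow> prob {\<omega>\<in>space PM. X 0 \<omega> = s} * prob {\<omega>\<in>space PM. X 0 \<omega> = t}"
      unfolding u_def prod.distrib by (intro tendsto_mult prob_single assms)
    have "\<bar>(\<Prod>m<M. p n m) - (\<Prod>m<M. u m)\<bar> \<le> 2 * (r/3)" if M: "M1 \<le> M" for M
    proof -
      have "norm ((\<Prod>m<M. p n m) - (\<Prod>m<M. u m)) \<le> (\<Sum>m<M. norm (p n m - u m))"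
        by (rule norm_prod_diff) (use pb in auto)
      also have "\<dots> = (\<Sum>m<M1. \<bar>p n m - u m\<bar>) + (\<Sum>m\<in>{M1..<M}. \<bar>p n m - u m\<bar>)"
        unfolding lessThan_atLeast0 real_norm_def using M by (intro sum.atLeastLessThan_concat[symmetric]) auto
      also have "\<dots> \<le> (\<Sum>m<M1. \<rho> m ^ n) + (\<Sum>m\<in>{M1..<M}. w m)"
        using d2 d3 by (intro add_mono sum_mono) auto
      also have "\<dots> \<le> r/3 + r/3"
        using N0[of n] K[of M1 M] n by (intro add_mono) (auto simp: M1_def)
      finally show ?thesis by simp
    qed
    then have "\<bar>prob {\<omega>\<in>space PM. X 0 \<omega> = s \<and> X (int n) \<omega> = t} - prob {\<omega>\<in>space PM. X 0 \<omega> = s} * prob {\<omega>\<in>space PM. X 0 \<omega> = t}\<bar> \<le> 2 * (r/3)"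
      by (intro LIMSEQ_le_const2[OF tendsto_rabs[OF tendsto_diff[OF l1 l2]]]) blast
    then show ?thesis using r by linarith
  qed
  show "\<exists>no. \<forall>n\<ge>no. norm (prob {\<omega>\<in>space PM. X 0 \<omega> = s \<and> X (int n) \<omega> = t} - prob {\<omega>\<in>space PM. X 0 \<omega> = s} * prob {\<omega>\<in>space PM. X 0 \<omega> = t}) < r"
    using main by (intro exI[of _ "max N0 1"]) auto
qed

sublocale W: window_chain PM states X
proof
  show "countable states" by (rule countable_states)
  show "X k \<in> borel_measurable PM" for k by measurable
  show "X k \<omega> \<in> states" if "\<omega> \<in> space PM" for k \<omega> by (rule X_in_states)
  show "prob (cyl PM (\<lambda>k. X (k + m)) {a..b} s) = prob (cyl PM X {a..b} s)" if s: "\<forall>i\<in>{a..b}. s i \<in> states" for a b m s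
  proof (cases "a \<le> b")
    case True
    have "(\<lambda>M. \<Prod>j<M. pathp j (a + m) (b + m) (\<lambda>i. dig (s (i - m)) j)) \<longlonglongrightarrow> prob (cyl PM X {a + m..b + m} (\<lambda>i. s (i - m)))"
      using True s by (intro prob_window) auto
    moreover have "pathp j (a + m) (b + m) (\<lambda>i. dig (s (i - m)) j) = pathp j a b (\<lambda>i. dig (s i) j)" for j
      by (rule pathp_shift[where s="\<lambda>i. dig (s i) j"])
    ultimately show ?thesis
      unfolding cyl_shift using LIMSEQ_unique[OF _ prob_window[OF True, of s]] s by simp
  next
    case False
    then show ?thesis by (simp add: cyl_def)
  qed
  show "prob (cyl PM (\<lambda>k. X (- k)) {a..b} s) = prob (cyl PM X {a..b} s)" if s: "\<forall>i\<in>{a..b}. s i \<in> states" for a b s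
  proof (cases "a \<le> b")
    case True
    have "(\<lambda>M. \<Prod>j<M. pathp j (- b) (- a) (\<lambda>i. dig (s (- i)) j)) \<longlonglongrightarrow> prob (cyl PM X {- b..- a} (\<lambda>i. s (- i)))"
      using True s by (intro prob_window) auto
    moreover have "pathp j (- b) (- a) (\<lambda>i. dig (s (- i)) j) = pathp j a b (\<lambda>i. dig (s i) j)" for j
      by (rule pathp_reflect[OF True, where s="\<lambda>i. dig (s i) j"])
    ultimately show ?thesis
      unfolding cyl_reflect using LIMSEQ_unique[OF _ prob_window[OF True, of s]] s by simp
  next
    case False
    then show ?thesis by (simp add: cyl_def)
  qed
  show "prob (cyl PM X {a..b} s) * prob (cyl PM X {k..k} s) = prob (cyl PM X {a..k} s) * prob (cyl PM X {k..b} s)"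
    if ab: "a \<le> k" "k \<le> b" and s: "\<forall>i\<in>{a..b}. s i \<in> states" for a b k s
  proof -
    have l1: "(\<lambda>M. (\<Prod>j<M. pathp j a b (\<lambda>i. dig (s i) j)) * (\<Prod>j<M. pathp j k k (\<lambda>i. dig (s i) j)))
      \<longlonglongrightarrow> prob (cyl PM X {a..b} s) * prob (cyl PM X {k..k} s)"
      using ab s by (intro tendsto_mult prob_window) auto
    have l2: "(\<lambda>M. (\<Prod>j<M. pathp j a k (\<lambda>i. dig (s i) j)) * (\<Prod>j<M. pathp j k b (\<lambda>i. dig (s i) j)))
      \<longlonglongrightarrow> prob (cyl PM X {a..k} s) * prob (cyl PM X {k..b} s)"
      using ab s by (intro tendsto_mult prob_window) auto
    show ?thesis
      using LIMSEQ_unique[OF l1] l2 unfolding prod.distrib[symmetric] pathp_markov[OF ab] by blast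
  qed
  show "0 < prob {\<omega>\<in>space PM. X 0 \<omega> = s \<and> X 1 \<omega> = t}" if "s \<in> states" "t \<in> states" for s t
    using that by (rule charge)
  show "(\<lambda>n. prob {\<omega>\<in>space PM. X 0 \<omega> = s \<and> X (int n) \<omega> = t})
    \<longlonglongrightarrow> prob {\<omega>\<in>space PM. X 0 \<omega> = s} * prob {\<omega>\<in>space PM. X 0 \<omega> = t}" if "s \<in> states" "t \<in> states" for s t
    using that by (rule asymp_indep)
qed

end

section \<open>Moments and characteristic functions of the partial sums\<close>

context product_chain
begin

definition T :: "nat \<Rightarrow> nat \<Rightarrow> (int \<Rightarrow> real) \<Rightarrow> real" where
  "T m n \<omega> = (\<Sum>k=1..n. Z m (int k) \<omega>)"

lemma T_0 [simp]: "T m 0 \<omega> = 0"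
  by (simp add: T_def)

lemma T_Suc: "T m (Suc n) \<omega> = T m n \<omega> + Z m (int n + 1) \<omega>"
  by (simp add: T_def add.commute)

lemma measurable_T [measurable]: "T m n \<in> borel_measurable PM"
  unfolding T_def[abs_def] by measurable

lemma Z_abs_le: "\<bar>Z m k \<omega>\<bar> \<le> 1"
  using Z_in_tri tri_abs_le by blast

lemma T_abs_le: "\<bar>T m n \<omega>\<bar> \<le> real n"
proof -
  have "\<bar>T m n \<omega>\<bar> \<le> (\<Sum>k=1..n. \<bar>Z m (int k) \<omega>\<bar>)" unfolding T_def by (rule sum_abs)
  also have "\<dots> \<le> (\<Sum>k=1..n. 1)" by (intro sum_mono Z_abs_le)
  finally show ?thesis by simp
qed

lemma T_depends: "depends_only (enc m ` {0..int n}) (T m n)"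
proof -
  have "depends_only (enc m ` {0..int n}) (Z m (int k))" if "k \<le> n" for k
    by (rule Z_depends) (use that in auto)
  then show ?thesis unfolding depends_only_def T_def by (auto intro!: sum.cong)
qed

lemma T_depends': "depends_only (range (enc m)) (T m n)"
  by (rule depends_only_mono[OF T_depends]) auto

lemma Z_depends': "depends_only (enc m ` {0..int n}) (Z m (int n))"
  by (rule Z_depends) auto

lemma integrable_bounded:
  fixes f :: "(int \<Rightarrow> real) \<Rightarrow> 'c::{banach, second_countable_topology}"
  assumes "f \<in> borel_measurable PM" "\<And>\<omega>. norm (f \<omega>) \<le> c"
  shows "integrable PM f"
  by (rule integrable_const_bound[of _ c]) (use assms in auto)

lemma integrable_T: "integrable PM (T m n)"
  by (rule integrable_bounded[of _ "real n"]) (auto simp: T_abs_le)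

lemma integrable_T_Z: "integrable PM (\<lambda>\<omega>. T m n \<omega> * Z m k \<omega>)"
proof (rule integrable_bounded[of _ "real n"])
  show "norm (T m n \<omega> * Z m k \<omega>) \<le> real n" for \<omega>
    using mult_mono[OF T_abs_le[of m n \<omega>] Z_abs_le[of m k \<omega>]] by (simp add: abs_mult)
qed measurable

lemma integrable_T_sq: "integrable PM (\<lambda>\<omega>. (T m n \<omega>)\<^sup>2)"
proof (rule integrable_bounded[of _ "(real n)\<^sup>2"])
  show "norm ((T m n \<omega>)\<^sup>2) \<le> (real n)\<^sup>2" for \<omega>
    using power_mono[OF T_abs_le[of m n \<omega>], of 2] by simp
qed measurable

lemma integrable_ind_Z: "integrable PM (\<lambda>\<omega>. indicator A (Z m k \<omega>) :: real)" if [measurable]: "A \<in> sets borel"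
  by (rule integrable_bounded[of _ 1]) (auto simp: indicator_def)

lemma expectation_ind_Z: "(\<integral>\<omega>. indicator {y} (Z m k \<omega>) \<partial>PM) = prob {\<omega>. Z m k \<omega> = y}"
proof -
  have "(\<integral>\<omega>. indicator {y} (Z m k \<omega>) \<partial>PM) = (\<integral>\<omega>. indicator {\<omega>. Z m k \<omega> = y} \<omega> \<partial>PM :: real)"
    by (intro Bochner_Integration.integral_cong) (auto simp: indicator_def)
  then show ?thesis using Z_events by simp
qed

lemma Z_eq_ind: "Z m k \<omega> = indicator {1} (Z m k \<omega>) - indicator {-1} (Z m k \<omega>)"
  using Z_in_tri[of m k \<omega>] by (auto simp: tri_def)

lemma Z_sq_eq_ind: "(Z m k \<omega>)\<^sup>2 = indicator {1} (Z m k \<omega>) + indicator {-1} (Z m k \<omega>)"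
  using Z_in_tri[of m k \<omega>] by (auto simp: tri_def)

lemma expectation_Z: "expectation (Z m k) = 0"
proof -
  have "expectation (Z m k) = (\<integral>\<omega>. indicator {1} (Z m k \<omega>) - indicator {-1} (Z m k \<omega>) \<partial>PM)"
    by (rule Bochner_Integration.integral_cong[OF refl]) (rule Z_eq_ind)
  also have "\<dots> = prob {\<omega>. Z m k \<omega> = 1} - prob {\<omega>. Z m k \<omega> = -1}"
    by (subst Bochner_Integration.integral_diff) (auto intro!: integrable_ind_Z simp: expectation_ind_Z)
  also have "\<dots> = 0" by (simp add: prob_Z tri_def pmass_def)
  finally show ?thesis .
qed

lemma expectation_Z_sq: "expectation (\<lambda>\<omega>. (Z m k \<omega>)\<^sup>2) = w m"
proof -
  have "expectation (\<lambda>\<omega>. (Z m k \<omega>)\<^sup>2) = (\<integral>\<omega>. indicator {1} (Z m k \<omega>) + indicator {-1} (Z m k \<omega>) \<partial>PM)"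
    by (rule Bochner_Integration.integral_cong[OF refl]) (rule Z_sq_eq_ind)
  also have "\<dots> = prob {\<omega>. Z m k \<omega> = 1} + prob {\<omega>. Z m k \<omega> = -1}"
    by (subst Bochner_Integration.integral_add) (auto intro!: integrable_ind_Z simp: expectation_ind_Z)
  also have "\<dots> = w m" by (simp add: prob_Z tri_def pmass_def)
  finally show ?thesis .
qed

lemma expectation_abs_Z: "expectation (\<lambda>\<omega>. \<bar>Z m k \<omega>\<bar>) = w m"
proof -
  have "\<bar>Z m k \<omega>\<bar> = (Z m k \<omega>)\<^sup>2" for \<omega> using Z_in_tri[of m k \<omega>] by (auto simp: tri_def)
  then show ?thesis by (simp add: expectation_Z_sq)
qed

lemma expectation_T: "expectation (T m n) = 0"
proof -
  have "integrable PM (Z m k)" for k by (rule integrable_bounded[of _ 1]) (auto simp: Z_abs_le)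
  then have "expectation (T m n) = (\<Sum>k=1..n. expectation (Z m (int k)))"
    unfolding T_def[abs_def] by (intro Bochner_Integration.integral_sum)
  then show ?thesis by (simp add: expectation_Z)
qed

text \<open>No mixing is used, so \<open>L m\<close> does not occur: this is the bound for
  components slower than the active one, whose \<open>L m\<close> is too large for the second moment
  bound.\<close>

lemma expectation_abs_T_le: "expectation (\<lambda>\<omega>. \<bar>T m n \<omega>\<bar>) \<le> real n * w m"
proof -
  have int: "integrable PM (\<lambda>\<omega>. \<bar>Z m k \<omega>\<bar>)" for k by (rule integrable_bounded[of _ 1]) (auto simp: Z_abs_le)
  have "expectation (\<lambda>\<omega>. \<bar>T m n \<omega>\<bar>) \<le> expectation (\<lambda>\<omega>. \<Sum>k=1..n. \<bar>Z m (int k) \<omega>\<bar>)"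
    by (intro integral_mono integrable_abs integrable_T Bochner_Integration.integrable_sum int) (simp add: T_def sum_abs)
  also have "\<dots> = (\<Sum>k=1..n. expectation (\<lambda>\<omega>. \<bar>Z m (int k) \<omega>\<bar>))"
    by (intro Bochner_Integration.integral_sum int)
  finally show ?thesis by (simp add: expectation_abs_Z)
qed

lemma step_at: "Z m (int n + 1) \<omega> = step (Z m (int n) \<omega>) (\<omega> (enc m (int n + 1)))"
  by (rule Z_forward) simp

text \<open>A refreshed value is independent of the past and \<open>T\<close> is centred, so only
  the kept value contributes.\<close>

lemma expectation_T_step: "expectation (\<lambda>\<omega>. T m n \<omega> * Z m (int n + 1) \<omega>) = \<rho> m * expectation (\<lambda>\<omega>. T m n \<omega> * Z m (int n) \<omega>)"
proof -
  have ex: "expectation (\<lambda>\<omega>. T m n \<omega> * Z m k \<omega>)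
    = (\<integral>\<omega>. T m n \<omega> * indicator {1} (Z m k \<omega>) \<partial>PM) - (\<integral>\<omega>. T m n \<omega> * indicator {-1} (Z m k \<omega>) \<partial>PM)" for k
  proof -
    have int: "integrable PM (\<lambda>\<omega>. T m n \<omega> * indicator {y} (Z m k \<omega>))" for y
    proof (rule integrable_bounded[of _ "real n"])
      show "norm (T m n \<omega> * indicator {y} (Z m k \<omega>)) \<le> real n" for \<omega>
        using T_abs_le[of m n \<omega>] by (simp add: indicator_def)
    qed measurable
    have "expectation (\<lambda>\<omega>. T m n \<omega> * Z m k \<omega>) = (\<integral>\<omega>. T m n \<omega> * indicator {1} (Z m k \<omega>) - T m n \<omega> * indicator {-1} (Z m k \<omega>) \<partial>PM)"
      by (intro Bochner_Integration.integral_cong refl) (metis Z_eq_ind right_diff_distrib)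
    then show ?thesis by (simp add: Bochner_Integration.integral_diff[OF int int])
  qed
  have st: "(\<integral>\<omega>. T m n \<omega> * indicator {y} (Z m (int n + 1) \<omega>) \<partial>PM)
    = \<rho> m * (\<integral>\<omega>. T m n \<omega> * indicator {y} (Z m (int n) \<omega>) \<partial>PM)" if "y \<in> tri" for y
  proof -
    have "(\<integral>\<omega>. T m n \<omega> * of_real (indicator {y} (Z m (int n + 1) \<omega>)) \<partial>PM)
      = of_real (\<rho> m) * (\<integral>\<omega>. T m n \<omega> * of_real (indicator {y} (Z m (int n) \<omega>)) \<partial>PM)
        + of_real ((1 - \<rho> m) * pmass (w m) y) * (\<integral>\<omega>. T m n \<omega> \<partial>PM)"
      by (rule integral_step[OF integrable_T T_depends Z_depends' _ _ step_at that]) auto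
    then show ?thesis by (simp add: expectation_T)
  qed
  show ?thesis unfolding ex by (simp add: st tri_def right_diff_distrib)
qed

section \<open>Covariances and variances of one component\<close>

definition cov :: "nat \<Rightarrow> nat \<Rightarrow> real" where
  "cov m n = expectation (\<lambda>\<omega>. T m n \<omega> * Z m (int n) \<omega>)"

definition var :: "nat \<Rightarrow> nat \<Rightarrow> real" where
  "var m n = expectation (\<lambda>\<omega>. (T m n \<omega>)\<^sup>2)"

lemma integrable_Z_sq: "integrable PM (\<lambda>\<omega>. (Z m k \<omega>)\<^sup>2)"
proof (rule integrable_bounded[of _ 1])
  show "norm ((Z m k \<omega>)\<^sup>2) \<le> 1" for \<omega> using Z_abs_le[of m k \<omega>] by (simp add: abs_square_le_1)
qed measurable

lemma cov_0: "cov m 0 = 0" and var_0: "var m 0 = 0"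
  by (simp_all add: cov_def var_def)

lemma cov_Suc: "cov m (Suc n) = \<rho> m * cov m n + w m"
proof -
  have "cov m (Suc n) = expectation (\<lambda>\<omega>. T m n \<omega> * Z m (int n + 1) \<omega> + (Z m (int n + 1) \<omega>)\<^sup>2)"
    unfolding cov_def by (intro Bochner_Integration.integral_cong refl)
      (simp add: T_Suc algebra_simps power2_eq_square)
  also have "\<dots> = expectation (\<lambda>\<omega>. T m n \<omega> * Z m (int n + 1) \<omega>) + w m"
    by (simp add: Bochner_Integration.integral_add[OF integrable_T_Z integrable_Z_sq] expectation_Z_sq)
  finally show ?thesis by (simp add: expectation_T_step cov_def)
qed

text \<open>Twice \<open>cov m (Suc n)\<close> counts the second moment of the new summand twice,
  hence the correction by \<open>w m\<close>.\<close>

lemma var_Suc: "var m (Suc n) = var m n + 2 * cov m (Suc n) - w m"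
proof -
  have "var m (Suc n) = expectation (\<lambda>\<omega>. (T m n \<omega>)\<^sup>2 + (2 * (T m n \<omega> * Z m (int n + 1) \<omega>) + (Z m (int n + 1) \<omega>)\<^sup>2))"
    unfolding var_def by (intro Bochner_Integration.integral_cong refl)
      (simp add: T_Suc algebra_simps power2_eq_square)
  also have "\<dots> = var m n + (2 * expectation (\<lambda>\<omega>. T m n \<omega> * Z m (int n + 1) \<omega>) + w m)"
    by (simp add: Bochner_Integration.integral_add integrable_T_sq integrable_T_Z integrable_Z_sq expectation_Z_sq var_def)
  finally show ?thesis
    unfolding expectation_T_step cov_def[symmetric] using cov_Suc[of m n] by simp
qed

lemma one_minus_\<rho>: "1 - \<rho> m = 1 / L m"
  by (simp add: \<rho>_def)

lemma cov_nonneg: "0 \<le> cov m n"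
  by (induction n) (use \<rho> w' in \<open>auto simp: cov_0 cov_Suc less_imp_le\<close>)

lemma cov_le: "cov m n \<le> w m * L m" "cov m n \<le> w m * real n"
proof -
  have L0: "0 < L m" using L[of m] by simp
  show "cov m n \<le> w m * L m"
  proof (induction n)
    case (Suc n)
    have "cov m (Suc n) \<le> \<rho> m * (w m * L m) + w m"
      using mult_left_mono[OF Suc, of "\<rho> m"] \<rho>[of m] by (simp add: cov_Suc)
    also have "\<dots> = w m * L m" using L0 by (simp add: \<rho>_def field_simps)
    finally show ?case .
  qed (use L0 w'[of m] in \<open>simp add: cov_0\<close>)
  show "cov m n \<le> w m * real n"
  proof (induction n)
    case (Suc n)
    have "\<rho> m * cov m n \<le> 1 * cov m n" using \<rho>[of m] cov_nonneg[of m n] by (intro mult_right_mono) auto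
    then show ?case using Suc by (simp add: cov_Suc algebra_simps)
  qed (simp add: cov_0)
qed

text \<open>The recursion is solved by w L (1 - \<rho>^n), which explains the two upper bounds in
  \<open>cov_le\<close>; here it is bounded below by its expansion to second order in n/L.\<close>

lemma cov_ge: "w m * (real n - (real n)\<^sup>2 / (2 * L m)) \<le> cov m n"
proof (induction n)
  case (Suc n)
  have L0: "0 < L m" using L[of m] by simp
  have "cov m (Suc n) = cov m n - cov m n / L m + w m" by (simp add: cov_Suc \<rho>_def algebra_simps)
  moreover have "cov m n / L m \<le> w m * real n / L m" using cov_le(2)[of m n] L0 by (intro divide_right_mono) auto
  moreover have "w m * (real (Suc n) - (real (Suc n))\<^sup>2 / (2 * L m)) + w m / (2 * L m)
     = w m * (real n - (real n)\<^sup>2 / (2 * L m)) - w m * real n / L m + w m"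
    using L0 by (simp add: field_simps power2_eq_square)
  moreover have "0 \<le> w m / (2 * L m)" using L0 w'[of m] by simp
  ultimately show ?case using Suc by linarith
qed (simp add: cov_0)

lemma var_le: "var m n \<le> 2 * real n * w m * L m"
proof (induction n)
  case (Suc n)
  show ?case using Suc cov_le(1)[of m "Suc n"] w'[of m] by (simp add: var_Suc algebra_simps)
qed (simp add: var_0)

text \<open>Below half the time scale the component has hardly moved: each covariance is at least
  3/4 of \<open>w m * real k\<close>. Summing \<open>2 * cov - w\<close> gives w (3/4 n^2 - n/4),
  which is at least w n^2/2 for integer n.\<close>

lemma var_ge:
  assumes "2 * real n \<le> L m"
  shows "w m * (real n)\<^sup>2 / 2 \<le> var m n"
proof -
  have L0: "0 < L m" using L[of m] by simp
  have c: "3/4 * w m * real k \<le> cov m k" if "k \<le> n" for k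
  proof -
    have "2 * real k \<le> L m" using that assms by linarith
    then have "real k * (2 * real k) \<le> real k * L m" by (intro mult_left_mono) auto
    then have "(real k)\<^sup>2 / (2 * L m) \<le> real k / 4" using L0 by (simp add: field_simps power2_eq_square)
    then have "w m * (3/4 * real k) \<le> w m * (real k - (real k)\<^sup>2 / (2 * L m))"
      using w'[of m] by (intro mult_left_mono) auto
    then show ?thesis using cov_ge[of m k] by simp
  qed
  have "w m * (3/4 * (real k)\<^sup>2 - real k / 4) \<le> var m k" if "k \<le> n" for k
    using that
  proof (induction k)
    case (Suc k)
    then have "w m * (3/4 * (real k)\<^sup>2 - real k / 4) \<le> var m k" by simp
    moreover have "3/4 * w m * real (Suc k) \<le> cov m (Suc k)" using Suc by (intro c) simp
    moreover have "w m * (3/4 * (real (Suc k))\<^sup>2 - real (Suc k) / 4) = w m * (3/4 * (real k)\<^sup>2 - real k / 4) + 2 * (3/4 * w m * real (Suc k)) - w m"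
      by (simp add: field_simps power2_eq_square)
    ultimately show ?case by (simp add: var_Suc)
  qed (simp add: var_0)
  from this[of n] have "w m * (3/4 * (real n)\<^sup>2 - real n / 4) \<le> var m n" by simp
  moreover have "real n * 1 \<le> real n * real n" by (cases "n = 0") (auto intro: mult_left_mono)
  then have "(real n)\<^sup>2 / 2 \<le> 3/4 * (real n)\<^sup>2 - real n / 4" unfolding power2_eq_square by linarith
  then have "w m * ((real n)\<^sup>2 / 2) \<le> w m * (3/4 * (real n)\<^sup>2 - real n / 4)"
    using w'[of m] by (intro mult_left_mono) auto
  ultimately show ?thesis by simp
qed

text \<open>The bound for components faster than the active one, where cancellation counts; it comes
  from the second moment.\<close>

lemma expectation_abs_T_le_sqrt: "expectation (\<lambda>\<omega>. \<bar>T m n \<omega>\<bar>) \<le> sqrt (2 * real n * w m * L m)"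
proof -
  let ?e = "expectation (\<lambda>\<omega>. \<bar>T m n \<omega>\<bar>)"
  have i: "integrable PM (\<lambda>\<omega>. \<bar>T m n \<omega>\<bar>)" using integrable_T by (rule integrable_abs)
  have i2: "integrable PM (\<lambda>\<omega>. \<bar>T m n \<omega>\<bar>\<^sup>2)" using integrable_T_sq by simp
  have "?e\<^sup>2 \<le> var m n"
    using variance_eq[OF i i2] variance_positive[of "\<lambda>\<omega>. \<bar>T m n \<omega>\<bar>"] by (simp add: var_def)
  also have "\<dots> \<le> 2 * real n * w m * L m" by (rule var_le)
  finally show ?thesis by (rule real_le_rsqrt)
qed

section \<open>One component against the sum of all others\<close>

definition R :: "nat \<Rightarrow> nat \<Rightarrow> (int \<Rightarrow> real) \<Rightarrow> real" where
  "R m n \<omega> = val (\<lambda>j. if j = m then 0 else T j n \<omega>)"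

lemma measurable_R [measurable]: "R m n \<in> borel_measurable PM"
proof -
  have [measurable]: "(\<lambda>\<omega>. if j = m then 0 else T j n \<omega>) \<in> borel_measurable PM" for j
    by (cases "j = m") simp_all
  show ?thesis unfolding R_def[abs_def] val_def by measurable
qed

lemma R_depends: "depends_only (- range (enc m)) (R m n)"
proof -
  have "depends_only (- range (enc m)) (\<lambda>\<omega>. if j = m then 0 else T j n \<omega>)" for j
  proof (cases "j = m")
    case False
    then have "depends_only (- range (enc m)) (T j n)" by (intro depends_only_mono[OF T_depends']) auto
    then show ?thesis using False by simp
  qed (simp add: depends_only_const)
  from depends_only_fun[of _ "\<lambda>j \<omega>. if j = m then 0 else T j n \<omega>" val, OF this] show ?thesis
    by (simp add: R_def[abs_def])
qed

lemma val_add: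
  assumes "\<And>m. \<bar>u m\<bar> \<le> c" "\<And>m. \<bar>v m\<bar> \<le> c'"
  shows "val (\<lambda>m. u m + v m) = val u + val v"
  unfolding val_def
  by (subst suminf_add[OF summable_val[OF assms(1)] summable_val[OF assms(2)]]) (simp add: distrib_left)

lemma val_single: "val (\<lambda>j. if j = m then c else 0) = (1/4) ^ m * c"
proof -
  have "(\<Sum>j. (1/4) ^ j * (if j = m then c else 0)) = (\<Sum>j\<in>{m}. (1/4) ^ j * (if j = m then c else 0))"
    by (rule suminf_finite) auto
  then show ?thesis by (simp add: val_def)
qed

definition SY :: "nat \<Rightarrow> (int \<Rightarrow> real) \<Rightarrow> real" where
  "SY n \<omega> = (\<Sum>k=1..n. Y (int k) \<omega>)"

lemma SY_eq_val: "SY n \<omega> = val (\<lambda>m. T m n \<omega>)"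
proof (induction n)
  case 0
  show ?case by (simp add: SY_def val_def)
next
  case (Suc n)
  have "val (\<lambda>m. T m (Suc n) \<omega>) = val (\<lambda>m. T m n \<omega>) + val (\<lambda>m. Z m (int n + 1) \<omega>)"
    unfolding T_Suc by (rule val_add[OF T_abs_le Z_abs_le])
  then show ?case using Suc by (simp add: SY_def Y_def add.commute)
qed

lemma SY_split: "SY n \<omega> = (1/4) ^ m * T m n \<omega> + R m n \<omega>"
proof -
  have "val (\<lambda>j. (if j = m then T m n \<omega> else 0) + (if j = m then 0 else T j n \<omega>))
      = val (\<lambda>j. if j = m then T m n \<omega> else 0) + val (\<lambda>j. if j = m then 0 else T j n \<omega>)"
    by (rule val_add[where c="real n" and c'="real n"]) (auto simp: T_abs_le)
  moreover have "(\<lambda>j. (if j = m then T m n \<omega> else 0) + (if j = m then 0 else T j n \<omega>)) = (\<lambda>j. T j n \<omega>)"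
    by auto
  ultimately show ?thesis by (simp add: SY_eq_val val_single R_def)
qed

lemma SY_abs_le: "\<bar>SY n \<omega>\<bar> \<le> 4/3 * real n"
proof -
  have "\<bar>SY n \<omega>\<bar> \<le> (\<Sum>k=1..n. \<bar>Y (int k) \<omega>\<bar>)" unfolding SY_def by (rule sum_abs)
  also have "\<dots> \<le> (\<Sum>k=1..n. 4/3)" unfolding Y_def by (intro sum_mono abs_val_le Z_abs_le)
  finally show ?thesis by simp
qed

lemma measurable_SY [measurable]: "SY n \<in> borel_measurable PM"
  unfolding SY_def[abs_def] by measurable

lemma integrable_SY: "integrable PM (SY n)"
  by (rule integrable_bounded[of _ "4/3 * real n"]) (auto simp: SY_abs_le[simplified])

lemma R_eq: "R m n \<omega> = SY n \<omega> - (1/4) ^ m * T m n \<omega>"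
  using SY_split[of n \<omega> m] by simp

lemma integrable_R: "integrable PM (R m n)"
  unfolding R_eq[abs_def] by (intro Bochner_Integration.integrable_diff integrable_SY integrable_mult_right integrable_T)

lemma expectation_Y: "expectation (Y k) = 0"
proof -
  have "((\<lambda>m. (1/4) ^ m * expectation (Z m k))) sums expectation (\<lambda>\<omega>. \<Sum>m. (1/4) ^ m * Z m k \<omega>)"
  proof -
    have int: "integrable PM (\<lambda>\<omega>. (1/4) ^ m * Z m k \<omega>)" for m
      by (rule integrable_bounded[of _ 1]) (auto simp: abs_mult Z_abs_le power_le_one intro!: mult_le_one)
    have "(\<lambda>m. expectation (\<lambda>\<omega>. (1/4) ^ m * Z m k \<omega>)) sums expectation (\<lambda>\<omega>. \<Sum>m. (1/4) ^ m * Z m k \<omega>)"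
    proof (rule sums_integral[OF int])
      show "AE \<omega> in PM. summable (\<lambda>m. norm ((1/4) ^ m * Z m k \<omega>))"
      proof (rule AE_I2, rule summable_comparison_test'[OF summable_quarter])
        show "norm (norm ((1/4) ^ m * Z m k \<omega>)) \<le> (1/4) ^ m" for m \<omega>
          by (simp add: abs_mult mult_left_le Z_abs_le)
      qed
      show "summable (\<lambda>m. \<integral>\<omega>. norm ((1/4) ^ m * Z m k \<omega>) \<partial>PM)"
      proof (rule summable_comparison_test'[OF summable_quarter])
        have "(\<integral>\<omega>. norm ((1/4) ^ m * Z m k \<omega>) \<partial>PM) = (1/4) ^ m * w m" for m
          by (simp add: abs_mult expectation_abs_Z)
        then show "norm (\<integral>\<omega>. norm ((1/4) ^ m * Z m k \<omega>) \<partial>PM) \<le> (1/4) ^ m" for m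
          using w'[of m] by (simp add: mult_left_le)
      qed
    qed
    then show ?thesis by simp
  qed
  then have "expectation (\<lambda>\<omega>. \<Sum>m. (1/4) ^ m * Z m k \<omega>) = 0"
    by (simp add: expectation_Z sums_iff)
  then show ?thesis by (simp add: Y_def[abs_def] val_def)
qed

lemma expectation_SY: "expectation (SY n) = 0"
proof -
  have "integrable PM (Y k)" for k
    by (rule integrable_bounded[of _ "4/3"]) (use abs_val_le[OF Z_abs_le] in \<open>simp_all add: Y_def\<close>)
  then have "expectation (SY n) = (\<Sum>k=1..n. expectation (Y (int k)))"
    unfolding SY_def[abs_def] by (intro Bochner_Integration.integral_sum)
  then show ?thesis by (simp add: expectation_Y)
qed

lemma R_abs_le: "\<bar>R m n \<omega>\<bar> \<le> 3 * real n"
proof -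
  have "\<bar>(1/4) ^ m * T m n \<omega>\<bar> \<le> 1 * real n" unfolding abs_mult
    using T_abs_le[of m n \<omega>] by (intro mult_mono) (auto simp: power_le_one)
  then show ?thesis using SY_abs_le[of n \<omega>] unfolding R_eq by linarith
qed

lemma integrable_R_sq: "integrable PM (\<lambda>\<omega>. (R m n \<omega>)\<^sup>2)"
proof (rule integrable_bounded[of _ "(3 * real n)\<^sup>2"])
  show "norm ((R m n \<omega>)\<^sup>2) \<le> (3 * real n)\<^sup>2" for \<omega>
    using power_mono[OF R_abs_le[of m n \<omega>], of 2] by simp
qed measurable

lemma second_moment_SY_ge: "((1/4) ^ m)\<^sup>2 * var m n \<le> expectation (\<lambda>\<omega>. (SY n \<omega>)\<^sup>2)"
proof -
  let ?a = "(1/4::real) ^ m"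
  have cross: "expectation (\<lambda>\<omega>. T m n \<omega> * R m n \<omega>) = 0"
    by (subst integral_mult_depends_only[OF integrable_T T_depends' integrable_R R_depends]) (auto simp: expectation_T)
  have iTR: "integrable PM (\<lambda>\<omega>. T m n \<omega> * R m n \<omega>)"
  proof (rule integrable_bounded[of _ "real n * (3 * real n)"])
    show "norm (T m n \<omega> * R m n \<omega>) \<le> real n * (3 * real n)" for \<omega>
      unfolding real_norm_def abs_mult by (intro mult_mono T_abs_le R_abs_le) auto
  qed measurable
  have "expectation (\<lambda>\<omega>. (SY n \<omega>)\<^sup>2) = expectation (\<lambda>\<omega>. ?a\<^sup>2 * (T m n \<omega>)\<^sup>2 + (2 * ?a * (T m n \<omega> * R m n \<omega>) + (R m n \<omega>)\<^sup>2))"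
    unfolding SY_split[of n _ m] by (intro Bochner_Integration.integral_cong refl) (simp add: power2_sum power_mult_distrib mult_ac)
  also have "\<dots> = expectation (\<lambda>\<omega>. ?a\<^sup>2 * (T m n \<omega>)\<^sup>2) + (expectation (\<lambda>\<omega>. 2 * ?a * (T m n \<omega> * R m n \<omega>)) + expectation (\<lambda>\<omega>. (R m n \<omega>)\<^sup>2))"
    by (subst Bochner_Integration.integral_add, intro integrable_mult_right integrable_T_sq,
        intro Bochner_Integration.integrable_add integrable_mult_right iTR integrable_R_sq,
        subst Bochner_Integration.integral_add, intro integrable_mult_right iTR, rule integrable_R_sq) (rule refl)
  also have "\<dots> = ?a\<^sup>2 * var m n + expectation (\<lambda>\<omega>. (R m n \<omega>)\<^sup>2)"
    unfolding integral_mult_right_zero cross by (simp add: var_def)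
  also have "\<dots> \<ge> ?a\<^sup>2 * var m n" by (simp add: integral_nonneg_AE)
  finally show ?thesis .
qed

text \<open>A single bound for all other components suffices because their weights form a geometric
  series with sum 4/3.\<close>

lemma expectation_abs_R_le:
  assumes B: "\<And>j. j \<noteq> m \<Longrightarrow> expectation (\<lambda>\<omega>. \<bar>T j n \<omega>\<bar>) \<le> B" and B0: "0 \<le> B"
  shows "expectation (\<lambda>\<omega>. \<bar>R m n \<omega>\<bar>) \<le> 4/3 * B"
proof -
  define f where "f j \<omega> = (1/4) ^ j * \<bar>if j = m then 0 else T j n \<omega>\<bar>" for j and \<omega> :: "int \<Rightarrow> real"
  have [measurable]: "f j \<in> borel_measurable PM" for j
    unfolding f_def by (cases "j = m") simp_all
  have fb: "norm (f j \<omega>) \<le> real n * (1/4) ^ j" for j \<omega>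
    using T_abs_le[of j n \<omega>] by (simp add: f_def abs_mult mult.commute mult_right_mono)
  have nn: "norm (f j \<omega>) = f j \<omega>" for j \<omega> by (simp add: f_def)
  have sn: "summable (\<lambda>j. real n * (1/4::real) ^ j)" by (rule summable_mult[OF summable_quarter])
  have int: "integrable PM (f j)" for j by (rule integrable_bounded[OF _ fb]) measurable
  have fs: "summable (\<lambda>j. norm (f j \<omega>))" for \<omega>
    by (rule summable_comparison_test'[OF sn]) (use fb in auto)
  have ef: "(\<integral>\<omega>. norm (f j \<omega>) \<partial>PM) \<le> B * (1/4) ^ j" for j
  proof (cases "j = m")
    case False
    then have "(\<integral>\<omega>. norm (f j \<omega>) \<partial>PM) = (1/4) ^ j * expectation (\<lambda>\<omega>. \<bar>T j n \<omega>\<bar>)"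
      by (simp add: f_def abs_mult)
    also have "\<dots> \<le> (1/4) ^ j * B" using B[OF False] by (intro mult_left_mono) auto
    finally show ?thesis by (simp add: mult.commute)
  qed (simp add: f_def B0)
  have sB: "summable (\<lambda>j. B * (1/4::real) ^ j)" by (rule summable_mult[OF summable_quarter])
  have se: "summable (\<lambda>j. \<integral>\<omega>. norm (f j \<omega>) \<partial>PM)"
    by (rule summable_comparison_test'[OF sB]) (use ef in \<open>simp add: integral_nonneg_AE\<close>)
  have intS: "integrable PM (\<lambda>\<omega>. \<Sum>j. f j \<omega>)"
    by (rule integrable_suminf[OF int]) (use fs se in auto)
  have "expectation (\<lambda>\<omega>. \<bar>R m n \<omega>\<bar>) \<le> expectation (\<lambda>\<omega>. \<Sum>j. f j \<omega>)"
  proof (rule integral_mono[OF _ intS])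
    show "integrable PM (\<lambda>\<omega>. \<bar>R m n \<omega>\<bar>)" by (rule integrable_abs[OF integrable_R])
    fix \<omega>
    define g where "g j = (1/4) ^ j * (if j = m then 0 else T j n \<omega>)" for j
    have nf: "norm (g j) = f j \<omega>" for j by (simp add: g_def f_def abs_mult)
    have "summable (\<lambda>j. norm (g j))" using fs[of \<omega>] by (simp only: nn nf)
    then have "norm (suminf g) \<le> (\<Sum>j. norm (g j))" by (rule summable_norm)
    moreover have "suminf g = R m n \<omega>" by (simp add: R_def val_def g_def[abs_def])
    ultimately have "norm (R m n \<omega>) \<le> (\<Sum>j. f j \<omega>)" unfolding nf by simp
    then show "\<bar>R m n \<omega>\<bar> \<le> (\<Sum>j. f j \<omega>)" by simp
  qed
  also have "\<dots> = (\<Sum>j. \<integral>\<omega>. f j \<omega> \<partial>PM)"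
    by (rule integral_suminf[OF int]) (use fs se in auto)
  also have "\<dots> \<le> (\<Sum>j. B * (1/4) ^ j)"
  proof (rule suminf_le[OF _ _ sB])
    show "(\<integral>\<omega>. f j \<omega> \<partial>PM) \<le> B * (1/4) ^ j" for j using ef[of j] by (simp only: nn)
    show "summable (\<lambda>j. \<integral>\<omega>. f j \<omega> \<partial>PM)" using se by (simp only: nn)
  qed
  also have "\<dots> = 4/3 * B" using suminf_mult[OF summable_quarter, of B] by (simp add: suminf_geometric)
  finally show ?thesis .
qed

section \<open>Characteristic functions of one component and of the whole sum\<close>

definition cf :: "nat \<Rightarrow> nat \<Rightarrow> real \<Rightarrow> complex" where
  "cf m n t = (\<integral>\<omega>. iexp (t * T m n \<omega>) \<partial>PM)"

text \<open>The phase is split according to the current value \<open>y\<close> of the chain. One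
  step multiplies the part at \<open>y\<close> by \<open>cis (t * y)\<close>, which is 1,
  \<open>e\<close> or its conjugate, and \<open>integral_step\<close> does the rest.\<close>

lemma cf_bound:
  fixes t :: real and m n :: nat
  defines "e \<equiv> cis t"
  defines "\<delta> \<equiv> 1 - Re (kap (\<rho> m) e)" and "\<eta> \<equiv> cmod (e - kap (\<rho> m) e)" and "E \<equiv> cmod (1 - kap (\<rho> m) e)"
  shows "cmod (cf m n t - of_real ((1 - (1 - \<rho> m) * w m * \<delta>) ^ n))
    \<le> 3 * w m * E + 2 * real n * (1 - \<rho> m) * (w m)\<^sup>2 * \<eta> * \<delta> + 2 * (w m)\<^sup>2 * \<eta> * \<delta> + w m * \<delta>"
proof -
  define f where "f n \<omega> = iexp (t * T m n \<omega>)" for n \<omega>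
  define g where "g n y = (\<integral>\<omega>. f n \<omega> * of_real (indicator {y} (Z m (int n) \<omega>)) \<partial>PM)" for n y
  have fm [measurable]: "f n \<in> borel_measurable PM" for n unfolding f_def by measurable
  have nf: "cmod (f n \<omega>) = 1" for n \<omega> by (simp add: f_def)
  have intf: "integrable PM (f n)" for n by (rule integrable_bounded[of _ 1]) (auto simp: nf)
  have depf: "depends_only (enc m ` {0..int n}) (f n)" for n
    unfolding f_def by (rule depends_only_compose[OF T_depends, where h="\<lambda>x. iexp (t * x)"])
  have intg: "integrable PM (\<lambda>\<omega>. f n \<omega> * of_real (indicator {y} (Z m k \<omega>)))" for n y k
    by (rule integrable_bounded[of _ 1]) (auto simp: norm_mult nf indicator_def)
  have cfH: "cf m n t = g n 0 + g n 1 + g n (-1)" for n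
  proof -
    have "cf m n t = (\<integral>\<omega>. f n \<omega> * of_real (indicator {0} (Z m (int n) \<omega>)) + f n \<omega> * of_real (indicator {1} (Z m (int n) \<omega>))
      + f n \<omega> * of_real (indicator {-1} (Z m (int n) \<omega>)) \<partial>PM)"
      unfolding cf_def f_def
    proof (rule Bochner_Integration.integral_cong[OF refl])
      fix \<omega>
      show "iexp (t * T m n \<omega>) = iexp (t * T m n \<omega>) * of_real (indicator {0} (Z m (int n) \<omega>)) + iexp (t * T m n \<omega>) * of_real (indicator {1} (Z m (int n) \<omega>))
      + iexp (t * T m n \<omega>) * of_real (indicator {-1} (Z m (int n) \<omega>))"
        using Z_in_tri[of m "int n" \<omega>] by (auto simp: tri_def)
    qed
    then show ?thesis unfolding g_def by (simp add: intg)
  qed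
  have gS: "g (Suc n) y = cis (t * y) * (of_real (\<rho> m) * g n y + of_real ((1 - \<rho> m) * pmass (w m) y) * cf m n t)" if y: "y \<in> tri" for n y
  proof -
    have "g (Suc n) y = (\<integral>\<omega>. cis (t * y) * (f n \<omega> * of_real (indicator {y} (Z m (int n + 1) \<omega>))) \<partial>PM)"
      unfolding g_def
    proof (rule Bochner_Integration.integral_cong[OF refl])
      fix \<omega>
      have "f (Suc n) \<omega> = cis (t * Z m (int n + 1) \<omega>) * f n \<omega>"
        by (simp add: f_def T_Suc cis_conv_exp exp_add[symmetric] algebra_simps)
      then show "f (Suc n) \<omega> * of_real (indicator {y} (Z m (int (Suc n)) \<omega>)) = cis (t * y) * (f n \<omega> * of_real (indicator {y} (Z m (int n + 1) \<omega>)))"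
        by (simp add: add.commute indicator_def)
    qed
    also have "\<dots> = cis (t * y) * (\<integral>\<omega>. f n \<omega> * of_real (indicator {y} (Z m (int n + 1) \<omega>)) \<partial>PM)" by simp
    also have "(\<integral>\<omega>. f n \<omega> * of_real (indicator {y} (Z m (int n + 1) \<omega>)) \<partial>PM)
        = of_real (\<rho> m) * g n y + of_real ((1 - \<rho> m) * pmass (w m) y) * (\<integral>\<omega>. f n \<omega> \<partial>PM)"
      unfolding g_def by (rule integral_step[OF intf depf Z_depends' _ _ step_at y]) auto
    finally show ?thesis by (simp add: cf_def f_def)
  qed
  have g0: "g 0 y = of_real (pmass (w m) y)" if "y \<in> tri" for y
  proof -
    have "g 0 y = of_real (\<integral>\<omega>. indicator {y} (Z m 0 \<omega>) \<partial>PM)"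
      unfolding g_def f_def by (subst integral_complex_of_real[symmetric]) simp
    then show ?thesis using prob_Z[OF that] by (simp add: expectation_ind_Z)
  qed
  have w0: "w m \<noteq> 0" "1 - w m \<noteq> 0" "complex_of_real (w m) \<noteq> 0" "1 - complex_of_real (w m) \<noteq> 0"
  proof -
    show "w m \<noteq> 0" "1 - w m \<noteq> 0" "complex_of_real (w m) \<noteq> 0" using w[of m] by auto
    then show "1 - complex_of_real (w m) \<noteq> 0" by (metis of_real_1 of_real_diff of_real_eq_0_iff)
  qed
  \<comment> \<open>Division by the stationary masses turns the three parts into conditional
    expectations, so that all of them start at 1.\<close>
  define x where "x n = g n 0 / of_real (1 - w m)" for n
  define zp where "zp n = g n 1 / of_real (w m / 2)" for n
  define zm where "zm n = g n (-1) / of_real (w m / 2)" for n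
  show ?thesis unfolding e_def \<delta>_def \<eta>_def E_def
  proof (rule cf_recursion_bound[where x=x and zp=zp and zm=zm])
    show "cmod (cis t) = 1" by simp
    show "0 < \<rho> m" "\<rho> m < 1" using \<rho> by auto
    show "0 \<le> w m" "w m \<le> 1/4" using w w' by auto
    show "x 0 = 1" "zp 0 = 1" "zm 0 = 1" using w0 by (simp_all add: x_def zp_def zm_def g0 tri_def pmass_def)
    have x': "g n 0 = of_real (1 - w m) * x n" and zp': "g n 1 = of_real (w m / 2) * zp n" and zm': "g n (-1) = of_real (w m / 2) * zm n" for n
      using w0 by (simp_all add: x_def zp_def zm_def)
    show "cf m n t = of_real (1 - w m) * x n + of_real (w m / 2) * (zp n + zm n)" for n
      unfolding cfH x' zp' zm' by (simp add: algebra_simps)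
    show "x (Suc n) = of_real (\<rho> m) * x n + of_real (1 - \<rho> m) * cf m n t" for n
      using gS[of 0 n] w0 by (simp add: x_def tri_def pmass_def field_simps)
    show "zp (Suc n) = cis t * (of_real (\<rho> m) * zp n + of_real (1 - \<rho> m) * cf m n t)" for n
      using gS[of 1 n] w0 by (simp add: zp_def tri_def pmass_def field_simps)
    show "zm (Suc n) = cnj (cis t) * (of_real (\<rho> m) * zm n + of_real (1 - \<rho> m) * cf m n t)" for n
      using gS[of "-1" n] w0 by (simp add: zm_def tri_def pmass_def cis_cnj field_simps)
  qed
qed

text \<open>The independent remainder contributes a factor of modulus at most 1, so any fixed
  \<open>m\<close> may be used to show decay.\<close>

lemma cf_SY_le: "cmod (\<integral>\<omega>. iexp (t * SY n \<omega>) \<partial>PM) \<le> cmod (cf m n (t * (1/4) ^ m))"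
proof -
  have int1: "integrable PM (\<lambda>\<omega>. iexp (t * (1/4) ^ m * T m n \<omega>))"
    by (rule integrable_bounded[of _ 1]) (simp_all)
  have int2: "integrable PM (\<lambda>\<omega>. iexp (t * R m n \<omega>))"
    by (rule integrable_bounded[of _ 1]) (simp_all)
  have "(\<integral>\<omega>. iexp (t * SY n \<omega>) \<partial>PM) = (\<integral>\<omega>. iexp (t * (1/4) ^ m * T m n \<omega>) * iexp (t * R m n \<omega>) \<partial>PM)"
    unfolding SY_split[of n _ m] by (intro Bochner_Integration.integral_cong refl) (simp add: exp_add[symmetric] algebra_simps)
  also have "\<dots> = (\<integral>\<omega>. iexp (t * (1/4) ^ m * T m n \<omega>) \<partial>PM) * (\<integral>\<omega>. iexp (t * R m n \<omega>) \<partial>PM)"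
    by (rule integral_mult_depends_only[OF int1 depends_only_compose[OF T_depends', where h="\<lambda>x. iexp (t * (1/4) ^ m * x)"]
          int2 depends_only_compose[OF R_depends, where h="\<lambda>x. iexp (t * x)"]]) auto
  finally have "cmod (\<integral>\<omega>. iexp (t * SY n \<omega>) \<partial>PM) = cmod (cf m n (t * (1/4) ^ m)) * cmod (\<integral>\<omega>. iexp (t * R m n \<omega>) \<partial>PM)"
    by (simp add: norm_mult cf_def)
  moreover have "cmod (\<integral>\<omega>. iexp (t * R m n \<omega>) \<partial>PM) \<le> (\<integral>\<omega>. cmod (iexp (t * R m n \<omega>)) \<partial>PM)"
    by (rule integral_norm_bound)
  then have "cmod (\<integral>\<omega>. iexp (t * R m n \<omega>) \<partial>PM) \<le> 1" using prob_space by simp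
  ultimately show ?thesis by (simp add: mult_left_le)
qed

lemma cf_SY_approx: "cmod ((\<integral>\<omega>. iexp (t * SY n \<omega>) \<partial>PM) - cf m n (t * (1/4) ^ m)) \<le> \<bar>t\<bar> * expectation (\<lambda>\<omega>. \<bar>R m n \<omega>\<bar>)"
proof -
  have int1: "integrable PM (\<lambda>\<omega>. iexp (t * (1/4) ^ m * T m n \<omega>))"
    by (rule integrable_bounded[of _ 1]) (simp_all)
  have int2: "integrable PM (\<lambda>\<omega>. iexp (t * SY n \<omega>))"
    by (rule integrable_bounded[of _ 1]) (simp_all)
  have "(\<integral>\<omega>. iexp (t * SY n \<omega>) \<partial>PM) - cf m n (t * (1/4) ^ m)
     = (\<integral>\<omega>. iexp (t * SY n \<omega>) - iexp (t * (1/4) ^ m * T m n \<omega>) \<partial>PM)"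
    unfolding cf_def by (rule Bochner_Integration.integral_diff[OF int2 int1, symmetric])
  also have "cmod \<dots> \<le> (\<integral>\<omega>. cmod (iexp (t * SY n \<omega>) - iexp (t * (1/4) ^ m * T m n \<omega>)) \<partial>PM)"
    by (rule integral_norm_bound)
  also have "\<dots> \<le> (\<integral>\<omega>. \<bar>t\<bar> * \<bar>R m n \<omega>\<bar> \<partial>PM)"
  proof (rule integral_mono)
    show "integrable PM (\<lambda>\<omega>. cmod (iexp (t * SY n \<omega>) - iexp (t * (1/4) ^ m * T m n \<omega>)))"
      by (intro integrable_norm Bochner_Integration.integrable_diff int1 int2)
    show "integrable PM (\<lambda>\<omega>. \<bar>t\<bar> * \<bar>R m n \<omega>\<bar>)" by (intro integrable_mult_right integrable_abs integrable_R)
    fix \<omega>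
    have "iexp (t * SY n \<omega>) - iexp (t * (1/4) ^ m * T m n \<omega>) = iexp (t * (1/4) ^ m * T m n \<omega>) * (iexp (t * R m n \<omega>) - 1)"
      unfolding SY_split[of n \<omega> m] by (simp add: exp_add[symmetric] algebra_simps)
    then have "cmod (iexp (t * SY n \<omega>) - iexp (t * (1/4) ^ m * T m n \<omega>)) = cmod (iexp (t * R m n \<omega>) - 1)"
      by (simp add: norm_mult)
    also have "\<dots> \<le> \<bar>t * R m n \<omega>\<bar>" using iexp_approx1[of "t * R m n \<omega>" 0] by simp
    finally show "cmod (iexp (t * SY n \<omega>) - iexp (t * (1/4) ^ m * T m n \<omega>)) \<le> \<bar>t\<bar> * \<bar>R m n \<omega>\<bar>" by (simp add: abs_mult)
  qed
  also have "\<dots> = \<bar>t\<bar> * expectation (\<lambda>\<omega>. \<bar>R m n \<omega>\<bar>)" by simp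
  finally show ?thesis .
qed

end

section \<open>The limit law\<close>

text \<open>The integrand of the characteristic function of the exponential law. The Laplace law is
  the equal mixture of that law and its reflection.\<close>

definition half_exp :: "real \<Rightarrow> real \<Rightarrow> complex" where
  "half_exp t x = indicator {0<..} x *\<^sub>R exp ((\<i> * t - 1) * x)"

lemma
  shows integrable_half_exp: "integrable lborel (half_exp t)"
    and integral_half_exp: "integral\<^sup>L lborel (half_exp t) = 1 / (1 - \<i> * t)"
proof -
  define c where "c = \<i> * complex_of_real t - 1"
  have c0: "c \<noteq> 0" by (simp add: c_def complex_eq_iff)
  have nrm: "cmod (exp (c * of_real x)) = exp (- x)" for x :: real
    by (simp add: c_def)
  have [measurable]: "half_exp t \<in> borel_measurable borel"
    unfolding half_exp_def[abs_def] by measurable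
  have ei: "integrable lborel (\<lambda>x. indicator {0<..} x *\<^sub>R exp (- x) :: real)"
    using integrable_I0i_exp_mscale[of 1] by (simp add: set_integrable_def)
  show int: "integrable lborel (half_exp t)"
  proof (rule Bochner_Integration.integrable_bound[OF ei])
    show "AE x in lborel. cmod (half_exp t x) \<le> norm (indicator {0<..} x *\<^sub>R exp (- x) :: real)"
      using nrm by (simp add: half_exp_def c_def)
  qed simp
  have si: "set_integrable lborel {0<..} (\<lambda>x. exp (c * of_real x))"
    using int by (simp add: set_integrable_def half_exp_def[abs_def] c_def)
  have "(LBINT x=ereal 0..\<infinity>. exp (c * of_real x)) = 0 - 1 / c"
  proof (rule interval_integral_FTC_integrable[where F="\<lambda>x. exp (c * of_real x) / c"])
    show "((\<lambda>x. exp (c * of_real x) / c) has_vector_derivative exp (c * of_real x)) (at x)" for x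
      using c0 by (auto intro!: derivative_eq_intros has_vector_derivative_real_field)
    show "set_integrable lborel (einterval (ereal 0) \<infinity>) (\<lambda>x. exp (c * of_real x))"
      using si by simp
    have "((\<lambda>x::real. exp (c * of_real x) / c) \<longlongrightarrow> exp (c * of_real 0) / c) (at_right 0)"
      using c0 by (intro tendsto_intros)
    then show "(((\<lambda>x. exp (c * of_real x) / c) \<circ> real_of_ereal) \<longlongrightarrow> 1 / c) (at_right (ereal 0))"
      by (simp add: at_right_ereal tendsto_compose_filtermap[symmetric] filterlim_filtermap o_def)
    have "((\<lambda>x::real. exp (c * of_real x) / c) \<longlongrightarrow> 0) at_top"
    proof (rule tendsto_norm_zero_cancel)
      have "((\<lambda>x::real. exp (- x) / cmod c) \<longlongrightarrow> 0 / cmod c) at_top"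
        by (intro tendsto_divide tendsto_const) (use c0 in \<open>auto intro: filterlim_compose[OF exp_at_bot] filterlim_uminus_at_bot_at_top\<close>)
      then show "((\<lambda>x::real. cmod (exp (c * of_real x) / c)) \<longlongrightarrow> 0) at_top"
        by (simp add: norm_divide nrm del: norm_exp_eq_Re)
    qed
    then show "(((\<lambda>x. exp (c * of_real x) / c) \<circ> real_of_ereal) \<longlongrightarrow> 0) (at_left \<infinity>)"
      by (simp add: at_left_PInf filterlim_filtermap o_def)
  qed (auto intro!: continuous_intros)
  moreover have "(LBINT x=ereal 0..\<infinity>. exp (c * of_real x)) = integral\<^sup>L lborel (half_exp t)"
    unfolding interval_integral_to_infinity_eq set_lebesgue_integral_def by (simp add: half_exp_def[abs_def] c_def)
  moreover have "0 - 1 / c = 1 / (1 - \<i> * t)"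
  proof -
    have "1 - \<i> * t = - c" by (simp add: c_def)
    then show ?thesis by simp
  qed
  ultimately show "integral\<^sup>L lborel (half_exp t) = 1 / (1 - \<i> * t)" by simp
qed

lemma
  shows integrable_laplace: "integrable lborel (\<lambda>x. (1 / 2 * exp (- \<bar>x\<bar>)) *\<^sub>R iexp (t * x))"
    and integral_laplace: "(\<integral>x. (1 / 2 * exp (- \<bar>x\<bar>)) *\<^sub>R iexp (t * x) \<partial>lborel) = of_real (1 / (1 + t\<^sup>2))"
proof -
  let ?f = "\<lambda>x. (1 / 2 * exp (- \<bar>x\<bar>)) *\<^sub>R iexp (t * x)"
  let ?g = "\<lambda>x. (1/2) * (half_exp t x + half_exp (- t) (0 + (-1) * x))"
  have i2: "integrable lborel (\<lambda>x. half_exp (- t) (0 + (-1) * x))"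
    by (rule lborel_integrable_real_affine[OF integrable_half_exp]) simp
  have ig: "integrable lborel ?g"
    by (intro integrable_mult_right Bochner_Integration.integrable_add integrable_half_exp i2)
  have "AE x in lborel. x \<noteq> (0::real)" by (rule AE_lborel_singleton)
  then have ae: "AE x in lborel. ?f x = ?g x"
  proof eventually_elim
    case (elim x)
    show ?case
    proof (cases "0 < x")
      case True
      have "exp ((\<i> * t - 1) * x) = exp (- x) * iexp (t * x)"
        by (simp add: exp_add[symmetric] algebra_simps exp_of_real[symmetric])
      then show ?thesis using True by (simp add: half_exp_def scaleR_conv_of_real)
    next
      case False
      then have x: "x < 0" using elim by simp
      have "exp ((\<i> * (- t) - 1) * (- x)) = exp x * iexp (t * x)"
        by (simp add: exp_add[symmetric] algebra_simps exp_of_real[symmetric])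
      then show ?thesis using x by (simp add: half_exp_def scaleR_conv_of_real)
    qed
  qed
  have gm: "?g \<in> borel_measurable lborel" using ig by auto
  show "integrable lborel ?f"
    using ig by (rule integrable_cong_AE_imp) (use ae in \<open>auto elim: eventually_mono\<close>)
  have "integral\<^sup>L lborel ?f = integral\<^sup>L lborel ?g"
    by (rule integral_cong_AE) (use ae gm in auto)
  also have "\<dots> = (1/2) * (1 / (1 - \<i> * t) + integral\<^sup>L lborel (\<lambda>x. half_exp (- t) (0 + (-1) * x)))"
    by (simp only: integral_mult_right_zero Bochner_Integration.integral_add[OF integrable_half_exp i2] integral_half_exp)
  also have "integral\<^sup>L lborel (\<lambda>x. half_exp (- t) (0 + (-1) * x)) = 1 / (1 + \<i> * t)"
    using lborel_integral_real_affine[of "-1" "half_exp (- t)" 0] integral_half_exp[of "- t"] by simp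
  also have "(1/2) * (1 / (1 - \<i> * t) + 1 / (1 + \<i> * t)) = of_real (1 / (1 + t\<^sup>2))"
  proof -
    have nz: "1 - \<i> * t \<noteq> 0" "1 + \<i> * t \<noteq> 0" by (simp_all add: complex_eq_iff)
    have "(1 - \<i> * t) * (1 + \<i> * t) = of_real (1 + t\<^sup>2)"
      by (simp add: algebra_simps power2_eq_square)
    moreover have "(1/2) * (1 / (1 - \<i> * t) + 1 / (1 + \<i> * t)) = 1 / ((1 - \<i> * t) * (1 + \<i> * t))"
      using nz by (simp add: field_simps)
    ultimately show ?thesis by simp
  qed
  finally show "integral\<^sup>L lborel ?f = of_real (1 / (1 + t\<^sup>2))" .
qed

section \<open>The Laplace law and Poisson sums of it\<close>

lemma sets_laplace [simp, measurable_cong]: "sets laplace_distribution = sets borel"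
  and space_laplace [simp]: "space laplace_distribution = UNIV"
  by (simp_all add: laplace_distribution_def)

lemma prob_space_laplace: "prob_space laplace_distribution"
proof
  have i: "integrable lborel (\<lambda>x::real. 1 / 2 * exp (- \<bar>x\<bar>))"
  proof (rule Bochner_Integration.integrable_bound[OF integrable_laplace[of 0]])
    show "AE x in lborel. norm (1 / 2 * exp (- \<bar>x\<bar>)) \<le> cmod ((1 / 2 * exp (- \<bar>x\<bar>)) *\<^sub>R iexp (0 * x))" by simp
  qed simp
  \<comment> \<open>The total mass is the Fourier integral at 0.\<close>
  have "complex_of_real (\<integral>x. 1 / 2 * exp (- \<bar>x\<bar>) \<partial>lborel) = (\<integral>x. (1 / 2 * exp (- \<bar>x\<bar>)) *\<^sub>R iexp (0 * x) \<partial>lborel)"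
    by (subst integral_complex_of_real[symmetric]) (simp add: scaleR_conv_of_real)
  also have "\<dots> = 1" by (subst integral_laplace) simp
  finally have "(\<integral>x. 1 / 2 * exp (- \<bar>x :: real\<bar>) \<partial>lborel) = 1" by (metis of_real_1 of_real_eq_iff)
  then have "(\<integral>\<^sup>+x. ennreal (1 / 2 * exp (- \<bar>x\<bar>)) \<partial>lborel) = 1"
    using nn_integral_eq_integral[OF i] by simp
  then show "emeasure laplace_distribution (space laplace_distribution) = 1"
    by (simp add: laplace_distribution_def emeasure_density)
qed

lemma char_laplace: "char laplace_distribution t = of_real (1 / (1 + t\<^sup>2))"
  unfolding char_def laplace_distribution_def
  by (subst integral_density) (auto simp: integral_laplace[simplified])

text \<open>\<open>N\<close> takes countably many values, so measurability may be checked for each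
  fixed number of summands.\<close>

lemma measurable_random_sum:
  "(\<lambda>(N, \<eta>). \<Sum>k=1..N. \<eta> k) \<in> borel_measurable (measure_pmf p \<Otimes>\<^sub>M (\<Pi>\<^sub>M k\<in>{1::nat..}. laplace_distribution))"
proof -
  have "(\<lambda>x. case x of (N, \<eta>) \<Rightarrow> \<Sum>k=1..N. \<eta> k) \<in> borel_measurable (count_space UNIV \<Otimes>\<^sub>M (\<Pi>\<^sub>M k\<in>{1::nat..}. laplace_distribution))"
  proof (rule measurable_pair_measure_countable1)
    fix N :: nat
    have "(\<lambda>\<eta>. \<eta> k) \<in> borel_measurable (\<Pi>\<^sub>M k\<in>{1::nat..}. laplace_distribution)" if "k \<in> {1..N}" for k
      using measurable_component_singleton[of k "{1::nat..}" "\<lambda>_. laplace_distribution"] that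
      by (simp cong: measurable_cong_sets)
    then show "(\<lambda>\<eta>. case (N, \<eta>) of (N, \<eta>) \<Rightarrow> \<Sum>k=1..N. \<eta> k) \<in> borel_measurable (\<Pi>\<^sub>M k\<in>{1::nat..}. laplace_distribution)"
      by simp
  qed simp
  then show ?thesis by (simp cong: measurable_cong_sets)
qed

lemma real_distribution_mu: "real_distribution mu_P1sL"
proof -
  interpret Q: prob_space "\<Pi>\<^sub>M k\<in>{1::nat..}. laplace_distribution"
    by (intro prob_space_PiM prob_space_laplace)
  interpret PP: pair_prob_space "measure_pmf (poisson_pmf 1)" "\<Pi>\<^sub>M k\<in>{1::nat..}. laplace_distribution" ..
  show ?thesis unfolding mu_P1sL_def by (rule PP.P.real_distribution_distr) (rule measurable_random_sum)
qed

lemma char_laplace_sum: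
  "(\<integral>\<eta>. iexp (t * (\<Sum>k=1..N. \<eta> k)) \<partial>(\<Pi>\<^sub>M k\<in>{1::nat..}. laplace_distribution)) = of_real ((1 / (1 + t\<^sup>2)) ^ N)"
proof -
  let ?P = "\<Pi>\<^sub>M k\<in>{1::nat..}. laplace_distribution"
  interpret P: prob_space ?P by (intro prob_space_PiM prob_space_laplace)
  have comp: "(\<lambda>\<eta>. \<eta> k) \<in> borel_measurable ?P" if "k \<in> {1..}" for k
    using measurable_component_singleton[of k "{1::nat..}" "\<lambda>_. laplace_distribution"] that
    by (simp cong: measurable_cong_sets)
  have dk: "distr ?P borel (\<lambda>\<eta>. \<eta> k) = laplace_distribution" if "k \<in> {1..}" for k
  proof -
    have "distr ?P borel (\<lambda>\<eta>. \<eta> k) = distr ?P laplace_distribution (\<lambda>\<eta>. \<eta> k)" by (rule distr_cong) simp_all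
    also have "\<dots> = laplace_distribution" using that by (intro distr_PiM_component prob_space_laplace)
    finally show ?thesis .
  qed
  have "P.indep_vars (\<lambda>_. borel) (\<lambda>k \<eta>. \<eta> k) {1..}"
  proof (subst P.indep_vars_iff_distr_eq_PiM')
    have "distr ?P (\<Pi>\<^sub>M i\<in>{1..}. borel) (\<lambda>x. \<lambda>i\<in>{1..}. x i) = distr ?P ?P (\<lambda>x. x)"
      by (rule distr_cong) (auto simp: space_PiM PiE_def extensional_restrict intro!: sets_PiM_cong)
    also have "\<dots> = (\<Pi>\<^sub>M i\<in>{1..}. distr ?P borel (\<lambda>x. x i))"
      unfolding distr_id by (rule PiM_cong[OF refl]) (rule dk[symmetric])
    finally show "distr ?P (\<Pi>\<^sub>M i\<in>{1..}. borel) (\<lambda>x. \<lambda>i\<in>{1..}. x i) = (\<Pi>\<^sub>M i\<in>{1..}. distr ?P borel (\<lambda>x. x i))" .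
  qed (use comp in auto)
  then have "P.indep_vars (\<lambda>_. borel) (\<lambda>k \<eta>. \<eta> k) {1..N}" by (rule P.indep_vars_subset) auto
  then have "char (distr ?P borel (\<lambda>\<eta>. \<Sum>k=1..N. \<eta> k)) t = (\<Prod>k=1..N. char (distr ?P borel (\<lambda>\<eta>. \<eta> k)) t)"
    by (rule P.char_distr_sum)
  also have "\<dots> = (\<Prod>k=1..N. char laplace_distribution t)"
    by (intro prod.cong refl) (subst dk, auto)
  finally have "char (distr ?P borel (\<lambda>\<eta>. \<Sum>k=1..N. \<eta> k)) t = (\<Prod>k=1..N. char laplace_distribution t)" .
  moreover have "char (distr ?P borel (\<lambda>\<eta>. \<Sum>k=1..N. \<eta> k)) t = (\<integral>\<eta>. iexp (t * (\<Sum>k=1..N. \<eta> k)) \<partial>?P)"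
    unfolding char_def by (rule integral_distr) (auto intro!: borel_measurable_sum comp)
  ultimately show ?thesis by (simp add: char_laplace)
qed

text \<open>Given \<open>N\<close> the characteristic function is \<open>\<phi> ^ N\<close>; the
  Poisson generating function makes this exp(\<phi> - 1), and \<phi> - 1 = - t^2/(1+t^2).\<close>

lemma char_mu: "char mu_P1sL t = of_real (exp (- (t\<^sup>2 / (1 + t\<^sup>2))))"
proof -
  let ?P = "\<Pi>\<^sub>M k\<in>{1::nat..}. laplace_distribution"
  interpret Q: prob_space ?P by (intro prob_space_PiM prob_space_laplace)
  interpret PP: pair_prob_space "measure_pmf (poisson_pmf 1)" ?P ..
  define \<phi> where "\<phi> = 1 / (1 + t\<^sup>2)"
  have t1: "0 < 1 + t\<^sup>2" by (simp add: add_pos_nonneg)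
  then have \<phi>: "0 \<le> \<phi>" "\<phi> \<le> 1" by (auto simp: \<phi>_def)
  note [measurable] = measurable_random_sum[of "poisson_pmf 1"]
  have int: "integrable (measure_pmf (poisson_pmf 1) \<Otimes>\<^sub>M ?P) (\<lambda>x. iexp (t * (case x of (N, \<eta>) \<Rightarrow> \<Sum>k=1..N. \<eta> k)))"
    by (rule PP.P.integrable_const_bound[of _ 1]) simp_all
  have "char mu_P1sL t = (\<integral>x. iexp (t * (case x of (N, \<eta>) \<Rightarrow> \<Sum>k=1..N. \<eta> k)) \<partial>(measure_pmf (poisson_pmf 1) \<Otimes>\<^sub>M ?P))"
    unfolding char_def mu_P1sL_def by (rule integral_distr) simp_all
  also have "\<dots> = (\<integral>N. \<integral>\<eta>. iexp (t * (\<Sum>k=1..N. \<eta> k)) \<partial>?P \<partial>measure_pmf (poisson_pmf 1))"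
    using PP.integral_fst'[OF int] by simp
  also have "\<dots> = (\<integral>N. complex_of_real (\<phi> ^ N) \<partial>measure_pmf (poisson_pmf 1))"
    by (simp only: char_laplace_sum \<phi>_def)
  also have "\<dots> = of_real (\<integral>N. \<phi> ^ N \<partial>measure_pmf (poisson_pmf 1))"
    by (rule integral_complex_of_real)
  also have "(\<integral>N. \<phi> ^ N \<partial>measure_pmf (poisson_pmf 1)) = (\<integral>N. pmf (poisson_pmf 1) N * \<phi> ^ N \<partial>count_space UNIV)"
    by (subst measure_pmf_eq_density, subst integral_density) auto
  also have "\<dots> = (\<Sum>N. pmf (poisson_pmf 1) N * \<phi> ^ N)"
  proof (rule integral_count_space_nat)
    have "summable (\<lambda>N. exp (-1) * (\<phi> ^ N /\<^sub>R fact N))"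
      by (intro summable_mult summable_exp_generic)
    then show "integrable (count_space UNIV) (\<lambda>N. pmf (poisson_pmf 1) N * \<phi> ^ N)"
      using \<phi> by (simp add: integrable_count_space_nat_iff field_simps abs_mult)
  qed
  also have "\<dots> = (\<Sum>N. exp (-1) * (\<phi> ^ N /\<^sub>R fact N))"
    by (intro suminf_cong) (simp add: field_simps)
  also have "\<dots> = exp (-1) * exp \<phi>"
    using suminf_mult[OF summable_exp_generic[of \<phi>], of "exp (-1)"] by (simp add: exp_def)
  also have "\<dots> = exp (- (t\<^sup>2 / (1 + t\<^sup>2)))"
  proof -
    have "- 1 + \<phi> = - (t\<^sup>2 / (1 + t\<^sup>2))" using t1 by (simp add: \<phi>_def field_simps)
    then show ?thesis by (simp add: exp_add[symmetric])
  qed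
  finally show ?thesis .
qed

text \<open>The limit is along a real variable, so that both \<open>sqrt (real n)\<close> and
  \<open>L m\<close> can be substituted.\<close>

lemma one_minus_cos_scaled: "((\<lambda>x::real. x\<^sup>2 * (1 - cos (t / x))) \<longlongrightarrow> t\<^sup>2 / 2) at_top"
proof (cases "t = 0")
  case False
  have l: "((\<lambda>x::real. (1 - cos x) / x\<^sup>2) \<longlongrightarrow> 1 / 2) (at 0)" by real_asymp
  have "filterlim (\<lambda>x::real. t / x) (at 0) at_top"
    unfolding filterlim_at
  proof
    show "\<forall>\<^sub>F x in at_top. t / x \<in> UNIV \<and> t / x \<noteq> 0"
      by (rule eventually_mono[OF eventually_gt_at_top[of 0]]) (use False in auto)
    show "((\<lambda>x. t / x) \<longlongrightarrow> 0) at_top"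
      by (rule tendsto_divide_0[OF tendsto_const filterlim_at_top_imp_at_infinity[OF filterlim_ident]])
  qed
  from filterlim_compose[OF l this]
  have "((\<lambda>x. t\<^sup>2 * ((1 - cos (t / x)) / (t / x)\<^sup>2)) \<longlongrightarrow> t\<^sup>2 * (1/2)) at_top"
    by (intro tendsto_mult tendsto_const)
  moreover have "\<forall>\<^sub>F x in at_top. t\<^sup>2 * ((1 - cos (t / x)) / (t / x)\<^sup>2) = x\<^sup>2 * (1 - cos (t / x))"
    by (rule eventually_mono[OF eventually_gt_at_top[of 0]]) (use False in \<open>simp add: power_divide\<close>)
  ultimately show ?thesis using tendsto_cong by force
qed simp

section \<open>Limit theorems for the superposition\<close>

context product_chain
begin

lemma kap_defect_bounds:
  shows "0 \<le> 1 - Re (kap (\<rho> m) (cis t))" "1 - Re (kap (\<rho> m) (cis t)) \<le> 2"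
    "cmod (1 - kap (\<rho> m) (cis t)) \<le> 2" "cmod (cis t - kap (\<rho> m) (cis t)) \<le> 2"
proof -
  have k: "cmod (kap (\<rho> m) (cis t)) \<le> 1" by (rule norm_kap_le) (use \<rho> in auto)
  have "\<bar>Re (kap (\<rho> m) (cis t))\<bar> \<le> 1" using abs_Re_le_cmod[of "kap (\<rho> m) (cis t)"] k by linarith
  then show "0 \<le> 1 - Re (kap (\<rho> m) (cis t))" "1 - Re (kap (\<rho> m) (cis t)) \<le> 2" by auto
  show "cmod (1 - kap (\<rho> m) (cis t)) \<le> 2" using norm_triangle_ineq4[of 1 "kap (\<rho> m) (cis t)"] k by simp
  show "cmod (cis t - kap (\<rho> m) (cis t)) \<le> 2" using norm_triangle_ineq4[of "cis t" "kap (\<rho> m) (cis t)"] k by simp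
qed

text \<open>With \<rho> fixed the angle tends to 0, so \<open>E\<close>, \<open>\<eta>\<close> and
  \<open>\<delta>\<close> vanish, while \<open>real n * \<delta> n\<close> converges. The limit is
  that of a centred normal law with variance \<open>w m * L m * (1 + \<rho> m)\<close>.\<close>

lemma cf_clt:
  "(\<lambda>n. cf m n (c / sqrt (real n))) \<longlonglongrightarrow> of_real (exp (- (w m * L m * (1 + \<rho> m) * c\<^sup>2 / 2)))"
proof -
  define \<theta> where "\<theta> n = c / sqrt (real n)" for n
  define \<delta> where "\<delta> n = 1 - Re (kap (\<rho> m) (cis (\<theta> n)))" for n
  define E where "E n = cmod (1 - kap (\<rho> m) (cis (\<theta> n)))" for n
  define \<eta> where "\<eta> n = cmod (cis (\<theta> n) - kap (\<rho> m) (cis (\<theta> n)))" for n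
  define r where "r n = (1 - (1 - \<rho> m) * w m * \<delta> n) ^ n" for n
  have r1: "0 < 1 - \<rho> m" using \<rho>[of m] by simp
  have sq: "filterlim (\<lambda>n. sqrt (real n)) at_top sequentially"
    by (rule filterlim_compose[OF sqrt_at_top filterlim_real_sequentially])
  have \<theta>0: "\<theta> \<longlonglongrightarrow> 0"
    unfolding \<theta>_def by (rule tendsto_divide_0[OF tendsto_const filterlim_at_top_imp_at_infinity[OF sq]])
  have cis0: "(\<lambda>n. cis (\<theta> n)) \<longlonglongrightarrow> cis 0"
    unfolding cis_conv_exp by (intro tendsto_intros \<theta>0)
  have "(\<lambda>n. cmod (1 - cis (\<theta> n)) / (1 - \<rho> m)) \<longlonglongrightarrow> cmod (1 - cis 0) / (1 - \<rho> m)"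
    using r1 by (intro tendsto_divide tendsto_norm tendsto_diff tendsto_const cis0) auto
  then have e0: "(\<lambda>n. cmod (1 - cis (\<theta> n)) / (1 - \<rho> m)) \<longlonglongrightarrow> 0" by simp
  have E0: "E \<longlonglongrightarrow> 0"
    by (rule Lim_null_comparison[OF _ e0])
      (use norm_one_minus_kap_le[of "cis (\<theta> _)" "\<rho> m"] \<rho>[of m] in \<open>simp add: E_def\<close>)
  have \<eta>0: "\<eta> \<longlonglongrightarrow> 0"
    by (rule Lim_null_comparison[OF _ e0])
      (use norm_minus_kap_le[of "cis (\<theta> _)" "\<rho> m"] \<rho>[of m] in \<open>simp add: \<eta>_def\<close>)
  have u: "(\<lambda>n. real n * (1 - cos (\<theta> n))) \<longlonglongrightarrow> c\<^sup>2 / 2"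
    using filterlim_compose[OF one_minus_cos_scaled[of c] sq] by (simp add: \<theta>_def)
  have "(\<lambda>n. 1 - cos (\<theta> n)) \<longlonglongrightarrow> 1 - cos 0" using \<theta>0 by (intro tendsto_intros)
  then have v: "(\<lambda>n. 1 - cos (\<theta> n)) \<longlonglongrightarrow> 0" by simp
  have den: "(\<lambda>n. (1 - \<rho> m)\<^sup>2 + 2 * \<rho> m * (1 - cos (\<theta> n))) \<longlonglongrightarrow> (1 - \<rho> m)\<^sup>2 + 2 * \<rho> m * 0"
    by (intro tendsto_intros v)
  have \<delta>eq: "\<delta> n = (1 + \<rho> m) * (1 - cos (\<theta> n)) / ((1 - \<rho> m)\<^sup>2 + 2 * \<rho> m * (1 - cos (\<theta> n)))" for n
    unfolding \<delta>_def by (rule one_minus_Re_kap) (use \<rho> in auto)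
  have "\<delta> \<longlonglongrightarrow> (1 + \<rho> m) * 0 / ((1 - \<rho> m)\<^sup>2 + 2 * \<rho> m * 0)"
    unfolding \<delta>eq using r1 by (intro tendsto_divide den tendsto_mult tendsto_const v) auto
  then have \<delta>0: "\<delta> \<longlonglongrightarrow> 0" by simp
  have "(\<lambda>n. (1 + \<rho> m) * (real n * (1 - cos (\<theta> n))) / ((1 - \<rho> m)\<^sup>2 + 2 * \<rho> m * (1 - cos (\<theta> n))))
      \<longlonglongrightarrow> (1 + \<rho> m) * (c\<^sup>2 / 2) / ((1 - \<rho> m)\<^sup>2 + 2 * \<rho> m * 0)"
    using r1 by (intro tendsto_divide den tendsto_mult tendsto_const u) auto
  then have n\<delta>: "(\<lambda>n. real n * \<delta> n) \<longlonglongrightarrow> (1 + \<rho> m) * (c\<^sup>2 / 2) / (1 - \<rho> m)\<^sup>2"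
    by (simp add: \<delta>eq mult_ac)
  have "(\<lambda>n. 3 * w m * E n + 2 * (real n * \<delta> n) * (1 - \<rho> m) * (w m)\<^sup>2 * \<eta> n + 2 * (w m)\<^sup>2 * \<eta> n * \<delta> n + w m * \<delta> n)
    \<longlonglongrightarrow> 3 * w m * 0 + 2 * ((1 + \<rho> m) * (c\<^sup>2 / 2) / (1 - \<rho> m)\<^sup>2) * (1 - \<rho> m) * (w m)\<^sup>2 * 0 + 2 * (w m)\<^sup>2 * 0 * 0 + w m * 0"
    by (intro tendsto_intros E0 \<eta>0 \<delta>0 n\<delta>)
  then have b0: "(\<lambda>n. 3 * w m * E n + 2 * (real n * \<delta> n) * (1 - \<rho> m) * (w m)\<^sup>2 * \<eta> n + 2 * (w m)\<^sup>2 * \<eta> n * \<delta> n + w m * \<delta> n) \<longlonglongrightarrow> 0"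
    by simp
  have "(\<lambda>n. cf m n (\<theta> n) - of_real (r n)) \<longlonglongrightarrow> 0"
  proof (rule Lim_null_comparison[OF _ b0], rule always_eventually, rule allI)
    fix n
    show "cmod (cf m n (\<theta> n) - of_real (r n))
      \<le> 3 * w m * E n + 2 * (real n * \<delta> n) * (1 - \<rho> m) * (w m)\<^sup>2 * \<eta> n + 2 * (w m)\<^sup>2 * \<eta> n * \<delta> n + w m * \<delta> n"
      using cf_bound[of m n "\<theta> n"] by (simp only: r_def \<delta>_def E_def \<eta>_def mult_ac)
  qed
  moreover have "(\<lambda>n. of_real (r n) :: complex) \<longlonglongrightarrow> of_real (exp (- (w m * L m * (1 + \<rho> m) * c\<^sup>2 / 2)))"
    unfolding r_def
  proof (intro tendsto_of_real power_one_minus_tendsto_exp)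
    have "(\<lambda>n. (1 - \<rho> m) * w m * \<delta> n) \<longlonglongrightarrow> (1 - \<rho> m) * w m * 0" by (intro tendsto_intros \<delta>0)
    then show "(\<lambda>n. (1 - \<rho> m) * w m * \<delta> n) \<longlonglongrightarrow> 0" by simp
    have "(\<lambda>n. (1 - \<rho> m) * w m * (real n * \<delta> n)) \<longlonglongrightarrow> (1 - \<rho> m) * w m * ((1 + \<rho> m) * (c\<^sup>2 / 2) / (1 - \<rho> m)\<^sup>2)"
      by (intro tendsto_intros n\<delta>)
    also have "(1 - \<rho> m) * w m * ((1 + \<rho> m) * (c\<^sup>2 / 2) / (1 - \<rho> m)\<^sup>2) = w m * (1 / (1 - \<rho> m)) * (1 + \<rho> m) * c\<^sup>2 / 2"
    proof -
      have "x * y * (z * (d / 2) / x\<^sup>2) = y * (1 / x) * z * d / 2" if "x \<noteq> 0" for x y z d :: real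
        using that by (simp add: power2_eq_square)
      then show ?thesis using r1 by (metis less_irrefl)
    qed
    also have "1 / (1 - \<rho> m) = L m" by (simp add: one_minus_\<rho>)
    finally show "(\<lambda>n. real n * ((1 - \<rho> m) * w m * \<delta> n)) \<longlonglongrightarrow> w m * L m * (1 + \<rho> m) * c\<^sup>2 / 2"
      by (simp add: mult_ac)
  qed
  ultimately have "(\<lambda>n. (cf m n (\<theta> n) - of_real (r n)) + of_real (r n)) \<longlonglongrightarrow> 0 + of_real (exp (- (w m * L m * (1 + \<rho> m) * c\<^sup>2 / 2)))"
    by (rule tendsto_add)
  then show ?thesis by (simp add: \<theta>_def)
qed

text \<open>The angle t/L is comparable with 1 - \<rho>, so \<open>E\<close> and
  \<open>\<eta>\<close> need not vanish and are only bounded by 2. The errors disappear because each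
  keeps a factor \<open>w m\<close> after \<open>real (J m) * w m / L m\<close>, which tends to 1,
  is split off. The limit of \<open>\<delta>\<close> is 1 minus the Laplace characteristic
  function.\<close>

lemma cf_compound_poisson:
  assumes Linf: "filterlim L at_top sequentially" and w0: "w \<longlonglongrightarrow> 0"
    and J: "(\<lambda>m. real (J m) * w m / L m) \<longlonglongrightarrow> 1"
  shows "(\<lambda>m. cf m (J m) (t / L m)) \<longlonglongrightarrow> of_real (exp (- (t\<^sup>2 / (1 + t\<^sup>2))))"
proof -
  define \<delta> where "\<delta> m = 1 - Re (kap (\<rho> m) (cis (t / L m)))" for m
  define r where "r m = (1 - (1 - \<rho> m) * w m * \<delta> m) ^ J m" for m
  define u where "u m = (L m)\<^sup>2 * (1 - cos (t / L m))" for m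
  have L0: "0 < L m" for m using L[of m] by simp
  have Li: "(\<lambda>m. 1 / L m) \<longlonglongrightarrow> 0"
    by (rule tendsto_divide_0[OF tendsto_const filterlim_at_top_imp_at_infinity[OF Linf]])
  have \<rho>1: "\<rho> \<longlonglongrightarrow> 1"
    using tendsto_diff[OF tendsto_const[of 1] Li] by (simp add: \<rho>_def[abs_def])
  have ul: "u \<longlonglongrightarrow> t\<^sup>2 / 2"
    unfolding u_def by (rule filterlim_compose[OF one_minus_cos_scaled Linf])
  have \<delta>eq: "\<delta> m = (1 + \<rho> m) * u m / (1 + 2 * \<rho> m * u m)" for m
  proof -
    have "\<delta> m = (1 + \<rho> m) * (1 - cos (t / L m)) / ((1 - \<rho> m)\<^sup>2 + 2 * \<rho> m * (1 - cos (t / L m)))"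
      unfolding \<delta>_def by (rule one_minus_Re_kap) (use \<rho> in auto)
    also have "\<dots> = ((L m)\<^sup>2 * ((1 + \<rho> m) * (1 - cos (t / L m)))) / ((L m)\<^sup>2 * ((1 - \<rho> m)\<^sup>2 + 2 * \<rho> m * (1 - cos (t / L m))))"
      using L0[of m] by simp
    also have "(L m)\<^sup>2 * ((1 + \<rho> m) * (1 - cos (t / L m))) = (1 + \<rho> m) * u m" by (simp add: u_def)
    also have "(L m)\<^sup>2 * ((1 - \<rho> m)\<^sup>2 + 2 * \<rho> m * (1 - cos (t / L m))) = (L m)\<^sup>2 * (1 - \<rho> m)\<^sup>2 + 2 * \<rho> m * u m"
      by (simp add: u_def algebra_simps)
    also have "(L m)\<^sup>2 * (1 - \<rho> m)\<^sup>2 = 1" using L0[of m] by (simp add: one_minus_\<rho> power_divide)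
    finally show ?thesis .
  qed
  have t1: "0 < 1 + t\<^sup>2" by (simp add: add_pos_nonneg)
  have "(\<lambda>m. (1 + \<rho> m) * u m / (1 + 2 * \<rho> m * u m)) \<longlonglongrightarrow> (1 + 1) * (t\<^sup>2 / 2) / (1 + 2 * 1 * (t\<^sup>2 / 2))"
    using t1 by (intro tendsto_intros \<rho>1 ul) auto
  then have \<delta>l: "\<delta> \<longlonglongrightarrow> t\<^sup>2 / (1 + t\<^sup>2)" unfolding \<delta>eq[abs_def] by simp
  have "(\<lambda>m. 3 * w m * 2 + 2 * (real (J m) * w m / L m) * w m * 2 * 2 + 2 * (w m)\<^sup>2 * 2 * 2 + w m * 2)
      \<longlonglongrightarrow> 3 * 0 * 2 + 2 * 1 * 0 * 2 * 2 + 2 * 0\<^sup>2 * 2 * 2 + 0 * 2"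
    by (intro tendsto_intros w0 J)
  then have b0: "(\<lambda>m. 3 * w m * 2 + 2 * (real (J m) * w m / L m) * w m * 2 * 2 + 2 * (w m)\<^sup>2 * 2 * 2 + w m * 2) \<longlonglongrightarrow> 0"
    by simp
  have "(\<lambda>m. cf m (J m) (t / L m) - of_real (r m)) \<longlonglongrightarrow> 0"
  proof (rule Lim_null_comparison[OF _ b0], rule always_eventually, rule allI)
    fix m
    let ?e = "cis (t / L m)"
    let ?E = "cmod (1 - kap (\<rho> m) ?e)" and ?\<eta> = "cmod (?e - kap (\<rho> m) ?e)"
    note b = kap_defect_bounds[where m=m and t="t / L m"]
    have "cmod (cf m (J m) (t / L m) - of_real (r m))
      \<le> 3 * w m * ?E + 2 * real (J m) * (1 - \<rho> m) * (w m)\<^sup>2 * ?\<eta> * \<delta> m + 2 * (w m)\<^sup>2 * ?\<eta> * \<delta> m + w m * \<delta> m"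
      using cf_bound[of m "J m" "t / L m"] by (simp add: r_def \<delta>_def)
    also have "\<dots> \<le> 3 * w m * 2 + 2 * real (J m) * (1 - \<rho> m) * (w m)\<^sup>2 * 2 * 2 + 2 * (w m)\<^sup>2 * 2 * 2 + w m * 2"
      using w'[of m] \<rho>[of m] b unfolding \<delta>_def
      by (intro add_mono mult_mono mult_left_mono mult_nonneg_nonneg order_refl) auto
    also have "2 * real (J m) * (1 - \<rho> m) * (w m)\<^sup>2 = 2 * (real (J m) * w m / L m) * w m"
      by (simp add: one_minus_\<rho> power2_eq_square)
    finally show "cmod (cf m (J m) (t / L m) - of_real (r m))
      \<le> 3 * w m * 2 + 2 * (real (J m) * w m / L m) * w m * 2 * 2 + 2 * (w m)\<^sup>2 * 2 * 2 + w m * 2" .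
  qed
  moreover have "(\<lambda>m. of_real (r m) :: complex) \<longlonglongrightarrow> of_real (exp (- (t\<^sup>2 / (1 + t\<^sup>2))))"
    unfolding r_def
  proof (intro tendsto_of_real power_one_minus_tendsto_exp)
    have "(\<lambda>m. (1 - \<rho> m) * w m * \<delta> m) \<longlonglongrightarrow> (1 - 1) * 0 * (t\<^sup>2 / (1 + t\<^sup>2))" by (intro tendsto_intros \<rho>1 w0 \<delta>l)
    then show "(\<lambda>m. (1 - \<rho> m) * w m * \<delta> m) \<longlonglongrightarrow> 0" by simp
    have "(\<lambda>m. (real (J m) * w m / L m) * \<delta> m) \<longlonglongrightarrow> 1 * (t\<^sup>2 / (1 + t\<^sup>2))" by (intro tendsto_mult J \<delta>l)
    then show "(\<lambda>m. real (J m) * ((1 - \<rho> m) * w m * \<delta> m)) \<longlonglongrightarrow> t\<^sup>2 / (1 + t\<^sup>2)"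
      by (simp add: one_minus_\<rho> mult_ac)
  qed
  ultimately have "(\<lambda>m. (cf m (J m) (t / L m) - of_real (r m)) + of_real (r m)) \<longlonglongrightarrow> 0 + of_real (exp (- (t\<^sup>2 / (1 + t\<^sup>2))))"
    by (rule tendsto_add)
  then show ?thesis by simp
qed

section \<open>Partial sums of the state process\<close>

definition SX :: "nat \<Rightarrow> (int \<Rightarrow> real) \<Rightarrow> real" where
  "SX n \<omega> = (\<Sum>k=1..n. X (int k) \<omega>)"

lemma measurable_SX [measurable]: "SX n \<in> borel_measurable PM"
  unfolding SX_def[abs_def] by measurable

lemma AE_SX: "AE \<omega> in PM. SX n \<omega> = SY n \<omega>"
  using AE_good by eventually_elim (simp add: SX_def SY_def good_X)

lemma variance_SX: "variance (SX n) = expectation (\<lambda>\<omega>. (SY n \<omega>)\<^sup>2)"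
proof -
  have "expectation (SX n) = expectation (SY n)"
    by (rule integral_cong_AE) (use AE_SX in auto)
  then have e: "expectation (SX n) = 0" by (simp add: expectation_SY)
  have "expectation (\<lambda>\<omega>. (SX n \<omega>)\<^sup>2) = expectation (\<lambda>\<omega>. (SY n \<omega>)\<^sup>2)"
  proof (rule integral_cong_AE)
    show "AE \<omega> in PM. (SX n \<omega>)\<^sup>2 = (SY n \<omega>)\<^sup>2" using AE_SX[of n] by eventually_elim simp
  qed measurable
  then show ?thesis by (simp add: e)
qed

lemma expectation_X: "expectation (X k) = 0"
proof -
  have "expectation (X k) = expectation (Y k)"
  proof (rule integral_cong_AE)
    show "AE \<omega> in PM. X k \<omega> = Y k \<omega>" using AE_good by eventually_elim (rule good_X)
  qed measurable
  then show ?thesis by (simp add: expectation_Y)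
qed

lemma X_abs_le: "\<bar>X k \<omega>\<bar> \<le> 4/3"
  using abs_val_le[of "\<lambda>m. Z m k \<omega>", OF Z_abs_le] by (simp add: X_def Y_def)

lemma variance_SX_ge:
  assumes "2 * real n \<le> L m"
  shows "((1/4) ^ m)\<^sup>2 * w m / 2 * (real n)\<^sup>2 \<le> variance (SX n)"
proof -
  have "((1/4) ^ m)\<^sup>2 * (w m * (real n)\<^sup>2 / 2) \<le> ((1/4) ^ m)\<^sup>2 * var m n"
    by (intro mult_left_mono var_ge assms) simp
  also have "\<dots> \<le> variance (SX n)" using second_moment_SY_ge[of m n] by (simp only: variance_SX)
  finally show ?thesis by simp
qed

lemma char_SX:
  "char (distr PM borel (\<lambda>\<omega>. SX n \<omega> / c)) t = (\<integral>\<omega>. iexp (t / c * SY n \<omega>) \<partial>PM)"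
proof -
  have "char (distr PM borel (\<lambda>\<omega>. SX n \<omega> / c)) t = (\<integral>\<omega>. iexp (t * (SX n \<omega> / c)) \<partial>PM)"
    unfolding char_def by (rule integral_distr) measurable
  also have "\<dots> = (\<integral>\<omega>. iexp (t / c * SY n \<omega>) \<partial>PM)"
  proof (rule integral_cong_AE)
    show "AE \<omega> in PM. iexp (t * (SX n \<omega> / c)) = iexp (t / c * SY n \<omega>)" using AE_SX[of n] by eventually_elim simp
  qed measurable
  finally show ?thesis .
qed

text \<open>The order of choice matters: for given \<epsilon> a component is fixed whose Gaussian
  limit is already below \<epsilon> at the frequency in question, and only then \<open>n\<close>
  tends to infinity. The other components can only decrease the modulus.\<close>

lemma concentration_SX:
  assumes big: "filterlim (\<lambda>m. w m * L m * ((1/4) ^ m)\<^sup>2) at_top sequentially" and c: "0 < c"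
  shows "(\<lambda>n. SUP r. prob {\<omega>\<in>space PM. r - c < SX n \<omega> / sqrt (real n) \<and> SX n \<omega> / sqrt (real n) < r + c}) \<longlonglongrightarrow> 0"
proof (rule concentration_tendsto_0[OF prob_space_axioms _ c])
  show "(\<lambda>\<omega>. SX n \<omega> / sqrt (real n)) \<in> borel_measurable PM" for n by measurable
  fix t :: real assume t: "t \<noteq> 0"
  show "(\<lambda>n. char (distr PM borel (\<lambda>\<omega>. SX n \<omega> / sqrt (real n))) t) \<longlonglongrightarrow> 0"
  proof (rule LIMSEQ_I)
    fix \<epsilon> :: real assume \<epsilon>: "0 < \<epsilon>"
    have t2: "0 < t\<^sup>2 / 2" using t by simp
    have "filterlim (\<lambda>m. t\<^sup>2 / 2 * (w m * L m * ((1/4) ^ m)\<^sup>2)) at_top sequentially"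
      by (rule filterlim_tendsto_pos_mult_at_top[OF tendsto_const t2 big])
    then have "(\<lambda>m. exp (- (t\<^sup>2 / 2 * (w m * L m * ((1/4) ^ m)\<^sup>2)))) \<longlonglongrightarrow> 0"
      by (intro filterlim_compose[OF exp_at_bot] filterlim_compose[OF filterlim_uminus_at_bot_at_top])
    then have "\<forall>\<^sub>F m in sequentially. exp (- (t\<^sup>2 / 2 * (w m * L m * ((1/4) ^ m)\<^sup>2))) < \<epsilon>"
      using \<epsilon> by (intro order_tendstoD) auto
    then obtain m where m: "exp (- (t\<^sup>2 / 2 * (w m * L m * ((1/4) ^ m)\<^sup>2))) < \<epsilon>"
      by (auto simp: eventually_sequentially)
    define a where "a = t * (1/4) ^ m"
    have "exp (- (w m * L m * (1 + \<rho> m) * a\<^sup>2 / 2)) \<le> exp (- (t\<^sup>2 / 2 * (w m * L m * ((1/4) ^ m)\<^sup>2)))"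
    proof -
      have 1: "w m * L m * a\<^sup>2 \<le> w m * L m * a\<^sup>2 * (1 + \<rho> m)"
        using w'[of m] L[of m] \<rho>[of m] by (simp add: distrib_left)
      have 2: "t\<^sup>2 / 2 * (w m * L m * ((1/4) ^ m)\<^sup>2) = w m * L m * a\<^sup>2 / 2"
        by (simp add: a_def power_mult_distrib)
      have 3: "w m * L m * (1 + \<rho> m) * a\<^sup>2 / 2 = w m * L m * a\<^sup>2 * (1 + \<rho> m) / 2" by simp
      show ?thesis unfolding 2 3 exp_le_cancel_iff using 1 by linarith
    qed
    from le_less_trans[OF this m]
    have lt: "cmod (of_real (exp (- (w m * L m * (1 + \<rho> m) * a\<^sup>2 / 2)))) < \<epsilon>"
      by (simp only: norm_of_real abs_exp_cancel)
    have "(\<lambda>n. cmod (cf m n (a / sqrt (real n)))) \<longlonglongrightarrow> cmod (of_real (exp (- (w m * L m * (1 + \<rho> m) * a\<^sup>2 / 2))))"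
      by (intro tendsto_norm cf_clt)
    then have "\<forall>\<^sub>F n in sequentially. cmod (cf m n (a / sqrt (real n))) < \<epsilon>"
      using lt by (rule order_tendstoD)
    then obtain N where N: "\<And>n. N \<le> n \<Longrightarrow> cmod (cf m n (a / sqrt (real n))) < \<epsilon>"
      by (auto simp: eventually_sequentially)
    have "cmod (char (distr PM borel (\<lambda>\<omega>. SX n \<omega> / sqrt (real n))) t) \<le> cmod (cf m n (a / sqrt (real n)))" for n
      using cf_SY_le[of "t / sqrt (real n)" n m] by (simp add: char_SX a_def)
    then show "\<exists>no. \<forall>n\<ge>no. norm (char (distr PM borel (\<lambda>\<omega>. SX n \<omega> / sqrt (real n))) t - 0) < \<epsilon>"
      using N by (intro exI[of _ N]) (auto intro: le_less_trans)
  qed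
qed

text \<open>At time \<open>J m\<close> component \<open>m\<close> has the compound Poisson limit on
  the scale \<open>(1/4) ^ m * L m\<close>. What remains is that all others are negligible in mean
  on that scale: \<open>growth\<close> takes care of the faster components, \<open>ratio\<close> of
  the slower ones.\<close>

lemma weak_conv_SX:
  assumes Linc: "incseq L" and wdec: "decseq w"
    and growth: "\<And>m. L m * real (m + 1) \<le> L (Suc m) * w (Suc m) * ((1/4) ^ Suc m)\<^sup>2"
    and ratio: "\<And>m. w (Suc m) \<le> w m * ((1/4) ^ m)\<^sup>2"
    and Linf: "filterlim L at_top sequentially"
    and J: "\<And>m. L m / w m \<le> real (J m)" "\<And>m. real (J m) \<le> L m / w m + 1"
  shows "weak_conv_m (\<lambda>m. distr PM borel (\<lambda>\<omega>. SX (J m) \<omega> / ((1/4) ^ m * L m))) mu_P1sL"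
proof (rule levy_continuity)
  show "real_distribution (distr PM borel (\<lambda>\<omega>. SX (J m) \<omega> / ((1/4) ^ m * L m)))" for m
    by (rule real_distribution_distr) measurable
  show "real_distribution mu_P1sL" by (rule real_distribution_mu)
  fix t
  have L0: "0 < L m" for m using L[of m] by simp
  have w0: "w \<longlonglongrightarrow> 0" using sw by (rule summable_LIMSEQ_zero)
  have Li: "(\<lambda>m. 1 / L m) \<longlonglongrightarrow> 0"
    by (rule tendsto_divide_0[OF tendsto_const filterlim_at_top_imp_at_infinity[OF Linf]])
  have JL: "(\<lambda>m. real (J m) * w m / L m) \<longlonglongrightarrow> 1"
  proof (rule tendsto_sandwich[of "\<lambda>_. 1" _ _ "\<lambda>m. 1 + w m * (1 / L m)"])
    show "\<forall>\<^sub>F m in sequentially. 1 \<le> real (J m) * w m / L m"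
      using J(1) w(1) L0 by (intro always_eventually allI) (simp add: field_simps)
    show "\<forall>\<^sub>F m in sequentially. real (J m) * w m / L m \<le> 1 + w m * (1 / L m)"
    proof (intro always_eventually allI)
      fix m
      have "real (J m) * w m \<le> (L m / w m + 1) * w m" using J(2)[of m] w'[of m] by (intro mult_right_mono) auto
      also have "\<dots> = L m + w m" using w(1)[of m] by (simp add: distrib_right)
      finally have "real (J m) * w m / L m \<le> (L m + w m) / L m" using L0[of m] by (intro divide_right_mono) auto
      then show "real (J m) * w m / L m \<le> 1 + w m * (1 / L m)"
        using L0[of m] by (simp add: add_divide_distrib)
    qed
    have "(\<lambda>m. 1 + w m * (1 / L m)) \<longlonglongrightarrow> 1 + 0 * 0" by (intro tendsto_intros w0 Li)
    then show "(\<lambda>m. 1 + w m * (1 / L m)) \<longlonglongrightarrow> 1" by simp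
  qed simp
  define b where "b m = (1/4) ^ m * L m" for m
  have b0: "0 < b m" for m using L0 by (simp add: b_def)
  define e where "e m = \<bar>t\<bar> * (4/3 * (sqrt (4 / real (m + 1)) + 2 * (1/4) ^ Suc m))" for m
  \<comment> \<open>The index is shifted because \<open>growth\<close> bounds \<open>L m\<close> in
    terms of its successor; the limit is insensitive to the shift.\<close>
  have err: "cmod (char (distr PM borel (\<lambda>\<omega>. SX (J (Suc m)) \<omega> / b (Suc m))) t - cf (Suc m) (J (Suc m)) (t / L (Suc m))) \<le> e m" for m
  proof -
    let ?M = "Suc m"
    let ?a = "(1/4::real) ^ ?M"
    \<comment> \<open>The first summand covers all components up to \<open>m\<close>, the second
      those beyond \<open>Suc m\<close>.\<close>
    define B where "B = sqrt (2 * real (J ?M) * L m) + real (J ?M) * w (Suc ?M)"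
    have wM: "0 < w ?M" "w ?M \<le> 1" using w w' by auto
    have "1 \<le> L ?M / w ?M" using wM L[of ?M] by simp
    then have J2: "real (J ?M) \<le> 2 * (L ?M / w ?M)" using J(2)[of ?M] by linarith
    have TB: "expectation (\<lambda>\<omega>. \<bar>T j (J ?M) \<omega>\<bar>) \<le> B" if "j \<noteq> ?M" for j
    proof (cases "j \<le> m")
      case True
      have "w j * L j \<le> 1 * L m"
        using w'[of j] incseqD[OF Linc True] L0[of j] by (intro mult_mono) auto
      then have "2 * real (J ?M) * w j * L j \<le> 2 * real (J ?M) * L m"
        by (simp add: mult.assoc mult_left_mono)
      then have "sqrt (2 * real (J ?M) * w j * L j) \<le> sqrt (2 * real (J ?M) * L m)" by simp
      then show ?thesis
        using expectation_abs_T_le_sqrt[of j "J ?M"] w'[of "Suc ?M"] unfolding B_def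
        by (smt (verit) mult_nonneg_nonneg of_nat_0_le_iff)
    next
      case False
      then have "Suc ?M \<le> j" using that by simp
      then have "real (J ?M) * w j \<le> real (J ?M) * w (Suc ?M)"
        using decseqD[OF wdec] by (intro mult_left_mono) auto
      moreover have "0 \<le> sqrt (2 * real (J ?M) * L m)" using L0[of m] by simp
      ultimately show ?thesis using expectation_abs_T_le[of j "J ?M"] unfolding B_def by linarith
    qed
    have B0: "0 \<le> B" unfolding B_def using L0[of m] w'[of "Suc ?M"] by (intro add_nonneg_nonneg) auto
    have R: "expectation (\<lambda>\<omega>. \<bar>R ?M (J ?M) \<omega>\<bar>) \<le> 4/3 * B" by (rule expectation_abs_R_le[OF TB B0])
    \<comment> \<open>With J at most 2 L/w, the factor \<open>w ?M\<close> and the squared weight in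
      \<open>growth\<close> produce exactly the square of \<open>b ?M\<close>, and the factor
      \<open>m + 1\<close> there provides the decay.\<close>
    have s1: "sqrt (2 * real (J ?M) * L m) \<le> b ?M * sqrt (4 / real (m + 1))"
    proof (rule real_le_lsqrt)
      have "L m * real (m + 1) / real (m + 1) \<le> L ?M * w ?M * ?a\<^sup>2 / real (m + 1)"
        by (rule divide_right_mono[OF growth]) simp
      then have Lm: "L m \<le> L ?M * w ?M * ?a\<^sup>2 / real (m + 1)" by simp
      have "2 * real (J ?M) * L m \<le> 2 * (2 * (L ?M / w ?M)) * (L ?M * w ?M * ?a\<^sup>2 / real (m + 1))"
        using J2 Lm less_imp_le[OF L0] wM by (intro mult_mono) auto
      also have "\<dots> = (b ?M)\<^sup>2 * (4 / real (m + 1))"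
      proof -
        have "2 * (2 * (l / x)) * (l * x * p\<^sup>2 / q) = (p * l)\<^sup>2 * (4 / q)" if "x \<noteq> 0" for l x p q :: real
          using that by (simp add: power2_eq_square)
        then show ?thesis using wM by (simp only: b_def)
      qed
      also have "\<dots> = (b ?M * sqrt (4 / real (m + 1)))\<^sup>2"
        by (subst power_mult_distrib) simp
      finally show "2 * real (J ?M) * L m \<le> (b ?M * sqrt (4 / real (m + 1)))\<^sup>2" .
      show "0 \<le> b ?M * sqrt (4 / real (m + 1))" using b0[of ?M] by simp
    qed
    have s2: "real (J ?M) * w (Suc ?M) \<le> b ?M * (2 * ?a)"
    proof -
      have "real (J ?M) * w (Suc ?M) \<le> 2 * (L ?M / w ?M) * (w ?M * ?a\<^sup>2)"
        using J2 ratio[of ?M] w'[of "Suc ?M"] L0[of ?M] wM by (intro mult_mono) auto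
      also have "\<dots> = b ?M * (2 * ?a)" using wM by (simp add: b_def power2_eq_square)
      finally show ?thesis .
    qed
    have "B \<le> b ?M * (sqrt (4 / real (m + 1)) + 2 * ?a)"
      using s1 s2 unfolding B_def distrib_left by linarith
    then have "\<bar>t\<bar> / b ?M * (4/3 * B) \<le> \<bar>t\<bar> / b ?M * (4/3 * (b ?M * (sqrt (4 / real (m + 1)) + 2 * ?a)))"
      using b0[of ?M] by (intro mult_left_mono) auto
    also have "\<dots> = e m" using b0[of ?M] by (simp add: e_def)
    finally have eB: "\<bar>t\<bar> / b ?M * (4/3 * B) \<le> e m" .
    have "t / b ?M * ?a = t / L ?M" by (simp add: b_def)
    then have "cmod (char (distr PM borel (\<lambda>\<omega>. SX (J ?M) \<omega> / b ?M)) t - cf ?M (J ?M) (t / L ?M))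
       \<le> \<bar>t / b ?M\<bar> * expectation (\<lambda>\<omega>. \<bar>R ?M (J ?M) \<omega>\<bar>)"
      using cf_SY_approx[of "t / b ?M" "J ?M" ?M] by (simp only: char_SX)
    also have "\<dots> \<le> \<bar>t / b ?M\<bar> * (4/3 * B)" by (intro mult_left_mono R) simp
    also have "\<dots> = \<bar>t\<bar> / b ?M * (4/3 * B)" using b0[of ?M] by simp
    finally show ?thesis using eB by linarith
  qed
  have "(\<lambda>m. sqrt (4 / real (m + 1)) + 2 * (1/4) ^ Suc m) \<longlonglongrightarrow> 0"
    by real_asymp
  then have "e \<longlonglongrightarrow> \<bar>t\<bar> * (4/3 * 0)" unfolding e_def by (intro tendsto_intros)
  then have e0: "e \<longlonglongrightarrow> 0" by simp
  have d0: "(\<lambda>m. char (distr PM borel (\<lambda>\<omega>. SX (J (Suc m)) \<omega> / b (Suc m))) t - cf (Suc m) (J (Suc m)) (t / L (Suc m))) \<longlonglongrightarrow> 0"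
    by (rule Lim_null_comparison[OF _ e0]) (use err in simp)
  have "(\<lambda>m. cf m (J m) (t / L m)) \<longlonglongrightarrow> char mu_P1sL t"
    unfolding char_mu by (rule cf_compound_poisson[OF Linf w0 JL])
  then have "(\<lambda>m. cf (Suc m) (J (Suc m)) (t / L (Suc m))) \<longlonglongrightarrow> char mu_P1sL t"
    by (rule LIMSEQ_Suc)
  from tendsto_add[OF d0 this]
  have "(\<lambda>m. char (distr PM borel (\<lambda>\<omega>. SX (J (Suc m)) \<omega> / b (Suc m))) t) \<longlonglongrightarrow> char mu_P1sL t" by simp
  then have "(\<lambda>m. char (distr PM borel (\<lambda>\<omega>. SX (J m) \<omega> / b m)) t) \<longlonglongrightarrow> char mu_P1sL t"
    by (rule LIMSEQ_imp_Suc)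
  then show "(\<lambda>m. char (distr PM borel (\<lambda>\<omega>. SX (J m) \<omega> / ((1/4) ^ m * L m))) t) \<longlonglongrightarrow> char mu_P1sL t"
    by (simp only: b_def)
qed

end

section \<open>Choice of the scales\<close>

text \<open>A quadratic exponent makes consecutive ratios 4^{-(2m+3)}, which is below the 16^{-m}
  required by \<open>wt_ratio\<close>; starting at exponent 1 gives the bound 1/4.\<close>

definition wt :: "nat \<Rightarrow> real" where
  "wt m = (1/4) ^ ((m + 1)\<^sup>2)"

lemma wt_pos: "0 < wt m"
  by (simp add: wt_def)

lemma wt_le_power: "wt m \<le> (1/4) ^ (m + 1)"
  unfolding wt_def by (rule power_decreasing) (simp_all add: power2_eq_square)

lemma wt_le: "wt m \<le> 1/4"
proof -
  have "(1/4::real) ^ (m + 1) \<le> (1/4) ^ 1" by (rule power_decreasing) auto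
  then show ?thesis using wt_le_power[of m] by simp
qed

lemma summable_wt: "summable wt"
proof (rule summable_comparison_test')
  show "summable (\<lambda>m. (1/4::real) ^ (m + 1))" using summable_quarter by (simp add: summable_mult)
  show "norm (wt m) \<le> (1/4) ^ (m + 1)" if "m \<ge> 0" for m
    using wt_le_power[of m] wt_pos[of m] by simp
qed

lemma wt_ratio: "wt (Suc m) \<le> wt m * ((1/4) ^ m)\<^sup>2"
proof -
  have "wt m * ((1/4) ^ m)\<^sup>2 = (1/4) ^ ((m + 1)\<^sup>2 + m * 2)" by (simp add: wt_def power_add power_mult)
  moreover have "(1/4::real) ^ ((Suc m + 1)\<^sup>2) \<le> (1/4) ^ ((m + 1)\<^sup>2 + m * 2)"
    by (rule power_decreasing) (simp_all add: power2_eq_square)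
  ultimately show ?thesis by (simp add: wt_def)
qed

lemma wt_Suc_le: "4 * wt (Suc m) \<le> wt m"
proof -
  have "(1/4::real) ^ ((Suc m + 1)\<^sup>2) \<le> (1/4) ^ ((m + 1)\<^sup>2 + 1)"
    by (rule power_decreasing) (simp_all add: power2_eq_square)
  then show ?thesis by (simp add: wt_def)
qed

lemma decseq_wt: "decseq wt"
  by (rule decseq_SucI) (use wt_Suc_le wt_pos in \<open>smt (verit)\<close>)

text \<open>On the block from \<open>N m\<close> to \<open>N (Suc m)\<close> component
  \<open>m\<close> serves the variance: there \<open>q n\<close> is below half of its factor
  \<open>\<kappa> m\<close>, and \<open>2 * n \<le> L m\<close>. The thresholds \<open>N\<close>
  depend on \<open>q\<close> and the weights only, so \<open>L\<close> can be chosen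
  afterwards.\<close>

lemma exists_scales:
  fixes q :: "nat \<Rightarrow> real"
  assumes q: "q \<longlonglongrightarrow> 0"
  obtains N :: "nat \<Rightarrow> nat" and L :: "nat \<Rightarrow> real" where
    "strict_mono N"
    "\<And>m n. N m \<le> n \<Longrightarrow> q n \<le> ((1/4) ^ m)\<^sup>2 * wt m / 2"
    "\<And>m. 2 \<le> L m" "\<And>m. 2 * real (N (Suc m)) \<le> L m"
    "\<And>m. real (m + 1) \<le> wt m * L m * ((1/4) ^ m)\<^sup>2"
    "\<And>m. L m * real (m + 1) \<le> L (Suc m) * wt (Suc m) * ((1/4) ^ Suc m)\<^sup>2"
proof -
  define \<kappa> where "\<kappa> m = ((1/4) ^ m)\<^sup>2 * wt m" for m
  have \<kappa>: "0 < \<kappa> m" for m using wt_pos by (simp add: \<kappa>_def)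
  have "\<exists>N. \<forall>n\<ge>N. q n \<le> \<kappa> m / 2" for m
  proof -
    have "\<forall>\<^sub>F n in sequentially. q n < \<kappa> m / 2" using q \<kappa>[of m] by (intro order_tendstoD) auto
    then show ?thesis by (auto simp: eventually_sequentially intro: less_imp_le)
  qed
  then obtain N0 where N0: "\<And>m n. N0 m \<le> n \<Longrightarrow> q n \<le> \<kappa> m / 2" by metis
  \<comment> \<open>Partial sums dominate \<open>N0\<close> and, with 1 added to each term, increase
    strictly.\<close>
  define N where "N m = (\<Sum>i\<le>m. N0 i + 1)" for m
  have N: "strict_mono N" unfolding strict_mono_Suc_iff by (simp add: N_def)
  have N0N: "N0 m \<le> N m" for m
    unfolding N_def using member_le_sum[of m "{..m}" "\<lambda>i. N0 i + 1"] by simp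
  \<comment> \<open>\<open>B\<close> collects the demands on \<open>L m\<close> that do not involve
    earlier values; the recursion below adds the growth condition.\<close>
  define B where "B m = max 2 (max (2 * real (N (Suc m))) (real (m + 1) / \<kappa> m))" for m
  define L where "L = rec_nat (B 0) (\<lambda>m l. max (B (Suc m)) (l * real (m + 1) / \<kappa> (Suc m)))"
  have LB: "B m \<le> L m" for m by (cases m) (auto simp: L_def)
  have LS: "L m * real (m + 1) / \<kappa> (Suc m) \<le> L (Suc m)" for m by (simp add: L_def)
  show ?thesis
  proof (rule that[of N L])
    show "strict_mono N" by (rule N)
    show "q n \<le> ((1/4) ^ m)\<^sup>2 * wt m / 2" if "N m \<le> n" for m n
      using N0[of m n] N0N[of m] that by (simp add: \<kappa>_def)
    show "2 \<le> L m" for m using LB[of m] by (simp add: B_def)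
    show "2 * real (N (Suc m)) \<le> L m" for m using LB[of m] by (simp add: B_def)
    show "real (m + 1) \<le> wt m * L m * ((1/4) ^ m)\<^sup>2" for m
    proof -
      have "real (m + 1) / \<kappa> m \<le> L m" using LB[of m] by (simp add: B_def)
      then have "real (m + 1) \<le> L m * \<kappa> m" using \<kappa>[of m] by (subst (asm) pos_divide_le_eq)
      then show ?thesis by (simp only: \<kappa>_def mult_ac)
    qed
    show "L m * real (m + 1) \<le> L (Suc m) * wt (Suc m) * ((1/4) ^ Suc m)\<^sup>2" for m
    proof -
      have "L m * real (m + 1) \<le> L (Suc m) * \<kappa> (Suc m)"
        using LS[of m] \<kappa>[of "Suc m"] by (subst (asm) pos_divide_le_eq)
      then show ?thesis by (simp only: \<kappa>_def mult_ac)
    qed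
  qed
qed

theorem theorem3p4:
  fixes q :: "nat \<Rightarrow> real"
  assumes "\<forall>n\<ge>1. q n > 0"
    and "q \<longlonglongrightarrow> 0"
  shows "\<exists>(M :: (int \<Rightarrow> real) measure) (S :: real set) (X :: int \<Rightarrow> (int \<Rightarrow> real) \<Rightarrow> real).
    countable_state_markov_chain M S X \<and>
    strictly_stationary M X \<and>
    irreducible_chain M S X \<and>
    aperiodic_chain M S X \<and>
    beta_mixing M X \<and>
    reversible M X \<and>
    (\<exists>C>0. \<P>(\<omega> in M. \<bar>X 0 \<omega>\<bar> \<le> C) = 1) \<and>
    (\<exists>N::nat. N > 0 \<and>
       (\<forall>n\<ge>N. prob_space.variance M (\<lambda>\<omega>. \<Sum>k=1..n. X (int k) \<omega>) \<ge> q n * (real n)\<^sup>2)) \<and>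
    (integrable M (\<lambda>\<omega>. (X 0 \<omega>)\<^sup>2) \<and>
     prob_space.expectation M (X 0) = 0 \<and>
     filterlim (\<lambda>n::nat. prob_space.variance M (\<lambda>\<omega>. \<Sum>k=1..n. X (int k) \<omega>) / real n)
       at_top sequentially \<and>
     (\<forall>c>0. (\<lambda>n::nat. SUP r::real.
         \<P>(\<omega> in M. r - c < (\<Sum>k=1..n. X (int k) \<omega>) / sqrt (real n) \<and>
                   (\<Sum>k=1..n. X (int k) \<omega>) / sqrt (real n) < r + c)) \<longlonglongrightarrow> 0)) \<and>
    (\<exists>(J :: nat \<Rightarrow> nat) (b :: nat \<Rightarrow> real).
       strict_mono_on {1..} J \<and> (\<forall>n\<ge>1. J n > 0) \<and>
       (\<forall>n\<ge>1. b n > 0) \<and> filterlim b at_top sequentially \<and>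
       weak_conv_m (\<lambda>n. distr M borel (\<lambda>\<omega>. (\<Sum>k=1..J n. X (int k) \<omega>) / b n)) mu_P1sL)"
proof -
  \<comment> \<open>The lower bound $n^{-1/2}$ makes the variance estimate also yield $\mathrm{Var}(S_n)/n \to \infty$.\<close>
  define q' where "q' n = max (q n) (1 / sqrt (real n))" for n
  have "(\<lambda>n. 1 / sqrt (real n)) \<longlonglongrightarrow> 0" by real_asymp
  then have "q' \<longlonglongrightarrow> max 0 0" unfolding q'_def by (intro tendsto_max assms(2))
  then have "q' \<longlonglongrightarrow> 0" by simp
  from exists_scales[OF this] obtain N L where N: "strict_mono N"
    and Nq: "\<And>m n. N m \<le> n \<Longrightarrow> q' n \<le> ((1/4) ^ m)\<^sup>2 * wt m / 2"
    and L2: "\<And>m. 2 \<le> L m" and LN: "\<And>m. 2 * real (N (Suc m)) \<le> L m"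
    and Lbig: "\<And>m. real (m + 1) \<le> wt m * L m * ((1/4) ^ m)\<^sup>2"
    and growth: "\<And>m. L m * real (m + 1) \<le> L (Suc m) * wt (Suc m) * ((1/4) ^ Suc m)\<^sup>2"
    by metis
  interpret product_chain L wt
  proof
    show "1 < L m" for m using L2[of m] by simp
  qed (use wt_pos wt_le summable_wt in auto)
  have a1: "(1/4::real) ^ m \<le> 1" "0 < (1/4::real) ^ m" for m by (auto simp: power_le_one)
  have L0: "0 < L m" for m using L2[of m] by simp
  \<comment> \<open>\<open>Lbig\<close> is the stronger demand; the factor dropped from it is at
    most 1. Hence the normalisers tend to infinity too.\<close>
  have aL: "real (m + 1) \<le> (1/4) ^ m * L m" for m
  proof -
    have "wt m * (1/4) ^ m \<le> 1 * 1" using wt_le[of m] wt_pos[of m] a1[of m] by (intro mult_mono) auto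
    then have "(wt m * (1/4) ^ m) * ((1/4) ^ m * L m) \<le> 1 * ((1/4) ^ m * L m)"
      using a1[of m] L0[of m] by (intro mult_right_mono) auto
    then show ?thesis using Lbig[of m] by (simp add: power2_eq_square mult_ac)
  qed
  have Linc: "incseq L"
  proof (rule incseq_SucI)
    fix m
    have "L m * 1 \<le> L m * real (m + 1)" using L0[of m] by (intro mult_left_mono) auto
    also have "\<dots> \<le> L (Suc m) * (wt (Suc m) * ((1/4) ^ Suc m)\<^sup>2)" using growth[of m] by (simp only: mult_ac)
    also have "\<dots> \<le> L (Suc m) * (1 * 1)"
      using wt_le[of "Suc m"] wt_pos[of "Suc m"] a1[of "Suc m"] L0[of "Suc m"]
      by (intro mult_left_mono mult_mono power_le_one) auto
    finally show "L m \<le> L (Suc m)" by simp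
  qed
  have rinf: "filterlim (\<lambda>m. real (m + 1)) at_top sequentially" by real_asymp
  have Linf: "filterlim L at_top sequentially"
  proof (rule filterlim_at_top_mono[OF rinf], intro always_eventually allI)
    fix m
    have "(1/4) ^ m * L m \<le> 1 * L m" using a1[of m] L0[of m] by (intro mult_right_mono) auto
    then show "real (m + 1) \<le> L m" using aL[of m] by linarith
  qed
  have binf: "filterlim (\<lambda>m. (1/4) ^ m * L m) at_top sequentially"
    by (rule filterlim_at_top_mono[OF rinf]) (use aL in \<open>intro always_eventually allI\<close>)
  have big: "filterlim (\<lambda>m. wt m * L m * ((1/4) ^ m)\<^sup>2) at_top sequentially"
    by (rule filterlim_at_top_mono[OF rinf]) (use Lbig in \<open>intro always_eventually allI\<close>)
  have var_low: "q' n * (real n)\<^sup>2 \<le> variance (SX n)" if n: "N 0 \<le> n" for n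
  proof -
    \<comment> \<open>The block that contains \<open>n\<close>. The maximum exists because a
      strictly increasing \<open>N\<close> satisfies \<open>k \<le> N k\<close>.\<close>
    define m where "m = (GREATEST m. N m \<le> n)"
    have bd: "k \<le> n" if "N k \<le> n" for k using strict_mono_imp_increasing[OF N, of k] that by linarith
    have m: "N m \<le> n" unfolding m_def by (rule GreatestI_nat[of _ 0 n]) (use n bd in auto)
    have "\<not> N (Suc m) \<le> n"
    proof
      assume "N (Suc m) \<le> n"
      then have "Suc m \<le> m" unfolding m_def by (rule Greatest_le_nat[of _ _ n]) (use bd in auto)
      then show False by simp
    qed
    then have "2 * real n \<le> L m" using LN[of m] by linarith
    from variance_SX_ge[OF this] have "((1/4) ^ m)\<^sup>2 * wt m / 2 * (real n)\<^sup>2 \<le> variance (SX n)" .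
    moreover have "q' n * (real n)\<^sup>2 \<le> ((1/4) ^ m)\<^sup>2 * wt m / 2 * (real n)\<^sup>2"
      by (rule mult_right_mono[OF Nq[OF m]]) simp
    ultimately show ?thesis by linarith
  qed
  \<comment> \<open>A refreshment comes every \<open>L m\<close> steps on average and is nonzero
    with probability \<open>wt m\<close>, so L/w is the mean waiting time for one new
    excursion.\<close>
  define J where "J m = nat \<lceil>L m / wt m\<rceil>" for m
  have J1: "L m / wt m \<le> real (J m)" for m unfolding J_def by linarith
  have J2: "real (J m) \<le> L m / wt m + 1" for m
    unfolding J_def using L0[of m] wt_pos[of m] by (simp add: ceiling_less_iff of_nat_nat)
  \<comment> \<open>L/w is at least 1 and at least quadruples, which outweighs the rounding by at
    most 1.\<close>
  have Jstep: "J m < J (Suc m)" for m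
  proof -
    have r1: "1 \<le> L m / wt m" using L2[of m] wt_le[of m] wt_pos[of m] by (simp add: le_divide_eq)
    have "L m * (4 * wt (Suc m)) \<le> L (Suc m) * wt m"
      using incseqD[OF Linc, of m "Suc m"] wt_Suc_le[of m] L0 wt_pos by (intro mult_mono) (auto intro: less_imp_le)
    then have "4 * (L m / wt m) \<le> L (Suc m) / wt (Suc m)"
      using wt_pos[of m] wt_pos[of "Suc m"] by (simp add: field_simps)
    then have "real (J m) < real (J (Suc m))" using J2[of m] J1[of "Suc m"] r1 by linarith
    then show ?thesis by simp
  qed
  have wc: "weak_conv_m (\<lambda>m. distr PM borel (\<lambda>\<omega>. SX (J m) \<omega> / ((1/4) ^ m * L m))) mu_P1sL"
    by (rule weak_conv_SX[OF Linc decseq_wt growth wt_ratio Linf J1 J2])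
  show ?thesis
  proof (intro exI[of _ PM] exI[of _ states] exI[of _ X] conjI allI impI)
    show "countable_state_markov_chain PM states X" by (rule W.countable_markov)
    show "strictly_stationary PM X" by (rule W.stationary)
    show "irreducible_chain PM states X" by (rule W.irreducible)
    show "aperiodic_chain PM states X" by (rule W.aperiodic)
    show "beta_mixing PM X" by (rule W.beta_mixing)
    show "reversible PM X" by (rule W.reversible)
    have "{\<omega> \<in> space PM. \<bar>X 0 \<omega>\<bar> \<le> 4/3} = space PM" using X_abs_le by auto
    then show "\<exists>C>0. prob {\<omega> \<in> space PM. \<bar>X 0 \<omega>\<bar> \<le> C} = 1"
      using prob_space by (intro exI[of _ "4/3"]) (simp only:, simp)
    show "\<exists>N::nat. N > 0 \<and> (\<forall>n\<ge>N. variance (\<lambda>\<omega>. \<Sum>k=1..n. X (int k) \<omega>) \<ge> q n * (real n)\<^sup>2)"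
    proof (intro exI[of _ "N 0 + 1"] conjI allI impI)
      fix n assume "N 0 + 1 \<le> n"
      then have "q' n * (real n)\<^sup>2 \<le> variance (SX n)" by (intro var_low) simp
      moreover have "q n * (real n)\<^sup>2 \<le> q' n * (real n)\<^sup>2" by (intro mult_right_mono) (auto simp: q'_def)
      ultimately show "q n * (real n)\<^sup>2 \<le> variance (\<lambda>\<omega>. \<Sum>k=1..n. X (int k) \<omega>)" unfolding SX_def[symmetric] by linarith
    qed simp
    show "integrable PM (\<lambda>\<omega>. (X 0 \<omega>)\<^sup>2)"
    proof (rule integrable_bounded[of _ "(4/3)\<^sup>2"])
      show "norm ((X 0 \<omega>)\<^sup>2) \<le> (4/3)\<^sup>2" for \<omega> using power_mono[OF X_abs_le[of 0 \<omega>], of 2] by simp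
    qed measurable
    show "expectation (X 0) = 0" by (rule expectation_X)
    show "filterlim (\<lambda>n. variance (\<lambda>\<omega>. \<Sum>k=1..n. X (int k) \<omega>) / real n) at_top sequentially"
      unfolding SX_def[symmetric]
    proof (rule filterlim_at_top_mono)
      show "filterlim (\<lambda>n. sqrt (real n)) at_top sequentially" by real_asymp
      show "\<forall>\<^sub>F n in sequentially. sqrt (real n) \<le> variance (SX n) / real n"
        using eventually_ge_at_top[of "N 0 + 1"]
      proof eventually_elim
        case (elim n)
        then have n0: "0 < real n" by simp
        have "1 / sqrt (real n) * (real n)\<^sup>2 \<le> q' n * (real n)\<^sup>2" by (intro mult_right_mono) (auto simp: q'_def)
        also have "\<dots> \<le> variance (SX n)" using elim by (intro var_low) simp
        finally have "1 / sqrt (real n) * (real n)\<^sup>2 / real n \<le> variance (SX n) / real n"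
          using n0 by (intro divide_right_mono) auto
        moreover have "1 / sqrt (real n) * (real n)\<^sup>2 / real n = sqrt (real n)"
          using n0 by (simp add: power2_eq_square real_div_sqrt)
        ultimately show ?case by simp
      qed
    qed
    show "(\<lambda>n::nat. SUP r::real. prob {\<omega> \<in> space PM. r - c < (\<Sum>k=1..n. X (int k) \<omega>) / sqrt (real n) \<and>
                   (\<Sum>k=1..n. X (int k) \<omega>) / sqrt (real n) < r + c}) \<longlonglongrightarrow> 0" if "0 < c" for c
      using concentration_SX[OF big that] by (simp only: SX_def)
    show "\<exists>(J :: nat \<Rightarrow> nat) (b :: nat \<Rightarrow> real).
       strict_mono_on {1..} J \<and> (\<forall>n\<ge>1. J n > 0) \<and>
       (\<forall>n\<ge>1. b n > 0) \<and> filterlim b at_top sequentially \<and>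
       weak_conv_m (\<lambda>n. distr PM borel (\<lambda>\<omega>. (\<Sum>k=1..J n. X (int k) \<omega>) / b n)) mu_P1sL"
    proof (intro exI[of _ J] exI[of _ "\<lambda>m. (1/4) ^ m * L m"] conjI allI impI)
      have "strict_mono J" unfolding strict_mono_Suc_iff using Jstep by blast
      then show "strict_mono_on {1..} J" by (auto simp: strict_mono_on_def strict_mono_def)
      show "0 < J n" if "1 \<le> n" for n
        using J1[of n] L0[of n] wt_pos[of n] by (metis divide_pos_pos less_le_trans of_nat_0_less_iff)
      show "0 < (1/4) ^ n * L n" if "1 \<le> n" for n using L0 by simp
      show "filterlim (\<lambda>m. (1/4) ^ m * L m) at_top sequentially" by (rule binf)
      show "weak_conv_m (\<lambda>n. distr PM borel (\<lambda>\<omega>. (\<Sum>k=1..J n. X (int k) \<omega>) / ((1/4) ^ n * L n))) mu_P1sL"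
        using wc by (simp only: SX_def)
    qed
  qed
qed

end
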